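(* Let $T$ be any ideal triangulation of an oriented punctured surface $S$, and let $\gamma$ be a simple closed curve in $S$ not retractible to a puncture or to a point of $S$. Suppose $\gamma$ has been continuously deformed so that the ideal arcs of $T$ divide $\gamma$ into loop segments, each of which connects two distinct ideal arcs. Then it is possible to choose, for each ideal triangle of $T$, a total ordering on the set of all loop segments living in this triangle, so that these orderings for triangles are compatible at each ideal arc of $T$.
   Context: An oriented punctured surface $S$ is a compact connected oriented surface of genus $g$ minus $s\ge1$ points (punctures), with $2-2g-s<0$. An ideal arc is a homotopy class of unoriented non-self-intersecting paths running between (not necessarily distinct) punctures, not homotopic to a point or a puncture. An ideal triangulation $T$ is a maximal collection of distinct ideal arcs having representatives that are pairwise disjoint except at endpoints (representatives are fixed). It divides $S$ into ideal triangles, each bounded by three sides that are arcs of $T$; a triangle with only two distinct sides is self-folded, and its multiplicity-two side is a self-folded arc. The curve $\gamma$ remains simple under the deformation. The junctures are the intersection points of $\gamma$ with the ideal arcs of $T$; they divide $\gamma$ into loop segments, each lying in one ideal triangle and connecting the arcs that contain its two endpoints. Each juncture on an arc is attached to two loop segments, one on each of the two local sides of the arc. Compatibility at an ideal arc $e$: let $t,t'$ be the two triangles on the two sides of $e$. A total ordering on the loop segments in $t$ induces a total ordering on the set of junctures on $e$, by comparing the loop segments in $t$ attached to these junctures (from the side of $t$); similarly for $t'$. The orderings are compatible at $e$ if these two induced orderings on the junctures of $e$ coincide. If $e$ is a self-folded arc, then $t=t'$ and the two induced orderings are those coming from the loop segments attached from the two local sides of $e$. *)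

theory Defs
  imports "HOL-Complex_Analysis.Complex_Analysis"
begin

section \<open>Oriented closed surfaces and their genus\<close>

text \<open>A homeomorphism between open subsets of the plane preserves orientation at a point if it
  maps small positively oriented circles around the point to loops of winding number 1.\<close>

definition orientation_preserving_at :: "(complex \<Rightarrow> complex) \<Rightarrow> complex \<Rightarrow> bool" where
  "orientation_preserving_at f z \<longleftrightarrow>
     (\<forall>\<^sub>F r in at_right 0. winding_number (f \<circ> circlepath z r) (f z) = 1)"

definition oriented_atlas ::
  "'a::topological_space set \<Rightarrow> ('a set \<times> ('a \<Rightarrow> complex)) set \<Rightarrow> bool" where
  "oriented_atlas M \<A> \<longleftrightarrow>
     (\<forall>(U, \<phi>)\<in>\<A>. openin (top_of_set M) U \<and> open (\<phi> ` U) \<and> (\<exists>\<psi>. homeomorphism U (\<phi> ` U) \<phi> \<psi>)) \<and>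
     (\<Union>(U, \<phi>)\<in>\<A>. U) = M \<and>
     (\<forall>(U, \<phi>)\<in>\<A>. \<forall>(V, \<psi>)\<in>\<A>. \<forall>x\<in>U \<inter> V.
        orientation_preserving_at (\<psi> \<circ> inv_into U \<phi>) (\<phi> x))"

text \<open>The Hausdorff axiom is supplied by the type class; a compact Hausdorff locally Euclidean
  space is automatically second countable.\<close>

definition closed_oriented_surface ::
  "'a::t2_space set \<Rightarrow> ('a set \<times> ('a \<Rightarrow> complex)) set \<Rightarrow> bool" where
  "closed_oriented_surface M \<A> \<longleftrightarrow> compact M \<and> connected M \<and> M \<noteq> {} \<and> oriented_atlas M \<A>"

text \<open>The genus is the largest number of pairwise disjoint simple closed curves that jointly do
  not disconnect the surface.\<close>

definition nonseparating_system :: "'a::topological_space set \<Rightarrow> 'a set set \<Rightarrow> bool" where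
  "nonseparating_system M \<C> \<longleftrightarrow> finite \<C> \<and> pairwise disjnt \<C> \<and>
     (\<forall>C\<in>\<C>. \<exists>c. simple_path c \<and> pathfinish c = pathstart c \<and> path_image c = C \<and> C \<subseteq> M) \<and>
     connected (M - \<Union>\<C>)"

definition has_genus :: "'a::topological_space set \<Rightarrow> nat \<Rightarrow> bool" where
  "has_genus M g \<longleftrightarrow> (\<exists>\<C>. nonseparating_system M \<C> \<and> card \<C> = g) \<and>
     (\<forall>\<C>. nonseparating_system M \<C> \<longrightarrow> card \<C> \<le> g)"

text \<open>Throughout, the punctured surface \<open>S = M - P\<close> is given by the closed surface \<open>M\<close> and the
  finite set \<open>P\<close> of punctures.\<close>

definition oriented_punctured_surface ::
  "'a::t2_space set \<Rightarrow> ('a set \<times> ('a \<Rightarrow> complex)) set \<Rightarrow> 'a set \<Rightarrow> nat \<Rightarrow> nat \<Rightarrow> bool" where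
  "oriented_punctured_surface M \<A> P g s \<longleftrightarrow>
     closed_oriented_surface M \<A> \<and> has_genus M g \<and>
     P \<subseteq> M \<and> finite P \<and> card P = s \<and> 1 \<le> s \<and> 2 - 2 * int g - int s < 0"


section \<open>Ideal arcs and ideal triangulations\<close>

definition arc_interior :: "(real \<Rightarrow> 'a) \<Rightarrow> 'a set" where
  "arc_interior \<alpha> = \<alpha> ` {0<..<1}"

definition ideal_path :: "'a::topological_space set \<Rightarrow> 'a set \<Rightarrow> (real \<Rightarrow> 'a) \<Rightarrow> bool" where
  "ideal_path M P \<alpha> \<longleftrightarrow> path \<alpha> \<and> pathstart \<alpha> \<in> P \<and> pathfinish \<alpha> \<in> P \<and> arc_interior \<alpha> \<subseteq> M - P"

text \<open>\<^const>\<open>simple_path\<close> allows the two end punctures to coincide.\<close>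

definition simple_ideal_path :: "'a::topological_space set \<Rightarrow> 'a set \<Rightarrow> (real \<Rightarrow> 'a) \<Rightarrow> bool" where
  "simple_ideal_path M P \<alpha> \<longleftrightarrow> ideal_path M P \<alpha> \<and> simple_path \<alpha>"

definition ideal_homotopic ::
  "'a::topological_space set \<Rightarrow> 'a set \<Rightarrow> (real \<Rightarrow> 'a) \<Rightarrow> (real \<Rightarrow> 'a) \<Rightarrow> bool" where
  "ideal_homotopic M P \<alpha> \<beta> \<longleftrightarrow> homotopic_with_canon (ideal_path M P) {0..1} M \<alpha> \<beta>"

text \<open>Shrinking to a point \<open>c\<close>, which may be a puncture; the intermediate paths run between
  punctures through the punctured surface as long as they are not constant.\<close>

definition ideally_trivial :: "'a::topological_space set \<Rightarrow> 'a set \<Rightarrow> (real \<Rightarrow> 'a) \<Rightarrow> bool" where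
  "ideally_trivial M P \<alpha> \<longleftrightarrow>
     (\<exists>c\<in>M. homotopic_with_canon (\<lambda>h. ideal_path M P h \<or> h constant_on {0..1}) {0..1} M \<alpha> (\<lambda>_. c))"

text \<open>Homotopy classes of unoriented paths.\<close>

definition arc_class ::
  "'a::topological_space set \<Rightarrow> 'a set \<Rightarrow> (real \<Rightarrow> 'a) \<Rightarrow> (real \<Rightarrow> 'a) set" where
  "arc_class M P \<alpha> = {\<beta>. simple_ideal_path M P \<beta> \<and>
     (ideal_homotopic M P \<alpha> \<beta> \<or> ideal_homotopic M P \<alpha> (reversepath \<beta>))}"

definition ideal_arcs :: "'a::topological_space set \<Rightarrow> 'a set \<Rightarrow> (real \<Rightarrow> 'a) set set" where
  "ideal_arcs M P = arc_class M P ` {\<alpha>. simple_ideal_path M P \<alpha> \<and> \<not> ideally_trivial M P \<alpha>}"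

definition disjoint_representatives ::
  "(real \<Rightarrow> 'a) set set \<Rightarrow> ((real \<Rightarrow> 'a) set \<Rightarrow> real \<Rightarrow> 'a) \<Rightarrow> bool" where
  "disjoint_representatives T rep \<longleftrightarrow> (\<forall>e\<in>T. rep e \<in> e) \<and>
     (\<forall>e\<in>T. \<forall>e'\<in>T. e \<noteq> e' \<longrightarrow> arc_interior (rep e) \<inter> arc_interior (rep e') = {})"

text \<open>\<open>rep\<close> records the fixed representatives of the arcs of \<open>T\<close>.\<close>

definition ideal_triangulation ::
  "'a::topological_space set \<Rightarrow> 'a set \<Rightarrow> (real \<Rightarrow> 'a) set set \<Rightarrow>
   ((real \<Rightarrow> 'a) set \<Rightarrow> real \<Rightarrow> 'a) \<Rightarrow> bool" where
  "ideal_triangulation M P T rep \<longleftrightarrow>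
     T \<subseteq> ideal_arcs M P \<and> disjoint_representatives T rep \<and>
     (\<forall>T' rep'. T \<subseteq> T' \<and> T' \<subseteq> ideal_arcs M P \<and> disjoint_representatives T' rep' \<longrightarrow> T' = T)"


section \<open>Ideal triangles and local sides of arcs\<close>

definition arcs_union :: "(real \<Rightarrow> 'a) set set \<Rightarrow> ((real \<Rightarrow> 'a) set \<Rightarrow> real \<Rightarrow> 'a) \<Rightarrow> 'a set" where
  "arcs_union T rep = (\<Union>e\<in>T. arc_interior (rep e))"

definition ideal_triangles ::
  "'a::topological_space set \<Rightarrow> 'a set \<Rightarrow> (real \<Rightarrow> 'a) set set \<Rightarrow>
   ((real \<Rightarrow> 'a) set \<Rightarrow> real \<Rightarrow> 'a) \<Rightarrow> 'a set set" where
  "ideal_triangles M P T rep = components (M - P - arcs_union T rep)"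

definition corner :: "nat \<Rightarrow> complex" where
  "corner k = [0, 1, \<i>] ! (k mod 3)"

definition standard_triangle :: "complex set" where
  "standard_triangle = convex hull {corner 0, corner 1, corner 2}"

definition side :: "nat \<Rightarrow> complex set" where
  "side k = open_segment (corner k) (corner (Suc k))"

text \<open>A characteristic map of an ideal triangle \<open>t\<close> presents it as a triangle with three sides that
  are arcs of \<open>T\<close>. In a self-folded triangle two of the sides are mapped to the same arc.\<close>

definition characteristic_map ::
  "'a::topological_space set \<Rightarrow> 'a set \<Rightarrow> (real \<Rightarrow> 'a) set set \<Rightarrow>
   ((real \<Rightarrow> 'a) set \<Rightarrow> real \<Rightarrow> 'a) \<Rightarrow> 'a set \<Rightarrow> (complex \<Rightarrow> 'a) \<Rightarrow> bool" where
  "characteristic_map M P T rep t f \<longleftrightarrow>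
     continuous_on standard_triangle f \<and> f ` standard_triangle \<subseteq> M \<and>
     (\<exists>g. homeomorphism (interior standard_triangle) t f g) \<and>
     (\<forall>k<3. f (corner k) \<in> P) \<and>
     (\<forall>k<3. \<exists>e\<in>T. \<exists>g. homeomorphism (side k) (arc_interior (rep e)) f g)"

definition characteristic_maps ::
  "'a::topological_space set \<Rightarrow> 'a set \<Rightarrow> (real \<Rightarrow> 'a) set set \<Rightarrow>
   ((real \<Rightarrow> 'a) set \<Rightarrow> real \<Rightarrow> 'a) \<Rightarrow> ('a set \<Rightarrow> complex \<Rightarrow> 'a) \<Rightarrow> bool" where
  "characteristic_maps M P T rep \<tau> \<longleftrightarrow>
     (\<forall>t\<in>ideal_triangles M P T rep. characteristic_map M P T rep t (\<tau> t))"

text \<open>A local side of the arc \<open>e\<close> is a side of a triangle that is mapped to \<open>e\<close>. The two local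
  sides of a self-folded arc belong to the same triangle but to different sides of it.\<close>

definition local_sides ::
  "'a::topological_space set \<Rightarrow> 'a set \<Rightarrow> (real \<Rightarrow> 'a) set set \<Rightarrow>
   ((real \<Rightarrow> 'a) set \<Rightarrow> real \<Rightarrow> 'a) \<Rightarrow> ('a set \<Rightarrow> complex \<Rightarrow> 'a) \<Rightarrow>
   (real \<Rightarrow> 'a) set \<Rightarrow> ('a set \<times> nat) set" where
  "local_sides M P T rep \<tau> e =
     {(t, k). t \<in> ideal_triangles M P T rep \<and> k < 3 \<and> \<tau> t ` side k = arc_interior (rep e)}"


section \<open>Simple closed curves, junctures and loop segments\<close>

definition simple_loop :: "'a::topological_space set \<Rightarrow> (real \<Rightarrow> 'a) \<Rightarrow> bool" where
  "simple_loop S \<gamma> \<longleftrightarrow> simple_path \<gamma> \<and> pathfinish \<gamma> = pathstart \<gamma> \<and> path_image \<gamma> \<subseteq> S"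

text \<open>Retraction of a loop to a point \<open>c\<close> of the surface or to a puncture \<open>c\<close>: the intermediate
  loops lie in the punctured surface unless they are constant.\<close>

definition retractible :: "'a::topological_space set \<Rightarrow> 'a set \<Rightarrow> (real \<Rightarrow> 'a) \<Rightarrow> bool" where
  "retractible M P \<gamma> \<longleftrightarrow>
     (\<exists>c\<in>M. homotopic_with_canon
        (\<lambda>h. pathfinish h = pathstart h \<and> (path_image h \<subseteq> M - P \<or> h constant_on {0..1}))
        {0..1} M \<gamma> (\<lambda>_. c))"

text \<open>A deformation keeping the loop simple.\<close>

definition deforms_to ::
  "'a::topological_space set \<Rightarrow> (real \<Rightarrow> 'a) \<Rightarrow> (real \<Rightarrow> 'a) \<Rightarrow> bool" where
  "deforms_to S \<gamma> \<gamma>' \<longleftrightarrow> homotopic_with_canon (simple_loop S) {0..1} S \<gamma> \<gamma>'"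

definition junctures ::
  "((real \<Rightarrow> 'a::topological_space) set \<Rightarrow> real \<Rightarrow> 'a) \<Rightarrow> (real \<Rightarrow> 'a) \<Rightarrow> (real \<Rightarrow> 'a) set \<Rightarrow> 'a set"
  where "junctures rep \<gamma> e = path_image \<gamma> \<inter> arc_interior (rep e)"

text \<open>Loop segments are taken without their endpoints.\<close>

definition loop_segments ::
  "(real \<Rightarrow> 'a::topological_space) set set \<Rightarrow> ((real \<Rightarrow> 'a) set \<Rightarrow> real \<Rightarrow> 'a) \<Rightarrow>
   (real \<Rightarrow> 'a) \<Rightarrow> 'a set set" where
  "loop_segments T rep \<gamma> = components (path_image \<gamma> - arcs_union T rep)"

definition segments_in ::
  "(real \<Rightarrow> 'a::topological_space) set set \<Rightarrow> ((real \<Rightarrow> 'a) set \<Rightarrow> real \<Rightarrow> 'a) \<Rightarrow>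
   (real \<Rightarrow> 'a) \<Rightarrow> 'a set \<Rightarrow> 'a set set" where
  "segments_in T rep \<gamma> t = {\<sigma> \<in> loop_segments T rep \<gamma>. \<sigma> \<subseteq> t}"

definition connects_distinct_arcs ::
  "(real \<Rightarrow> 'a::topological_space) set set \<Rightarrow> ((real \<Rightarrow> 'a) set \<Rightarrow> real \<Rightarrow> 'a) \<Rightarrow> 'a set \<Rightarrow> bool" where
  "connects_distinct_arcs T rep \<sigma> \<longleftrightarrow>
     (\<exists>e\<in>T. \<exists>e'\<in>T. e \<noteq> e' \<and>
       (\<exists>j\<in>arc_interior (rep e). \<exists>j'\<in>arc_interior (rep e'). closure \<sigma> - \<sigma> = {j, j'}))"

text \<open>The segment \<open>\<sigma>\<close>, viewed inside the standard triangle, runs into a point of side \<open>k\<close> lying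
  over the juncture \<open>j\<close>.\<close>

definition attached ::
  "(real \<Rightarrow> 'a::topological_space) set set \<Rightarrow> ((real \<Rightarrow> 'a) set \<Rightarrow> real \<Rightarrow> 'a) \<Rightarrow>
   ('a set \<Rightarrow> complex \<Rightarrow> 'a) \<Rightarrow> (real \<Rightarrow> 'a) \<Rightarrow> 'a set \<times> nat \<Rightarrow> 'a \<Rightarrow> 'a set \<Rightarrow> bool" where
  "attached T rep \<tau> \<gamma> = (\<lambda>(t, k) j \<sigma>. \<sigma> \<in> segments_in T rep \<gamma> t \<and>
     (\<exists>z\<in>side k. \<tau> t z = j \<and> z \<in> closure {w \<in> interior standard_triangle. \<tau> t w \<in> \<sigma>}))"

text \<open>The last clause says that the curve crosses the arc at each juncture instead of merely
  touching it.\<close>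

definition divided_into_segments ::
  "'a::topological_space set \<Rightarrow> 'a set \<Rightarrow> (real \<Rightarrow> 'a) set set \<Rightarrow>
   ((real \<Rightarrow> 'a) set \<Rightarrow> real \<Rightarrow> 'a) \<Rightarrow> ('a set \<Rightarrow> complex \<Rightarrow> 'a) \<Rightarrow> (real \<Rightarrow> 'a) \<Rightarrow> bool" where
  "divided_into_segments M P T rep \<tau> \<gamma> \<longleftrightarrow>
     finite (path_image \<gamma> \<inter> arcs_union T rep) \<and>
     (\<forall>e\<in>T. \<forall>j\<in>junctures rep \<gamma> e. \<forall>a\<in>local_sides M P T rep \<tau> e. \<exists>!\<sigma>. attached T rep \<tau> \<gamma> a j \<sigma>)"


section \<open>Orderings and compatibility\<close>

definition induced_ordering ::
  "(real \<Rightarrow> 'a::topological_space) set set \<Rightarrow> ((real \<Rightarrow> 'a) set \<Rightarrow> real \<Rightarrow> 'a) \<Rightarrow>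
   ('a set \<Rightarrow> complex \<Rightarrow> 'a) \<Rightarrow> (real \<Rightarrow> 'a) \<Rightarrow> ('a set \<Rightarrow> 'a set rel) \<Rightarrow>
   (real \<Rightarrow> 'a) set \<Rightarrow> 'a set \<times> nat \<Rightarrow> 'a rel" where
  "induced_ordering T rep \<tau> \<gamma> R e a =
     {(j, j'). j \<in> junctures rep \<gamma> e \<and> j' \<in> junctures rep \<gamma> e \<and>
        (\<exists>\<sigma> \<sigma>'. attached T rep \<tau> \<gamma> a j \<sigma> \<and> attached T rep \<tau> \<gamma> a j' \<sigma>' \<and> (\<sigma>, \<sigma>') \<in> R (fst a))}"

definition compatible_at ::
  "'a::topological_space set \<Rightarrow> 'a set \<Rightarrow> (real \<Rightarrow> 'a) set set \<Rightarrow>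
   ((real \<Rightarrow> 'a) set \<Rightarrow> real \<Rightarrow> 'a) \<Rightarrow> ('a set \<Rightarrow> complex \<Rightarrow> 'a) \<Rightarrow> (real \<Rightarrow> 'a) \<Rightarrow>
   ('a set \<Rightarrow> 'a set rel) \<Rightarrow> (real \<Rightarrow> 'a) set \<Rightarrow> bool" where
  "compatible_at M P T rep \<tau> \<gamma> R e \<longleftrightarrow>
     (\<forall>a\<in>local_sides M P T rep \<tau> e. \<forall>b\<in>local_sides M P T rep \<tau> e.
        induced_ordering T rep \<tau> \<gamma> R e a = induced_ordering T rep \<tau> \<gamma> R e b)"

end

(*
  Each triangle is a vertex and each arc an edge of the graph dual to the triangulation, and the
  curve becomes a closed walk in this graph. The required orderings are heights on the passages of
  the walk through the vertices such that the order of any two passages is preserved along common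
  edges, i.e. a "stacking" of the walk. A reduced closed walk that is not a proper power has a
  stacking: as long as two passages through the same vertex are not separated, some integer
  cocycle on the graph that vanishes on the walk but not on the part of the walk between two such
  passages provides a height; the walk is lifted to the corresponding infinite cyclic cover, and
  the heights are combined lexicographically. Each lift increases the number of visited vertices,
  so this terminates. It is only for showing that the walk is not a proper power that the
  topology of the surface is needed: parallel segments in a triangle do not cross (Fashoda
  theorem), and triangles are glued along arcs compatibly with the orientation (winding numbers),
  so a curve that runs several times around a shorter cycle would drift to one side and never
  close up.
*)
theory Submission
  imports Defs
begin

section \<open>Stackings of closed walks in graphs\<close>

text \<open>Why a separating cocycle exists: for each side \<open>s\<close>, the signed number of
  crossings of its edge is a cocycle, and the combinations \<open>G s' * F s - G s * F s'\<close>,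
  with \<open>G\<close> the net number per round, vanish on the whole walk; so does
  \<open>F s\<close> itself if \<open>G s = 0\<close>. If none of these separates two visits to a
  vertex, the crossing numbers on every return to a vertex are proportional to the net numbers. A
  shortest return crosses each of its edges exactly once, so an edge outside it has crossing number
  0 on every return. But a walk that ever left the shortest return would, at the next repetition of
  a vertex, close a return that crosses an outside edge exactly once. So the walk repeats the
  shortest return forever and is a proper power.

  The dual graph may have multiple edges, and a self-folded arc gives a loop; the walk is therefore
  recorded by local sides of arcs and not by its vertices alone. It is indexed by all integers with
  period \<open>n\<close>, which removes case distinctions at the base point; in exchange, data
  chosen separately for each index have to be proved periodic.\<close>

lemma int_primitive:
  fixes f :: "int \<Rightarrow> int"
  obtains F where "\<And>r. F r - F (r - 1) = f r"
proof
  fix r :: int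
  \<comment> \<open>These are the partial sums to the right and to the left of 0; for each argument
    at least one of the two sums is empty.\<close>
  let ?F = "\<lambda>r. sum f {1..r} - sum f {r+1..0}"
  show "?F r - ?F (r - 1) = f r"
  proof (cases "r \<ge> 1")
    case True
    then have "{1..r} = insert r {1..r-1}" by auto
    with True show ?thesis by simp
  next
    case False
    then have "{r..0} = insert r {r+1..0}" by auto
    with False show ?thesis by simp
  qed
qed

lemma primitive_diff:
  fixes f F :: "int \<Rightarrow> int"
  assumes "\<And>r. F r - F (r - 1) = f r" "i \<le> k"
  shows "F k - F i = sum f {i<..k}"
  using assms(2)
proof (induction k rule: int_ge_induct)
  case base show ?case by simp
next
  case (step k)
  have "{i<..k+1} = insert (k+1) {i<..k}" using step by auto
  with step assms(1)[of "k+1"] show ?case by simp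
qed

lemma periodic_mult:
  fixes f :: "int \<Rightarrow> 'c"
  assumes "\<And>r. f (r + n) = f r"
  shows "f (r + z * n) = f r"
proof (induction z rule: int_induct[where k = 0])
  case base show ?case by simp
next
  case (step1 i)
  show ?case using assms[of "r + i * n"] step1 by (simp add: algebra_simps)
next
  case (step2 i)
  show ?case using assms[of "r + (i - 1) * n"] step2 by (simp add: algebra_simps)
qed

lemma periodic_mod:
  fixes f :: "int \<Rightarrow> 'c"
  assumes "\<And>r. f (r + n) = f r"
  shows "f (r mod n) = f r"
  using periodic_mult[of f n "r mod n" "r div n", OF assms] by simp

lemma periodic_cong:
  fixes f :: "int \<Rightarrow> 'c"
  assumes "\<And>r. f (r + n) = f r" "r mod n = s mod n"
  shows "f r = f s"
  by (metis assms periodic_mod)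

text \<open>Well-ordering of a half-line of integers. Maximal choices are obtained from it by a
  change of sign.\<close>

lemma least_int:
  fixes a x :: int
  assumes "P x" "a \<le> x"
  shows "\<exists>q\<ge>a. P q \<and> (\<forall>r. a \<le> r \<and> r < q \<longrightarrow> \<not> P r)"
proof -
  define k where "k = (LEAST k. P (a + int k))"
  have "P (a + int (nat (x - a)))" using assms by simp
  then have "P (a + int k)" unfolding k_def by (rule LeastI)
  moreover have "\<not> P r" if "a \<le> r" "r < a + int k" for r
    using not_less_Least[of "nat (r - a)" "\<lambda>k. P (a + int k)"] that by (simp add: k_def[symmetric] nat_less_iff)
  ultimately show ?thesis by (intro exI[of _ "a + int k"]) auto
qed

text \<open>A closed walk of length \<open>n\<close> in a graph whose edges have two sides each: it enters its
  \<open>i\<close>-th edge from the side \<open>a i\<close>, leaves it on the side \<open>b i\<close>, and then visits the vertex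
  \<open>V (b i)\<close>.\<close>

locale closed_walk =
  fixes n :: int and a b :: "int \<Rightarrow> 'side" and V :: "'side \<Rightarrow> 'vertex"
  assumes n_pos: "n > 0"
    and a_periodic: "a (i + n) = a i" and b_periodic: "b (i + n) = b i"
    and vertex: "V (a (i + 1)) = V (b i)"
    and sides_distinct: "a i \<noteq> b i"
    and same_direction: "b i = b k \<longleftrightarrow> a i = a k"
    and opposite_direction: "b i = a k \<Longrightarrow> a i = b k"
    and reduced: "b i \<noteq> a (i + 1)"
    and aperiodic: "0 < m \<Longrightarrow> m < n \<Longrightarrow> \<exists>i. b (i + m) \<noteq> b i"
begin

abbreviation v where "v i \<equiv> V (b i)"

lemma v_before: "V (a i) = v (i - 1)"
  using vertex[of "i - 1"] by simp

text \<open>The function \<open>h\<close> is a primitive of a cocycle along the walk: its increments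
  depend only on the directed edge and change sign with the direction, and periodicity says that the
  cocycle vanishes on the whole walk. It is the sheet number of the lift to the cyclic cover
  belonging to this cocycle.\<close>

lemma separating_height:
  assumes "V (b i0) = V (b k0)" "i0 mod n \<noteq> k0 mod n"
  obtains h :: "int \<Rightarrow> int" and i k where
    "\<And>r. h (r + n) = h r"
    "\<And>i k. b i = b k \<Longrightarrow> h i - h (i - 1) = h k - h (k - 1)"
    "\<And>i k. b i = a k \<Longrightarrow> h i - h (i - 1) = h (k - 1) - h k"
    "v i = v k" "h i \<noteq> h k"
proof (rule ccontr)
  assume "\<not> thesis"
  with that have no_height: "h i = h k"
    if "\<And>r. h (r + n) = h r"
      "\<And>i k. b i = b k \<Longrightarrow> h i - h (i - 1) = h k - h (k - 1)"
      "\<And>i k. b i = a k \<Longrightarrow> h i - h (i - 1) = h (k - 1) - h k"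
      "v i = v k" for h :: "int \<Rightarrow> int" and i k
    using that by blast
  \<comment> \<open>The value is 1 if step \<open>r\<close> crosses the edge of \<open>s\<close>
    towards \<open>s\<close>, and -1 if it crosses away from \<open>s\<close>. \<open>F s\<close>
    will be the running count and \<open>G s\<close> the net count per period.\<close>
  define x :: "'side \<Rightarrow> int \<Rightarrow> int" where
    "x s r = (if b r = s then 1 else 0) - (if a r = s then 1 else 0)" for s r
  have "\<exists>F. \<forall>r. F r - F (r - 1) = x s r" for s
    using int_primitive[of "x s"] by blast
  then obtain F where F: "F s r - F s (r - 1) = x s r" for s r by metis
  have x_per: "x s (r + n) = x s r" for s r
    by (simp add: x_def a_periodic b_periodic)
  define G where "G s = F s n - F s 0" for s
  have G: "F s (r + n) = F s r + G s" for s r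
  proof (induction r rule: int_induct[where k = 0])
    case base show ?case by (simp add: G_def)
  next
    case (step1 i)
    show ?case using F[of s "i + 1 + n"] F[of s "i + 1"] x_per[of s "i+1"] step1
      by (simp add: algebra_simps)
  next
    case (step2 i)
    show ?case using F[of s "i + n"] F[of s i] x_per[of s i] step2
      by (simp add: algebra_simps)
  qed
  have x_same: "x s i = x s k" if "b i = b k" for s i k
    using that same_direction[of i k] by (simp add: x_def)
  have x_opp: "x s i = - x s k" if "b i = a k" for s i k
    using that opposite_direction[of i k] by (simp add: x_def)
  \<comment> \<open>The combination \<open>h\<close> changes by
    \<open>G s' * G s - G s * G s' = 0\<close> over one period, so it is an admissible height even
    where neither of the two counts is periodic.\<close>
  have proportional: "G s' * (F s k - F s i) = G s * (F s' k - F s' i)" if "v i = v k" for s s' i k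
  proof -
    define h where "h r = G s' * F s r - G s * F s' r" for r
    have hd: "h r - h (r - 1) = G s' * x s r - G s * x s' r" for r
      by (simp add: h_def F[symmetric] algebra_simps)
    have "h i = h k"
    proof (rule no_height[OF _ _ _ that])
      show "h (r + n) = h r" for r unfolding h_def G by (simp add: algebra_simps)
      show "h i - h (i - 1) = h k - h (k - 1)" if "b i = b k" for i k
        unfolding hd using x_same[OF that] by simp
      show "h i - h (i - 1) = h (k - 1) - h k" if "b i = a k" for i k
        using hd[of i] hd[of k] x_opp[OF that, of s] x_opp[OF that, of s'] by simp
    qed
    then show ?thesis by (simp add: h_def algebra_simps)
  qed
  have zero: "F s k = F s i" if "G s = 0" "v i = v k" for s i k
  proof -
    have "F s i = F s k"
    proof (rule no_height[OF _ _ _ that(2)])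
      show "F s (r + n) = F s r" for r by (simp add: G that)
      show "F s i - F s (i - 1) = F s k - F s (k - 1)" if "b i = b k" for i k
        unfolding F using x_same[OF that] by simp
      show "F s i - F s (i - 1) = F s (k - 1) - F s k" if "b i = a k" for i k
        using F[of s i] F[of s k] x_opp[OF that, of s] by simp
    qed
    then show ?thesis by simp
  qed
  have Fsum: "F s k - F s i = sum (x s) {i<..k}" if "i \<le> k" for s i k
    using primitive_diff[of "F s" "x s" i k] F that by blast

  define m0 where "m0 = (k0 - i0) mod n"
  have "m0 \<noteq> 0" using assms(2) by (metis m0_def mod_eq_dvd_iff dvd_eq_mod_eq_0)
  moreover have "0 \<le> m0" "m0 < n" using n_pos by (simp_all add: m0_def)
  ultimately have m0: "1 \<le> m0" "m0 < n" by linarith+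
  have "v (i0 + m0) = v k0"
    by (rule periodic_cong[of v n]) (auto simp: b_periodic m0_def mod_simps)
  then have m0_ex: "\<exists>i. v i = v (i + m0)" using assms(1) by metis
  \<comment> \<open>\<open>m\<close> is the length of a shortest return to a vertex. Minimality
    makes this return embedded, which is the fact \<open>inj\<close>, and \<open>m < n\<close>
    because the two given visits are inequivalent modulo \<open>n\<close>.\<close>
  obtain m where "1 \<le> m" and m_ex: "\<exists>i. v i = v (i + m)"
    and m_min: "\<And>r. 1 \<le> r \<Longrightarrow> r < m \<Longrightarrow> \<not> (\<exists>i. v i = v (i + r))"
    using least_int[of "\<lambda>m. \<exists>i. v i = v (i + m)" m0 1] m0(1) m0_ex by blast
  obtain i where i: "v i = v (i + m)" using m_ex by blast
  have "m \<le> m0" using m_min[OF m0(1)] m0_ex not_le by blast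
  then have m: "0 < m" "m < n" using \<open>1 \<le> m\<close> m0 by auto
  define j where "j = i + m"
  have vij: "v i = v j" and ij: "i < j" using i m by (auto simp: j_def)
  have inj: "p = q" if "v p = v q" "\<bar>p - q\<bar> < m" for p q
  proof (rule ccontr)
    assume "p \<noteq> q"
    have "v (min p q) = v (min p q + \<bar>p - q\<bar>)"
      by (cases "p < q") (auto simp: that)
    then show False using m_min[of "\<bar>p - q\<bar>"] \<open>p \<noteq> q\<close> that(2) by auto
  qed
  define \<beta> where "\<beta> = a ` {i<..j} \<union> b ` {i<..j}"
  have \<beta>_iff: "a r \<in> \<beta> \<longleftrightarrow> b r \<in> \<beta>" for r
  proof -
    have opp: "b r = a k \<longleftrightarrow> a r = b k" for k
      using opposite_direction[of r k] opposite_direction[of k r] by auto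
    have "a r \<in> \<beta> \<longleftrightarrow> (\<exists>k\<in>{i<..j}. a r = a k \<or> a r = b k)" by (auto simp: \<beta>_def)
    also have "\<dots> \<longleftrightarrow> (\<exists>k\<in>{i<..j}. b r = b k \<or> b r = a k)" by (simp only: same_direction opp)
    also have "\<dots> \<longleftrightarrow> b r \<in> \<beta>" by (auto simp: \<beta>_def)
    finally show ?thesis .
  qed
  \<comment> \<open>By \<open>inj\<close>, no other step of the return crosses the edge of
    \<open>r\<close> in the same direction. A step in the opposite direction would be the next one,
    or \<open>r\<close> and \<open>r'\<close> would be the last and the first step of the return;
    this contradicts \<open>reduced\<close>, or \<open>sides_distinct\<close> if
    \<open>m = 1\<close>.\<close>
  have F\<beta>: "F (b r) j - F (b r) i = 1" if r: "r \<in> {i<..j}" for r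
  proof -
    have "x (b r) r' = (if r' = r then 1 else 0)" if r': "r' \<in> {i<..j}" for r'
    proof -
      have "b r' = b r \<longleftrightarrow> r' = r"
        using inj[of r' r] r r' by (auto simp: j_def)
      moreover have "a r' \<noteq> b r"
      proof
        assume eq: "a r' = b r"
        then have eq': "a r = b r'" using opposite_direction[of r r'] by simp
        have 1: "v (r' - 1) = v r" using eq v_before[of r'] by simp
        have 2: "v (r - 1) = v r'" using eq' v_before[of r] by simp
        have "r' = r + 1 \<or> (r = j \<and> r' = i + 1)"
        proof (cases "\<bar>r' - 1 - r\<bar> < m")
          case True with inj[OF 1] show ?thesis by simp
        next
          case False then show ?thesis using r r' by (auto simp: j_def)
        qed
        then show False
        proof
          assume "r' = r + 1" then show False using reduced[of r] eq by simp
        next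
          assume A: "r = j \<and> r' = i + 1"
          then have "\<bar>(r - 1) - r'\<bar> < m \<or> m = 1" using m by (auto simp: j_def)
          then show False
          proof
            assume "\<bar>(r - 1) - r'\<bar> < m"
            then have "r = r' + 1" using inj[OF 2] by simp
            with reduced[of r'] eq' show False by simp
          next
            assume "m = 1" with A sides_distinct[of r] eq show False by (simp add: j_def)
          qed
        qed
      qed
      ultimately show ?thesis by (simp add: x_def)
    qed
    then have "sum (x (b r)) {i<..j} = sum (\<lambda>r'. if r' = r then 1 else 0) {i<..j}"
      by (rule sum.cong[OF refl])
    also have "\<dots> = 1" using r by simp
    finally show ?thesis using Fsum[of i j] ij by simp
  qed
  \<comment> \<open>An edge outside the return has count 0 on it, whereas \<open>b j\<close> has
    count 1; proportionality forces the net count of the outside edge to vanish, and then its count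
    is itself a height.\<close>
  have outside: "F s k = F s i'" if "s \<notin> \<beta>" "v i' = v k" for s i' k
  proof -
    have "sum (x s) {i<..j} = 0"
      using that(1) by (intro sum.neutral) (auto simp: x_def \<beta>_def)
    then have "F s j - F s i = 0" using Fsum[of i j s] ij by simp
    then have "G s * (F (b j) j - F (b j) i) = 0" using proportional[OF vij, of "b j" s] by simp
    then have "G s = 0" using F\<beta>[of j] ij by simp
    then show ?thesis using zero that(2) by blast
  qed

  have follow: "b r = b (r - m)" if "j + 1 \<le> r" for r
  proof (rule ccontr)
    assume neq: "b r \<noteq> b (r - m)"
    from that neq obtain q where "j + 1 \<le> q" and q_neq: "b q \<noteq> b (q - m)"
      and q_min: "\<And>r. j + 1 \<le> r \<Longrightarrow> r < q \<Longrightarrow> \<not> b r \<noteq> b (r - m)"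
      using least_int[of "\<lambda>r. b r \<noteq> b (r - m)" r "j + 1"] by blast
    then have q: "b q \<noteq> b (q - m)" "q > j" by auto
    have before_q: "b r = b (r - m)" if "j < r" "r < q" for r using q_min[of r] that by simp
    have red: "\<exists>r'\<in>{i<..j}. b r' = b r \<and> m dvd r - r'" if "i < r" "r < q" for r
      using that
    proof (induction "nat (r - i)" arbitrary: r rule: less_induct)
      case less
      show ?case
      proof (cases "r \<le> j")
        case True then show ?thesis using less by auto
      next
        case False
        then obtain r' where r': "r'\<in>{i<..j}" "b r' = b (r - m)" "m dvd r - m - r'"
          using less.hyps[of "r - m"] less.prems m by (auto simp: j_def)
        then have "m dvd (r - m - r') + m" by (intro dvd_add) auto
        then show ?thesis using r' before_q[of r] less.prems False by (intro bexI[of _ r']) (auto simp: algebra_simps)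
      qed
    qed
    have red_\<beta>: "b r \<in> \<beta>" if "i < r" "r < q" for r
      using red[OF that] unfolding \<beta>_def by (metis UnCI imageI)
    obtain l where l: "l \<in> {i<..j}" "b l = b (q - 1)" "m dvd q - 1 - l"
      using red[of "q - 1"] q(2) ij by auto
    \<comment> \<open>The position on the return of the vertex just before step \<open>q\<close>.
      The end \<open>j\<close> is replaced by the start \<open>i\<close>, which is the same vertex,
      so that \<open>k0 + 1\<close> is again a step of the return.\<close>
    define k0 where "k0 = (if l = j then i else l)"
    have k0: "i \<le> k0" "k0 < j" "v k0 = v (q - 1)" using l vij ij by (auto simp: k0_def split: if_splits)
    have b_next: "b (k0 + 1) = b (q - m)"
    proof -
      obtain r' where r': "r' \<in> {i<..j}" "b r' = b (q - m)" "m dvd q - m - r'"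
        using red[of "q - m"] q(2) m by (auto simp: j_def)
      have "m dvd k0 + 1 - r'"
      proof -
        have "m dvd (q - m - r') + m" using r'(3) by (intro dvd_add) auto
        then have A: "m dvd q - r'" by simp
        have "m dvd (q - r') - (q - 1 - l)" using A l(3) by (rule dvd_diff)
        then have B: "m dvd l + 1 - r'" by (simp add: algebra_simps)
        then have "m dvd (l + 1 - r') - m" using dvd_diff[OF B dvd_refl] by simp
        then show ?thesis using B by (auto simp: k0_def j_def algebra_simps)
      qed
      moreover have "\<bar>k0 + 1 - r'\<bar> < m" using k0 r'(1) by (auto simp: j_def)
      ultimately have "k0 + 1 = r'" using dvd_imp_le_int[of "k0 + 1 - r'" m] by auto
      then show ?thesis using r' by simp
    qed
    \<comment> \<open>At this vertex the return offers only two sides: the one of the arrival,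
      excluded by \<open>reduced\<close>, and the one continuing the return, excluded because
      \<open>q\<close> is the first deviating step.\<close>
    have aq: "a q \<notin> \<beta>"
    proof
      assume "a q \<in> \<beta>"
      then obtain r where r: "r \<in> {i<..j}" "a q = b r \<or> a q = a r" by (auto simp: \<beta>_def)
      show False
      proof (cases "a q = b r")
        case True
        then have "v r = v l" using v_before[of q] l(2) by simp
        moreover have "\<bar>r - l\<bar> < m" using r l by (auto simp: j_def)
        ultimately have "r = l" using inj by blast
        then show False using True l reduced[of "q - 1"] by simp
      next
        case False
        then have eq: "a q = a r" using r by simp
        then have "v (r - 1) = v k0" using v_before[of q] v_before[of r] k0(3) by simp
        moreover have "\<bar>r - 1 - k0\<bar> < m" using k0 r(1) by (auto simp: j_def)
        ultimately have "r = k0 + 1" using inj by force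
        then show False using eq q(1) b_next same_direction[of q r] by simp
      qed
    qed
    \<comment> \<open>From \<open>q\<close> on, \<open>w\<close> is the first step whose vertex was
      already visited since \<open>i\<close>; such a step exists because \<open>q + n\<close> visits
      the vertex of \<open>q\<close>. Below, \<open>p\<close> is the last earlier visit, found as a
      minimum of negated indices.\<close>
    have "\<exists>r. i \<le> r \<and> r < q + n \<and> v r = v (q + n)"
      using n_pos q(2) ij b_periodic[of q] by (intro exI[of _ q]) auto
    then obtain w where wq: "q \<le> w" and Ww: "\<exists>r. i \<le> r \<and> r < w \<and> v r = v w"
      and w_min: "\<And>k. q \<le> k \<Longrightarrow> k < w \<Longrightarrow> \<not> (\<exists>r. i \<le> r \<and> r < k \<and> v r = v k)"
      using least_int[of "\<lambda>k. \<exists>r. i \<le> r \<and> r < k \<and> v r = v k" "q + n" q] n_pos by auto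
    have new: "v r \<noteq> v k" if "q \<le> k" "k < w" "i \<le> r" "r < k" for r k
      using w_min that by blast
    obtain r0 where r0: "i \<le> r0" "r0 < w" "v r0 = v w" using Ww by blast
    then obtain p' where p': "1 - w \<le> p'" "i \<le> - p' \<and> v (- p') = v w"
      and p'_min: "\<And>r. 1 - w \<le> r \<Longrightarrow> r < p' \<Longrightarrow> \<not> (i \<le> - r \<and> v (- r) = v w)"
      using least_int[of "\<lambda>r. i \<le> - r \<and> v (- r) = v w" "- r0" "1 - w"] by auto
    define p where "p = - p'"
    have p: "i \<le> p" "p < w" "v p = v w" using p' by (auto simp: p_def)
    have pmax: "v r \<noteq> v w" if "p < r" "r < w" for r
      using p'_min[of "- r"] that p(1) by (auto simp: p_def)
    \<comment> \<open>If \<open>w > q\<close>, the vertex before step \<open>w\<close> is new and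
      thus not on the return, whereas both ends of an edge in \<open>\<beta>\<close> are on
      it.\<close>
    have aw: "a w \<notin> \<beta>"
    proof (cases "w = q")
      case True then show ?thesis using aq by simp
    next
      case False
      show ?thesis
      proof
        assume "a w \<in> \<beta>"
        then obtain r where r: "r \<in> {i..j}" "V (a w) = v r"
        proof -
          assume *: "\<And>r. r \<in> {i..j} \<Longrightarrow> V (a w) = v r \<Longrightarrow> thesis"
          from \<open>a w \<in> \<beta>\<close> obtain r where "r \<in> {i<..j}" "a w = b r \<or> a w = a r" by (auto simp: \<beta>_def)
          then show thesis using *[of r] *[of "r - 1"] v_before[of r] by auto
        qed
        then have "v r = v (w - 1)" using v_before[of w] by simp
        moreover have "v r \<noteq> v (w - 1)" using False wq q(2) r by (intro new) auto
        ultimately show False by simp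
      qed
    qed
    then have bw: "b w \<notin> \<beta>" using \<beta>_iff by simp
    have "x (b w) r = (if r = w then 1 else 0)" if r: "r \<in> {p<..w}" for r
    proof (cases "r = w")
      case True then show ?thesis using sides_distinct[of w] by (simp add: x_def)
    next
      case False
      \<comment> \<open>The edge of \<open>w\<close> is not crossed before in the same direction
        since \<open>p\<close> is the last visit. A crossing in the opposite direction would lie in
        \<open>\<beta>\<close> if before \<open>q\<close>, and otherwise it would be step
        \<open>w - 1\<close>, against \<open>reduced\<close>.\<close>
      then have rw: "p < r" "r < w" using r by auto
      have 1: "b r \<noteq> b w" using pmax[OF rw] by auto
      have 2: "a r \<noteq> b w"
      proof
        assume eq: "a r = b w"
        then have eq': "a w = b r" using opposite_direction[of w r] by simp
        show False
        proof (cases "r < q")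
          case True
          then have "a r \<in> \<beta>" using red_\<beta>[of r] rw p(1) \<beta>_iff by auto
          with eq bw show False by simp
        next
          case False
          have e: "v r = v (w - 1)" using eq' v_before[of w] by simp
          show False
          proof (cases "r = w - 1")
            case True
            then show False using eq' reduced[of r] by simp
          next
            case False': False
            then show False using new[of "w - 1" r] e rw p(1) False by auto
          qed
        qed
      qed
      show ?thesis using 1 2 False by (simp add: x_def)
    qed
    then have "sum (x (b w)) {p<..w} = sum (\<lambda>r. if r = w then 1 else 0) {p<..w}"
      by (rule sum.cong[OF refl])
    also have "\<dots> = 1" using p(2) by simp
    finally have "F (b w) w - F (b w) p = 1" using Fsum[of p w] p(2) by simp
    then show False using outside[OF bw p(3)] by simp
  qed
  \<comment> \<open>\<open>follow\<close> concerns only late steps; adding a large multiple of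
    \<open>n\<close> carries any step there.\<close>
  have "b (r + m) = b r" for r
  proof -
    define z where "z = \<bar>j - r\<bar> + 1"
    have "z * n \<ge> z" using n_pos by (simp add: z_def)
    then have "j + 1 \<le> r + m + z * n" using m z_def by linarith
    from follow[OF this] have "b (r + m + z * n) = b (r + z * n)" by (simp add: algebra_simps)
    then show ?thesis using periodic_mult[of b n, OF b_periodic] by simp
  qed
  with aperiodic[OF m] show False by blast
qed

text \<open>\<open>L i\<close> is the height of the passage between steps \<open>i\<close> and
  \<open>i + 1\<close>. If steps \<open>i\<close> and \<open>k\<close> cross an edge in opposite
  directions, the passages \<open>i\<close> and \<open>k - 1\<close> take place at one end of the
  edge and \<open>i - 1\<close> and \<open>k\<close> at the other; hence the shifted indices in the
  last clause.\<close>

definition coherent :: "(int \<Rightarrow> int) \<Rightarrow> bool" where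
  "coherent L \<longleftrightarrow> (\<forall>i. L (i + n) = L i) \<and>
     (\<forall>i k. b i = b k \<longrightarrow> (L i < L k \<longleftrightarrow> L (i - 1) < L (k - 1))) \<and>
     (\<forall>i k. b i = a k \<longrightarrow> (L i < L (k - 1) \<longleftrightarrow> L (i - 1) < L k))"

lemma coherentD:
  assumes "coherent L"
  shows "L (i + n) = L i"
    and "b i = b k \<Longrightarrow> L i < L k \<longleftrightarrow> L (i - 1) < L (k - 1)"
    and "b i = a k \<Longrightarrow> L i < L (k - 1) \<longleftrightarrow> L (i - 1) < L k"
  using assms by (auto simp: coherent_def)

lemma coherent_eq:
  assumes "coherent L"
  shows "b i = b k \<Longrightarrow> L i = L k \<longleftrightarrow> L (i - 1) = L (k - 1)"
    and "b i = a k \<Longrightarrow> L i = L (k - 1) \<longleftrightarrow> L (i - 1) = L k"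
proof -
  show "L i = L k \<longleftrightarrow> L (i - 1) = L (k - 1)" if "b i = b k"
    using coherentD(2)[OF assms that] coherentD(2)[OF assms that[symmetric]] by linarith
  show "L i = L (k - 1) \<longleftrightarrow> L (i - 1) = L k" if "b i = a k"
    using coherentD(3)[OF assms that] coherentD(3)[OF assms opposite_direction[OF that, symmetric]]
    by linarith
qed

text \<open>The vertices that the lifted walk visits in the current cover. There are at most
  \<open>n\<close> of them, which bounds the number of refinements.\<close>

definition level_classes :: "(int \<Rightarrow> int) \<Rightarrow> ('vertex \<times> int) set" where
  "level_classes L = (\<lambda>i. (v i, L i)) ` {0..<n}"

text \<open>Passing to the pairs of a side and a height corresponds to lifting the walk to an infinite
  cyclic cover of the graph; the new height orders the sheets of this cover.\<close>

lemma refine_coherent: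
  assumes L: "coherent L" and dup: "v i0 = v k0" "L i0 = L k0" "i0 mod n \<noteq> k0 mod n"
  obtains L' where "coherent L'" "card (level_classes L) < card (level_classes L')"
proof -
  \<comment> \<open>The side entered in step \<open>i\<close> belongs to the passage before the step
    and therefore carries \<open>L (i - 1)\<close>. Coherence says that lifted sides still pair up
    into edges.\<close>
  have "closed_walk n (\<lambda>i. (a i, L (i - 1))) (\<lambda>i. (b i, L i)) (\<lambda>(s, l). (V s, l))"
  proof
    fix i k m :: int
    show "n > 0" by (rule n_pos)
    show "(a (i + n), L (i + n - 1)) = (a i, L (i - 1))"
      using coherentD(1)[OF L, of "i - 1"] by (simp add: a_periodic algebra_simps)
    show "(b (i + n), L (i + n)) = (b i, L i)"
      using coherentD(1)[OF L, of "i"] by (simp add: b_periodic)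
    show "(case (a (i + 1), L (i + 1 - 1)) of (s, l) \<Rightarrow> (V s, l)) = (case (b i, L i) of (s, l) \<Rightarrow> (V s, l))"
      using vertex by simp
    show "(a i, L (i - 1)) \<noteq> (b i, L i)" using sides_distinct by simp
    show "(b i, L i) = (b k, L k) \<longleftrightarrow> (a i, L (i - 1)) = (a k, L (k - 1))"
      using same_direction coherent_eq(1)[OF L] by auto
    show "(a i, L (i - 1)) = (b k, L k)" if "(b i, L i) = (a k, L (k - 1))"
      using that opposite_direction coherent_eq(2)[OF L] by auto
    show "(b i, L i) \<noteq> (a (i + 1), L (i + 1 - 1))" using reduced by simp
    show "\<exists>i. (b (i + m), L (i + m)) \<noteq> (b i, L i)" if "0 < m" "m < n"
      using aperiodic[OF that] by auto
  qed
  then interpret cover: closed_walk n "\<lambda>i. (a i, L (i - 1))" "\<lambda>i. (b i, L i)" "\<lambda>(s, l). (V s, l)" .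
  have same: "(case (b i0, L i0) of (s, l) \<Rightarrow> (V s, l)) = (case (b k0, L k0) of (s, l) \<Rightarrow> (V s, l))"
    using dup by simp
  obtain h :: "int \<Rightarrow> int" and p q where h1: "\<And>r. h (r + n) = h r"
    and h2: "\<And>i k. (b i, L i) = (b k, L k) \<Longrightarrow> h i - h (i - 1) = h k - h (k - 1)"
    and h3: "\<And>i k. (b i, L i) = (a k, L (k - 1)) \<Longrightarrow> h i - h (i - 1) = h (k - 1) - h k"
    and pq': "(case (b p, L p) of (s, l) \<Rightarrow> (V s, l)) = (case (b q, L q) of (s, l) \<Rightarrow> (V s, l))" "h p \<noteq> h q"
  proof (rule cover.separating_height[OF same dup(3)])
    fix h :: "int \<Rightarrow> int" and p q
    assume "\<And>r. h (r + n) = h r"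
      "\<And>i k. (b i, L i) = (b k, L k) \<Longrightarrow> h i - h (i - 1) = h k - h (k - 1)"
      "\<And>i k. (b i, L i) = (a k, L (k - 1)) \<Longrightarrow> h i - h (i - 1) = h (k - 1) - h k"
      "(case (b p, L p) of (s, l) \<Rightarrow> (V s, l)) = (case (b q, L q) of (s, l) \<Rightarrow> (V s, l))" "h p \<noteq> h q"
    then show thesis by (rule that)
  qed
  have pq: "v p = v q" "L p = L q" "h p \<noteq> h q" using pq' by auto
  note h = h1 h2[unfolded prod.inject, OF conjI] h3[unfolded prod.inject, OF conjI]
  \<comment> \<open>\<open>B\<close> exceeds the spread of \<open>h\<close>, so in \<open>L'\<close>
    the old height decides and \<open>h\<close> only breaks ties; division by \<open>B\<close>
    recovers the old height.\<close>
  define m where "m = Min (h ` {0..<n})"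
  define B where "B = Max (h ` {0..<n}) - m + 1"
  have h_range: "0 \<le> h i - m" "h i - m < B" for i
  proof -
    have "h i \<in> h ` {0..<n}"
      using periodic_mod[of h n i, OF h(1)] n_pos
      by (metis atLeastLessThan_iff image_eqI pos_mod_bound pos_mod_sign)
    then have "h i \<le> Max (h ` {0..<n})" "m \<le> h i"
      by (auto simp: m_def)
    then show "0 \<le> h i - m" "h i - m < B" by (simp_all add: B_def)
  qed
  define L' where "L' i = B * L i + (h i - m)" for i
  have less: "L' i < L' k \<longleftrightarrow> L i < L k \<or> (L i = L k \<and> h i < h k)" for i k
  proof -
    have key: "L' i < L' k" if "L i < L k" for i k
    proof -
      have "B * (L i + 1) \<le> B * L k"
        using that h_range[of 0] by (intro mult_left_mono) auto
      then show ?thesis using h_range[of i] h_range[of k] by (simp add: L'_def algebra_simps)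
    qed
    consider "L i < L k" | "L k < L i" | "L i = L k" by linarith
    then show ?thesis
      by cases (use key[of i k] key[of k i] in \<open>auto simp: L'_def\<close>)
  qed
  have "coherent L'"
    unfolding coherent_def
  proof (intro conjI allI impI)
    fix i k
    show "L' (i + n) = L' i" by (simp add: L'_def h(1) coherentD(1)[OF L])
    show "L' i < L' k \<longleftrightarrow> L' (i - 1) < L' (k - 1)" if "b i = b k"
    proof (cases "L i = L k")
      case True
      then show ?thesis using coherent_eq(1)[OF L that] h(2)[OF that True] unfolding less by auto
    next
      case False
      then show ?thesis
        using coherentD(2)[OF L that] coherent_eq(1)[OF L that] unfolding less by auto
    qed
    show "L' i < L' (k - 1) \<longleftrightarrow> L' (i - 1) < L' k" if "b i = a k"
    proof (cases "L i = L (k - 1)")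
      case True
      then show ?thesis using coherent_eq(2)[OF L that] h(3)[OF that True] unfolding less by auto
    next
      case False
      then show ?thesis
        using coherentD(3)[OF L that] coherent_eq(2)[OF L that] unfolding less by auto
    qed
  qed
  moreover have "card (level_classes L) < card (level_classes L')"
  proof -
    define f where "f = (\<lambda>(x::'vertex, l). (x, l div B))"
    have "L' i div B = L i" for i
      using h_range[of i] by (simp add: L'_def)
    then have f: "f (v i, L' i) = (v i, L i)" for i by (simp add: f_def)
    then have image: "f ` level_classes L' = level_classes L"
      by (simp add: level_classes_def image_image)
    have in_classes: "(v r, L' r) \<in> level_classes L'" for r
    proof -
      have "v (r mod n) = v r" "L' (r mod n) = L' r"
        using periodic_mod[of v n r] periodic_mod[of L' n r] b_periodic
          coherentD(1)[OF \<open>coherent L'\<close>] by auto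
      then show ?thesis unfolding level_classes_def using n_pos
        by (intro image_eqI[of _ _ "r mod n"]) auto
    qed
    \<comment> \<open>The passages \<open>p\<close> and \<open>q\<close> share vertex and old height
      but are separated by \<open>h\<close>, so the projection from new to old classes is not
      injective.\<close>
    have "f (v p, L' p) = f (v q, L' q)" "(v p, L' p) \<noteq> (v q, L' q)"
      using f[of p] f[of q] pq by (simp, simp add: L'_def)
    then have "\<not> inj_on f (level_classes L')"
      using in_classes by (metis inj_onD)
    moreover have fin: "finite (level_classes L')" by (simp add: level_classes_def)
    ultimately have "card (f ` level_classes L') \<noteq> card (level_classes L')"
      using eq_card_imp_inj_on by blast
    then show ?thesis using card_image_le[OF fin, of f] image by simp
  qed
  ultimately show thesis by (rule that)
qed

theorem stacking:
  obtains L where "coherent L" "\<And>i k. v i = v k \<Longrightarrow> L i = L k \<Longrightarrow> i mod n = k mod n"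
proof -
  have bound: "card (level_classes L) \<le> nat n" for L
    using card_image_le[of "{0..<n}" "\<lambda>i. (v i, L i)"] by (simp add: level_classes_def)
  have "\<exists>L'. coherent L' \<and> (\<forall>i k. v i = v k \<longrightarrow> L' i = L' k \<longrightarrow> i mod n = k mod n)"
    if "coherent L" for L
    using that
  proof (induction "nat n - card (level_classes L)" arbitrary: L rule: less_induct)
    case less
    show ?case
    proof (cases "\<exists>i k. v i = v k \<and> L i = L k \<and> i mod n \<noteq> k mod n")
      case True
      then obtain L' where L': "coherent L'" "card (level_classes L) < card (level_classes L')"
        using refine_coherent[OF less.prems] by metis
      then have "nat n - card (level_classes L') < nat n - card (level_classes L)"
        using bound[of L'] by linarith
      then show ?thesis using less.hyps L'(1) by blast
    next
      case False
      then show ?thesis using less.prems by blast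
    qed
  qed
  moreover have "coherent (\<lambda>_. 0)" by (simp add: coherent_def)
  ultimately show thesis using that by blast
qed

end

section \<open>The local degree of injective planar maps\<close>

text \<open>The orientation sign of an injective continuous map, with no differentiability involved.
  For such a map all sufficiently small circles give the same winding number, so \<open>THE\<close>
  is meaningful; this is \<open>local_degree_eq\<close>.\<close>

definition local_degree :: "(complex \<Rightarrow> complex) \<Rightarrow> complex \<Rightarrow> complex" where
  "local_degree f z = (THE d. \<forall>\<^sub>F r in at_right 0. winding_number (f \<circ> circlepath z r) (f z) = d)"

lemma injective_image_avoids:
  assumes "inj_on f (ball z R)" "path_image c \<subseteq> ball z R - {z}"
  shows "f z \<notin> path_image (f \<circ> c)"
proof
  assume "f z \<in> path_image (f \<circ> c)"
  then obtain w where w: "w \<in> path_image c" "f z = f w" unfolding path_image_compose by (rule imageE)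
  then have "w \<in> ball z R" "w \<noteq> z" using assms(2) by auto
  moreover from this have "z \<in> ball z R" by (metis centre_in_ball dist_pos_lt mem_ball order_less_trans)
  ultimately show False using inj_onD[OF assms(1) w(2)] by simp
qed

text \<open>Loops in the punctured plane are classified by their winding number, but a homotopy
  between them may leave the ball on which \<open>f\<close> is controlled. A radial retraction pulls
  the homotopy into the ball before \<open>f\<close> is applied.\<close>

lemma winding_number_injective_image:
  assumes f: "continuous_on (ball z R) f" "inj_on f (ball z R)"
    and p: "path p" "pathfinish p = pathstart p" "path_image p \<subseteq> ball z R - {z}"
    and q: "path q" "pathfinish q = pathstart q" "path_image q \<subseteq> ball z R - {z}"
    and eq: "winding_number p z = winding_number q z"
  shows "winding_number (f \<circ> p) (f z) = winding_number (f \<circ> q) (f z)"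
proof -
  define K where "K = path_image p \<union> path_image q"
  have K: "compact K" "K \<subseteq> ball z R" "K \<noteq> {}"
    using p q path_image_nonempty[of p] by (auto simp: K_def compact_path_image)
  have "continuous_on K (\<lambda>w. dist z w)" by (intro continuous_intros)
  then obtain w0 where w0: "w0 \<in> K" "\<And>w. w \<in> K \<Longrightarrow> dist z w \<le> dist z w0"
    using continuous_attains_sup[of K "\<lambda>w. dist z w"] K by blast
  \<comment> \<open>The largest distance of the two loops from \<open>z\<close>. Cutting off the
    radius at \<open>R'\<close> fixes both loops and keeps everything strictly inside the ball and
    away from \<open>z\<close>.\<close>
  define R' where "R' = dist z w0"
  have R': "R' < R" "0 < R'" using w0(1) K p q by (auto simp: R'_def K_def)
  define \<rho> where "\<rho> w = z + (min 1 (R' / norm (w - z))) *\<^sub>R (w - z)" for w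
  have \<rho>_cont: "continuous_on (-{z}) \<rho>"
    unfolding \<rho>_def by (intro continuous_intros) auto
  have \<rho>_ball: "\<rho> w \<in> ball z R - {z}" if "w \<noteq> z" for w
  proof -
    have "norm (\<rho> w - z) = min 1 (R' / norm (w - z)) * norm (w - z)"
      using R' by (simp add: \<rho>_def)
    also have "\<dots> \<le> R'" using that by (auto simp: min_def field_simps)
    finally have 1: "norm (\<rho> w - z) \<le> R'" .
    have "min 1 (R' / norm (w - z)) \<noteq> 0" using that R' by (auto simp: min_def)
    then have "\<rho> w \<noteq> z" using that by (simp add: \<rho>_def)
    with 1 R' show ?thesis by (auto simp: dist_norm norm_minus_commute)
  qed
  have \<rho>_id: "\<rho> w = w" if "w \<in> K" for w
  proof -
    have "norm (w - z) \<le> R'" using w0(2)[OF that] by (simp add: R'_def dist_norm norm_minus_commute)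
    moreover have "w \<noteq> z" using that p q by (auto simp: K_def)
    ultimately have "1 \<le> R' / norm (w - z)" by (simp add: field_simps)
    then show ?thesis by (simp add: \<rho>_def min_def)
  qed
  have "homotopic_loops (-{z}) p q"
    using winding_number_homotopic_loops_eq[of p z q] p q eq by auto
  then have hom: "homotopic_loops (-{f z}) ((f \<circ> \<rho>) \<circ> p) ((f \<circ> \<rho>) \<circ> q)"
  proof (rule homotopic_loops_continuous_image)
    show "continuous_on (-{z}) (f \<circ> \<rho>)"
      by (rule continuous_on_compose[OF \<rho>_cont continuous_on_subset[OF f(1)]]) (use \<rho>_ball in blast)
    show "f \<circ> \<rho> \<in> -{z} \<rightarrow> -{f z}"
    proof
      fix w assume "w \<in> -{z}"
      then have "\<rho> w \<in> ball z R" "\<rho> w \<noteq> z" using \<rho>_ball[of w] by auto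
      moreover have "z \<in> ball z R" using R' by auto
      ultimately show "(f \<circ> \<rho>) w \<in> -{f z}" using inj_onD[OF f(2)] by fastforce
    qed
  qed
  have same: "homotopic_loops (-{f z}) (f \<circ> c) ((f \<circ> \<rho>) \<circ> c)"
    if "path c" "pathfinish c = pathstart c" "path_image c \<subseteq> ball z R - {z}" "path_image c \<subseteq> K" for c
  proof (rule homotopic_loops_eq)
    show "path (f \<circ> c)" by (rule path_continuous_image[OF that(1) continuous_on_subset[OF f(1)]]) (use that in auto)
    show "path_image (f \<circ> c) \<subseteq> -{f z}" using injective_image_avoids[OF f(2) that(3)] by blast
    show "pathfinish (f \<circ> c) = pathstart (f \<circ> c)" using that by (simp add: pathfinish_compose pathstart_compose)
    show "(f \<circ> c) t = (f \<circ> \<rho> \<circ> c) t" if "t \<in> {0..1}" for t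
    proof -
      have "c t \<in> K" using \<open>path_image c \<subseteq> K\<close> that unfolding path_image_def by blast
      then show ?thesis using \<rho>_id by simp
    qed
  qed
  have "homotopic_loops (-{f z}) (f \<circ> p) (f \<circ> q)"
    using same[OF p] hom same[OF q] unfolding K_def
    by (meson Un_upper1 Un_upper2 homotopic_loops_sym homotopic_loops_trans)
  then show ?thesis by (rule winding_number_homotopic_loops)
qed

lemma circlepath_ball:
  assumes "0 < r" "r < R"
  shows "path_image (circlepath z r) \<subseteq> ball z R - {z}"
  using assms by auto

lemma local_degree_eq:
  assumes f: "continuous_on (ball z R) f" "inj_on f (ball z R)"
    and r: "0 < r" "r < R"
  shows "local_degree f z = winding_number (f \<circ> circlepath z r) (f z)"
proof -
  have same: "winding_number (f \<circ> circlepath z s) (f z) = winding_number (f \<circ> circlepath z r) (f z)"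
    if "0 < s" "s < R" for s
    using that r circlepath_ball
    by (intro winding_number_injective_image[OF f]) (auto simp: winding_number_circlepath_centre)
  have ev: "\<forall>\<^sub>F s in at_right 0. winding_number (f \<circ> circlepath z s) (f z) = winding_number (f \<circ> circlepath z r) (f z)"
    unfolding eventually_at_right_field
  proof (intro exI[of _ R] conjI allI impI)
    show "0 < R" using r by simp
    fix s assume "0 < s" "s < R"
    then show "winding_number (f \<circ> circlepath z s) (f z) = winding_number (f \<circ> circlepath z r) (f z)"
      by (rule same)
  qed
  show ?thesis unfolding local_degree_def
  proof (rule the_equality)
    show "\<forall>\<^sub>F s in at_right 0. winding_number (f \<circ> circlepath z s) (f z) = winding_number (f \<circ> circlepath z r) (f z)"
      by (rule ev)
    fix d assume "\<forall>\<^sub>F s in at_right 0. winding_number (f \<circ> circlepath z s) (f z) = d"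
    with ev have "\<forall>\<^sub>F s::real in at_right 0. d = winding_number (f \<circ> circlepath z r) (f z)"
      by eventually_elim auto
    then show "d = winding_number (f \<circ> circlepath z r) (f z)"
      using eventually_const_iff trivial_limit_at_right_real by metis
  qed
qed

text \<open>Needed for images of circles, which are loops of winding number 1 or -1 but no longer
  circles.\<close>

lemma local_degree_loop:
  assumes f: "continuous_on (ball z R) f" "inj_on f (ball z R)"
    and p: "path p" "pathfinish p = pathstart p" "path_image p \<subseteq> ball z R - {z}"
  shows "winding_number p z = 1 \<Longrightarrow> winding_number (f \<circ> p) (f z) = local_degree f z"
    and "winding_number p z = -1 \<Longrightarrow> winding_number (f \<circ> p) (f z) = - local_degree f z"
proof -
  have "pathstart p \<in> ball z R" using p(3) by auto
  then have R: "R > 0" using zero_le_dist[of z "pathstart p"] by (simp only: mem_ball)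
  define c where "c = circlepath z (R / 2)"
  have c: "path c" "pathfinish c = pathstart c" "path_image c \<subseteq> ball z R - {z}"
    and wc: "winding_number c z = 1"
    using R circlepath_ball[of "R/2" R z] by (auto simp: c_def winding_number_circlepath_centre)
  have d: "local_degree f z = winding_number (f \<circ> c) (f z)"
    unfolding c_def by (rule local_degree_eq[OF f]) (use R in auto)
  show "winding_number (f \<circ> p) (f z) = local_degree f z" if "winding_number p z = 1"
    unfolding d using that wc by (intro winding_number_injective_image[OF f p c]) auto
  have fc: "path (f \<circ> c)" by (rule path_continuous_image[OF c(1) continuous_on_subset[OF f(1)]]) (use c in auto)
  note nf = injective_image_avoids[OF f(2) c(3)]
  have "z \<notin> path_image c" using c(3) by auto
  then have "winding_number (reversepath c) z = -1"
    using wc c winding_number_reversepath[of c z] by auto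
  moreover have "f \<circ> reversepath c = reversepath (f \<circ> c)" by (simp add: reversepath_def o_def)
  ultimately show "winding_number (f \<circ> p) (f z) = - local_degree f z" if "winding_number p z = -1"
    using winding_number_injective_image[OF f p, of "reversepath c"] c that
      winding_number_reversepath[OF fc nf] d by simp
qed

lemma local_degree_cong:
  assumes "\<And>w. w \<in> ball z R \<Longrightarrow> f w = g w" "R > 0"
    and f: "continuous_on (ball z R) f" "inj_on f (ball z R)"
  shows "local_degree f z = local_degree g z"
proof -
  have g: "continuous_on (ball z R) g" "inj_on g (ball z R)"
    using f assms(1) by (auto simp: inj_on_def intro: continuous_on_eq)
  have c: "path_image (circlepath z (R/2)) \<subseteq> ball z R - {z}" using assms by (intro circlepath_ball) auto
  have "homotopic_loops (-{f z}) (f \<circ> circlepath z (R/2)) (g \<circ> circlepath z (R/2))"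
  proof (rule homotopic_loops_eq)
    show "path (f \<circ> circlepath z (R/2))"
      by (rule path_continuous_image[OF _ continuous_on_subset[OF f(1)]]) (use c in auto)
    show "path_image (f \<circ> circlepath z (R/2)) \<subseteq> -{f z}" using injective_image_avoids[OF f(2) c] by blast
    show "pathfinish (f \<circ> circlepath z (R/2)) = pathstart (f \<circ> circlepath z (R/2))"
      by (simp add: pathfinish_compose pathstart_compose)
    show "(f \<circ> circlepath z (R/2)) t = (g \<circ> circlepath z (R/2)) t" if "t \<in> {0..1}" for t
    proof -
      have "circlepath z (R/2) t \<in> ball z R" using c that unfolding path_image_def by blast
      then show ?thesis using assms(1) by simp
    qed
  qed
  from winding_number_homotopic_loops[OF this] show ?thesis
    using local_degree_eq[OF f, of "R/2"] local_degree_eq[OF g, of "R/2"] assms by simp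
qed

text \<open>Applied both to the image of a disc in the complement of a Jordan curve and to the loop
  segments.\<close>

lemma clopen_connected_component:
  assumes "openin (top_of_set X) S" "closedin (top_of_set X) S" "connected S" "S \<noteq> {}"
  shows "S \<in> components X"
  unfolding in_components_maximal
proof (intro conjI allI impI)
  show "S \<subseteq> X" using assms(1) openin_imp_subset by blast
  fix d assume d: "d \<noteq> {} \<and> S \<subseteq> d \<and> d \<subseteq> X \<and> connected d"
  then have "openin (top_of_set d) S" "closedin (top_of_set d) S"
    by (auto intro: openin_subset_trans[OF assms(1)] closedin_subset_trans[OF assms(2)])
  then show "d = S" using d assms(4) connected_clopen[of d] by metis
qed (use assms in auto)

text \<open>The image of a circle is a Jordan curve. The image of the open disc is open by
  invariance of domain, and closed off the curve because its union with the curve is compact. So it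
  is a bounded component of the complement, that is, it lies inside, where a Jordan curve has
  winding number 1 or -1.\<close>

lemma local_degree_cases:
  assumes f: "continuous_on (ball z R) f" "inj_on f (ball z R)" and "R > 0"
  shows "local_degree f z = 1 \<or> local_degree f z = -1"
proof -
  define c where "c = circlepath z (R/2)"
  have c_ball: "path_image c \<subseteq> ball z R" using circlepath_ball[of "R/2" R z] \<open>R > 0\<close> by (auto simp: c_def)
  have simple: "simple_path (f \<circ> c)"
    by (rule simple_path_continuous_image)
      (use c_ball \<open>R > 0\<close> in \<open>auto simp: c_def simple_path_circlepath intro: continuous_on_subset[OF f(1)] inj_on_subset[OF f(2)]\<close>)
  define S where "S = f ` ball z (R/2)"
  have half: "cball z (R/2) \<subseteq> ball z R" using \<open>R > 0\<close> by auto
  have im: "path_image (f \<circ> c) = f ` sphere z (R/2)"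
    using \<open>R > 0\<close> by (simp add: path_image_compose c_def)
  have disj: "S \<inter> path_image (f \<circ> c) = {}"
  proof -
    have "f x \<noteq> f y" if "x \<in> ball z (R/2)" "y \<in> sphere z (R/2)" for x y
      using inj_onD[OF f(2), of x y] that half by auto
    then show ?thesis unfolding im S_def by blast
  qed
  have S: "open S" "connected S"
    unfolding S_def
    by (intro invariance_of_domain connected_continuous_image
        continuous_on_subset[OF f(1)] inj_on_subset[OF f(2)]; use half in force)+
  have comp: "compact (f ` cball z (R/2))"
    by (rule compact_continuous_image[OF continuous_on_subset[OF f(1) half]]) auto
  have "S \<in> components (- path_image (f \<circ> c))"
  proof (rule clopen_connected_component[OF _ _ S(2)])
    have "f ` cball z (R/2) = S \<union> path_image (f \<circ> c)"
      unfolding im S_def image_Un[symmetric] by (rule arg_cong[where f="(`) f"]) auto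
    then have "S = - path_image (f \<circ> c) \<inter> f ` cball z (R/2)" using disj by auto
    then show "closedin (top_of_set (- path_image (f \<circ> c))) S"
      using comp compact_imp_closed closedin_closed_Int by metis
    show "openin (top_of_set (- path_image (f \<circ> c))) S"
      using S(1) disj by (auto intro: open_subset)
    show "S \<noteq> {}" using \<open>R > 0\<close> by (auto simp: S_def)
  qed
  moreover have "bounded S" using comp half
    by (metis S_def ball_subset_cball bounded_subset compact_imp_bounded image_mono)
  moreover have "f z \<in> S" using \<open>R > 0\<close> by (auto simp: S_def)
  moreover have "connected_component_set (- path_image (f \<circ> c)) (f z) = S"
    using calculation(1,3) unfolding components_iff by (metis connected_component_eq)
  ultimately have "f z \<in> inside (path_image (f \<circ> c))"
    unfolding inside_def using disj by auto
  then have "winding_number (f \<circ> c) (f z) = 1 \<or> winding_number (f \<circ> c) (f z) = -1"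
    using simple_closed_path_winding_number_inside[OF simple] by metis
  then show ?thesis using local_degree_eq[OF f, of "R/2"] \<open>R > 0\<close> by (simp add: c_def)
qed

lemma local_degree_constant:
  assumes f: "continuous_on S f" "inj_on f S" and S: "open S" "connected S" "z \<in> S" "w \<in> S"
  shows "local_degree f z = local_degree f w"
proof -
  have "local_degree f constant_on S"
  proof (rule locally_constant_imp_constant[OF S(2)])
    fix z0 assume "z0 \<in> S"
    then obtain R where R: "R > 0" "ball z0 R \<subseteq> S" using S(1) openE by blast
    \<comment> \<open>With a third of the radius, every disc of radius \<open>2 * r\<close> about a
      point of \<open>ball z0 r\<close> stays in \<open>S\<close> and contains the circle
      \<open>c\<close>; thus one circle computes the degree at all these points.\<close>
    define r where "r = R / 3"
    define c where "c = circlepath z0 r"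
    have r: "r > 0" using R by (simp add: r_def)
    have c_im: "path_image c = sphere z0 r" using r by (simp add: c_def)
    have c_S: "path_image c \<subseteq> S" using R r by (auto simp: c_im r_def)
    have fc: "path (f \<circ> c)"
      by (rule path_continuous_image[OF _ continuous_on_subset[OF f(1) c_S]]) (simp add: c_def)
    have deg_c: "local_degree f u = winding_number (f \<circ> c) (f u)" if u: "u \<in> ball z0 r" for u
    proof -
      have sub: "ball u (2 * r) \<subseteq> S"
      proof
        fix x assume "x \<in> ball u (2 * r)"
        then have "dist z0 x < R" using u dist_triangle[of z0 x u] by (simp add: r_def)
        then show "x \<in> S" using R by auto
      qed
      have "path_image c \<subseteq> ball u (2 * r) - {u}"
      proof
        fix x assume "x \<in> path_image c"
        then have "dist z0 x = r" by (simp add: c_im)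
        then show "x \<in> ball u (2 * r) - {u}" using u dist_triangle[of u x z0] by (auto simp: dist_commute)
      qed
      moreover have "winding_number c u = 1"
        unfolding c_def using u by (intro winding_number_circlepath) (auto simp: dist_norm norm_minus_commute)
      ultimately show ?thesis
        using local_degree_loop(1)[OF continuous_on_subset[OF f(1) sub] inj_on_subset[OF f(2) sub], of c]
        by (simp add: c_def)
    qed
    have const_c: "winding_number (f \<circ> c) (f u) = winding_number (f \<circ> c) (f z0)" if u: "u \<in> ball z0 r" for u
    proof (rule winding_number_eq[OF fc, where S = "f ` ball z0 r"])
      have b: "ball z0 r \<subseteq> S" using R r by (auto simp: r_def)
      show "pathfinish (f \<circ> c) = pathstart (f \<circ> c)" by (simp add: c_def pathfinish_compose pathstart_compose)
      show "f u \<in> f ` ball z0 r" "f z0 \<in> f ` ball z0 r" using u r by auto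
      show "connected (f ` ball z0 r)"
        by (intro connected_continuous_image continuous_on_subset[OF f(1) b]) auto
      have "f x \<noteq> f y" if "x \<in> ball z0 r" "y \<in> path_image c" for x y
      proof -
        have "x \<in> S" "y \<in> S" "x \<noteq> y" using that b c_S by (auto simp: c_im)
        then show ?thesis using inj_onD[OF f(2)] by blast
      qed
      then show "f ` ball z0 r \<inter> path_image (f \<circ> c) = {}" by (auto simp: path_image_compose)
    qed
    have "z0 \<in> ball z0 r" using r by simp
    then have "\<forall>u\<in>ball z0 r. local_degree f u = local_degree f z0"
      using deg_c const_c by metis
    moreover have "ball z0 r \<subseteq> S" using R r by (auto simp: r_def)
    ultimately show "\<exists>T. openin (top_of_set S) T \<and> z0 \<in> T \<and> (\<forall>x\<in>T. local_degree f x = local_degree f z0)"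
      using \<open>z0 \<in> ball z0 r\<close> open_ball open_subset by blast
  qed
  then show ?thesis using S by (auto simp: constant_on_def)
qed

text \<open>The image under \<open>f\<close> of a small circle has winding number 1 or -1 about
  \<open>f z\<close>, so it computes the degree of \<open>g\<close> up to exactly this sign.\<close>

lemma local_degree_compose:
  assumes f: "continuous_on S f" "inj_on f S" "open S" "z \<in> S"
    and g: "continuous_on S' g" "inj_on g S'" "open S'" "f z \<in> S'"
  shows "local_degree (g \<circ> f) z = local_degree g (f z) * local_degree f z"
proof -
  obtain R' where R': "R' > 0" "ball (f z) R' \<subseteq> S'" using g openE by blast
  have "open (S \<inter> f -` ball (f z) R')" using f by (intro continuous_open_preimage) auto
  then obtain R where R: "R > 0" "ball z R \<subseteq> S \<inter> f -` ball (f z) R'"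
    using f(4) R' openE[of _ z] by (metis IntI centre_in_ball vimageI)
  have fb: "continuous_on (ball z R) f" "inj_on f (ball z R)"
    using R f by (auto intro: continuous_on_subset inj_on_subset)
  have gb: "continuous_on (ball (f z) R') g" "inj_on g (ball (f z) R')"
    using R' g by (auto intro: continuous_on_subset inj_on_subset)
  have im: "f ` ball z R \<subseteq> ball (f z) R'" using R by auto
  have gf: "continuous_on (ball z R) (g \<circ> f)" "inj_on (g \<circ> f) (ball z R)"
    by (rule continuous_on_compose[OF fb(1) continuous_on_subset[OF gb(1) im]],
        rule comp_inj_on[OF fb(2) inj_on_subset[OF gb(2) im]])
  define c where "c = circlepath z (R/2)"
  have c: "path_image c \<subseteq> ball z R - {z}" using R circlepath_ball[of "R/2" R z] by (auto simp: c_def)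
  have fc: "path (f \<circ> c)"
    by (rule path_continuous_image[OF _ continuous_on_subset[OF fb(1)]]) (use c in \<open>auto simp: c_def\<close>)
  have "path_image (f \<circ> c) \<subseteq> f ` ball z R"
    unfolding path_image_compose by (rule image_mono) (use c in blast)
  then have fc_im: "path_image (f \<circ> c) \<subseteq> ball (f z) R' - {f z}"
    using im injective_image_avoids[OF fb(2) c] by blast
  have fc_loop: "pathfinish (f \<circ> c) = pathstart (f \<circ> c)" by (simp add: c_def pathfinish_compose pathstart_compose)
  have 1: "local_degree (g \<circ> f) z = winding_number (g \<circ> (f \<circ> c)) (g (f z))"
    using local_degree_eq[OF gf, of "R/2"] R by (simp add: c_def comp_assoc)
  have 2: "local_degree f z = winding_number (f \<circ> c) (f z)"
    using local_degree_eq[OF fb, of "R/2"] R by (simp add: c_def)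
  show ?thesis
    using local_degree_cases[OF fb R(1)] local_degree_loop[OF gb fc fc_loop fc_im] 1 2 by auto
qed

lemma local_degree_affine:
  assumes "a \<noteq> 0"
  shows "local_degree (\<lambda>w. c + a * w) z = 1"
proof -
  \<comment> \<open>Multiplication by \<open>a\<close> is multiplication by \<open>s\<close> applied
    twice. The degree of the latter is constant on the plane, so the product is a square of 1 or -1;
    this takes the place of a homotopy from \<open>a\<close> to 1.\<close>
  define s where "s = csqrt a"
  have "s * s = a" using power2_csqrt[of a] by (simp only: s_def power2_eq_square)
  moreover from this assms have "s \<noteq> 0" by auto
  ultimately have s: "s * s = a" "s \<noteq> 0" .
  have trans: "local_degree (\<lambda>w. u + w) z = 1" for u z
  proof -
    have "(\<lambda>w. u + w) \<circ> circlepath z (1/2) = circlepath (u + z) (1/2)"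
      by (simp add: o_def circlepath add.assoc)
    moreover have "continuous_on (ball z 1) (\<lambda>w. u + w)" "inj_on (\<lambda>w. u + w) (ball z 1)"
      by (auto intro!: continuous_intros simp: inj_on_def)
    ultimately show ?thesis
      using local_degree_eq[of z 1 "\<lambda>w. u + w" "1/2"] winding_number_circlepath_centre[of "1/2" "u + z"]
      by simp
  qed
  have mult: "local_degree (\<lambda>w. s * w) (s * z) = local_degree (\<lambda>w. s * w) z"
    by (rule local_degree_constant[of UNIV]) (use s in \<open>auto intro!: continuous_intros inj_onI\<close>)
  have "local_degree (\<lambda>w. a * w) z = local_degree ((\<lambda>w. s * w) \<circ> (\<lambda>w. s * w)) z"
    by (simp add: o_def s(1)[symmetric] mult.assoc)
  also have "\<dots> = local_degree (\<lambda>w. s * w) (s * z) * local_degree (\<lambda>w. s * w) z"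
    by (rule local_degree_compose[of UNIV _ _ UNIV]) (use s in \<open>auto intro!: continuous_intros inj_onI\<close>)
  also have "\<dots> = 1"
  proof -
    have "continuous_on (ball z 1) (\<lambda>w. s * w)" "inj_on (\<lambda>w. s * w) (ball z 1)"
      using s by (auto intro!: continuous_intros simp: inj_on_def)
    then have "local_degree (\<lambda>w. s * w) z = 1 \<or> local_degree (\<lambda>w. s * w) z = -1"
      by (rule local_degree_cases) simp
    then show ?thesis unfolding mult by auto
  qed
  finally have 1: "local_degree (\<lambda>w. a * w) z = 1" .
  have "local_degree ((\<lambda>w. c + w) \<circ> (\<lambda>w. a * w)) z = local_degree (\<lambda>w. c + w) (a * z) * local_degree (\<lambda>w. a * w) z"
    by (rule local_degree_compose[of UNIV _ _ UNIV]) (use assms in \<open>auto intro!: continuous_intros inj_onI\<close>)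
  then show ?thesis using trans 1 by (simp add: o_def)
qed

lemma local_degree_cnj: "local_degree cnj z = -1"
proof -
  have "cnj \<circ> circlepath z (1/2) = reversepath (circlepath (cnj z) (1/2))"
  proof
    fix t :: real
    have "exp (2 * of_real pi * \<i> * (1 - of_real t)) = exp (- (2 * of_real pi * \<i> * of_real t))"
      using exp_plus_2pin[of "- (2 * of_real pi * \<i> * of_real t)" 1] by (simp add: algebra_simps)
    then show "(cnj \<circ> circlepath z (1/2)) t = reversepath (circlepath (cnj z) (1/2)) t"
      by (simp add: circlepath reversepath_def exp_cnj[symmetric] exp_cnj)
  qed
  moreover have "cnj z \<notin> path_image (circlepath (cnj z) (1/2))" by simp
  moreover have "continuous_on (ball z 1) cnj" "inj_on cnj (ball z 1)"
    by (auto intro!: continuous_intros simp: inj_on_def)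
  ultimately show ?thesis
    using local_degree_eq[of z 1 cnj "1/2"] winding_number_reversepath[of "circlepath (cnj z) (1/2)" "cnj z"]
      winding_number_circlepath_centre[of "1/2" "cnj z"]
    by simp
qed

lemma
  fixes h :: "real \<Rightarrow> real"
  shows shear_continuous: "continuous_on (ball (Re z) R) h \<Longrightarrow>
      continuous_on (ball z R) (\<lambda>w. Complex (h (Re w)) (Im w))"
    and shear_inj: "strict_mono_on (ball (Re z) R) h \<Longrightarrow>
      inj_on (\<lambda>w. Complex (h (Re w)) (Im w)) (ball z R)"
proof -
  have Re_ball: "Re w \<in> ball (Re z) R" if "w \<in> ball z R" for w
    using that abs_Re_le_cmod[of "z - w"] by (simp add: dist_norm dist_real_def)
  show "continuous_on (ball z R) (\<lambda>w. Complex (h (Re w)) (Im w))" if "continuous_on (ball (Re z) R) h"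
    unfolding Complex_eq
    by (intro continuous_intros continuous_on_compose2[OF that]) (use Re_ball in auto)
  show "inj_on (\<lambda>w. Complex (h (Re w)) (Im w)) (ball z R)" if "strict_mono_on (ball (Re z) R) h"
  proof (rule inj_onI)
    fix u w assume "u \<in> ball z R" "w \<in> ball z R" "Complex (h (Re u)) (Im u) = Complex (h (Re w)) (Im w)"
    then show "u = w"
      using strict_mono_on_imp_inj_on[OF that] Re_ball by (auto simp: complex_eq_iff inj_on_def)
  qed
qed

text \<open>The straight-line homotopy to a translated circle avoids \<open>f z\<close>: the vectors
  \<open>f w - f z\<close> and \<open>w - z\<close> have equal imaginary parts, and their real parts
  have the same sign because \<open>h\<close> is increasing.\<close>

lemma local_degree_shear:
  fixes h :: "real \<Rightarrow> real"
  assumes h: "continuous_on (ball (Re z) R) h" "strict_mono_on (ball (Re z) R) h" and "R > 0"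
  shows "local_degree (\<lambda>w. Complex (h (Re w)) (Im w)) z = 1"
proof -
  define f where "f w = Complex (h (Re w)) (Im w)" for w
  have Re_ball: "Re w \<in> ball (Re z) R" if "w \<in> ball z R" for w
    using that abs_Re_le_cmod[of "z - w"] by (simp add: dist_norm dist_real_def)
  have inj: "inj_on f (ball z R)" unfolding f_def by (rule shear_inj[OF h(2)])
  have cont: "continuous_on (ball z R) f" unfolding f_def by (rule shear_continuous[OF h(1)])
  define c where "c = circlepath z (R/2)"
  have c: "path_image c \<subseteq> ball z R - {z}" using assms(3) circlepath_ball[of "R/2" R z] by (auto simp: c_def)
  have "homotopic_loops (-{f z}) (f \<circ> c) (\<lambda>t. circlepath (f z) (R/2) t)"
  proof (rule homotopic_loops_linear)
    show "path (f \<circ> c)"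
      by (rule path_continuous_image[OF _ continuous_on_subset[OF cont]]) (use c in \<open>auto simp: c_def\<close>)
    show "pathfinish (f \<circ> c) = pathstart (f \<circ> c)" by (simp add: c_def pathfinish_compose pathstart_compose)
    fix t :: real assume t: "t \<in> {0..1}"
    define w where "w = c t"
    have w: "w \<in> ball z R" "w \<noteq> z" using c imageI[OF t, of c] unfolding path_image_def w_def by auto
    have 2: "circlepath (f z) (R/2) t = f z + (w - z)" by (simp add: w_def c_def circlepath)
    show "closed_segment ((f \<circ> c) t) (circlepath (f z) (R/2) t) \<subseteq> -{f z}"
    proof
      fix x assume "x \<in> closed_segment ((f \<circ> c) t) (circlepath (f z) (R/2) t)"
      then obtain u where u: "0 \<le> u" "u \<le> 1" "x = (1 - u) *\<^sub>R f w + u *\<^sub>R (f z + (w - z))"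
        unfolding closed_segment_def 2 w_def by auto
      have "x \<noteq> f z"
      proof
        assume "x = f z"
        then have "(1 - u) *\<^sub>R (f w - f z) + u *\<^sub>R (w - z) = 0" using u(3) by (simp add: algebra_simps scaleR_diff_left)
        then have re: "(1 - u) * (h (Re w) - h (Re z)) + u * (Re w - Re z) = 0"
          and im: "(1 - u) * (Im w - Im z) + u * (Im w - Im z) = 0"
          by (auto simp: complex_eq_iff f_def)
        have "Im w = Im z" using im by (simp add: algebra_simps)
        moreover have "Re w = Re z"
        proof (rule ccontr)
          assume "Re w \<noteq> Re z"
          moreover have "Re w \<in> ball (Re z) R" "Re z \<in> ball (Re z) R" using Re_ball w(1) assms(3) by auto
          ultimately have pos: "(h (Re w) - h (Re z)) * (Re w - Re z) > 0"
            using strict_mono_onD[OF h(2), of "Re w" "Re z"] strict_mono_onD[OF h(2), of "Re z" "Re w"]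
            by (cases "Re w < Re z") (auto simp: zero_less_mult_iff)
          have "((1 - u) * (h (Re w) - h (Re z)) + u * (Re w - Re z)) * (Re w - Re z) = 0" using re by simp
          then have "(1 - u) * ((h (Re w) - h (Re z)) * (Re w - Re z)) + u * (Re w - Re z)\<^sup>2 = 0"
            by (simp add: algebra_simps power2_eq_square)
          moreover have "0 \<le> (1 - u) * ((h (Re w) - h (Re z)) * (Re w - Re z))" "0 \<le> u * (Re w - Re z)\<^sup>2"
            using u pos by auto
          ultimately have "1 - u = 0" "u = 0" using pos \<open>Re w \<noteq> Re z\<close>
            by (smt (verit) mult_eq_0_iff zero_less_power2)+
          then show False by simp
        qed
        ultimately show False using w(2) by (simp add: complex_eq_iff)
      qed
      then show "x \<in> -{f z}" by simp
    qed
  qed auto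
  from winding_number_homotopic_loops[OF this]
  have "winding_number (f \<circ> c) (f z) = 1"
    using assms(3) winding_number_circlepath_centre[of "R/2" "f z"] by simp
  then show ?thesis
    using local_degree_eq[OF cont inj, of "R/2"] assms(3) by (simp add: c_def f_def[abs_def])
qed

text \<open>Two maps that agree on the real axis and have disjoint images off it form one injective
  continuous map on the disc, whose degree is constant. In this way orientations are compared across
  an arc.\<close>

lemma local_degree_glue:
  assumes F: "continuous_on (ball c R \<inter> {z. Im z \<ge> 0}) F" "inj_on F (ball c R \<inter> {z. Im z \<ge> 0})"
    and F': "continuous_on (ball c R \<inter> {z. Im z \<le> 0}) F'" "inj_on F' (ball c R \<inter> {z. Im z \<le> 0})"
    and agree: "\<And>z. z \<in> ball c R \<Longrightarrow> Im z = 0 \<Longrightarrow> F z = F' z"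
    and disj: "F ` (ball c R \<inter> {z. Im z > 0}) \<inter> F' ` (ball c R \<inter> {z. Im z < 0}) = {}"
    and z: "z \<in> ball c R" "Im z > 0" and w: "w \<in> ball c R" "Im w < 0"
  shows "local_degree F z = local_degree F' w"
proof -
  define G where "G x = (if Im x \<ge> 0 then F x else F' x)" for x
  have G': "G x = F' x" if "x \<in> ball c R" "Im x \<le> 0" for x
    using that agree by (cases "Im x = 0") (auto simp: G_def)
  have cont: "continuous_on (ball c R) G"
  proof -
    have "ball c R = (ball c R \<inter> {z. Im z \<ge> 0}) \<union> (ball c R \<inter> {z. Im z \<le> 0})" by auto
    moreover have "continuous_on ((ball c R \<inter> {z. Im z \<ge> 0}) \<union> (ball c R \<inter> {z. Im z \<le> 0})) G"
    proof (rule continuous_on_Un_local)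
      show "closedin (top_of_set (ball c R \<inter> {z. 0 \<le> Im z} \<union> ball c R \<inter> {z. Im z \<le> 0})) (ball c R \<inter> {z. 0 \<le> Im z})"
        "closedin (top_of_set (ball c R \<inter> {z. 0 \<le> Im z} \<union> ball c R \<inter> {z. Im z \<le> 0})) (ball c R \<inter> {z. Im z \<le> 0})"
        unfolding calculation[symmetric]
        by (auto intro!: closedin_closed_Int closed_halfspace_Im_ge closed_halfspace_Im_le)
      show "continuous_on (ball c R \<inter> {z. 0 \<le> Im z}) G"
        using F(1) by (rule continuous_on_eq) (auto simp: G_def)
      show "continuous_on (ball c R \<inter> {z. Im z \<le> 0}) G"
        using F'(1) by (rule continuous_on_eq) (use G' in auto)
    qed
    ultimately show ?thesis by metis
  qed
  have inj: "inj_on G (ball c R)"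
  proof -
    have ne: "G x \<noteq> G y" if "x \<in> ball c R" "y \<in> ball c R" "Im x \<ge> 0" "Im y < 0" for x y
    proof (cases "Im x = 0")
      case True
      then have "G x = F' x" "G y = F' y" "x \<noteq> y" using G' that by auto
      then show ?thesis using inj_onD[OF F'(2), of x y] that True by auto
    next
      case False
      have "G x \<in> F ` (ball c R \<inter> {z. Im z > 0})"
        using that False by (intro image_eqI[of _ _ x]) (auto simp: G_def)
      moreover have "G y \<in> F' ` (ball c R \<inter> {z. Im z < 0})"
        using that by (intro image_eqI[of _ _ y]) (auto simp: G_def)
      ultimately show ?thesis using disj by (metis IntI emptyE)
    qed
    show ?thesis
    proof (rule inj_onI)
      fix x y assume xy: "x \<in> ball c R" "y \<in> ball c R" "G x = G y"
      consider "Im x \<ge> 0" "Im y \<ge> 0" | "Im x < 0" "Im y < 0" | "Im x \<ge> 0" "Im y < 0" | "Im x < 0" "Im y \<ge> 0"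
        by linarith
      then show "x = y"
      proof cases
        case 1 then show ?thesis using inj_onD[OF F(2), of x y] xy by (auto simp: G_def)
      next
        case 2 then show ?thesis using inj_onD[OF F'(2), of x y] xy by (auto simp: G_def)
      next
        case 3 then show ?thesis using ne xy by blast
      next
        case 4 then show ?thesis using ne[of y x] xy by auto
      qed
    qed
  qed
  have near: "\<exists>r>0. ball x r \<subseteq> ball c R \<inter> A" if "x \<in> ball c R" "x \<in> A" "open A" for x and A :: "complex set"
    using that open_Int[OF open_ball that(3)] open_contains_ball by (metis IntI)
  obtain r where r: "r > 0" "ball z r \<subseteq> ball c R \<inter> {z. Im z > 0}"
    using near[OF z(1), of "{z. Im z > 0}"] z(2) open_halfspace_Im_gt by auto
  obtain s where s: "s > 0" "ball w s \<subseteq> ball c R \<inter> {z. Im z < 0}"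
    using near[OF w(1), of "{z. Im z < 0}"] w(2) open_halfspace_Im_lt by auto
  have "local_degree G z = local_degree F z"
  proof (rule local_degree_cong[OF _ r(1)])
    have sub: "ball z r \<subseteq> ball c R" using r by blast
    show "continuous_on (ball z r) G" "inj_on G (ball z r)"
      by (rule continuous_on_subset[OF cont sub], rule inj_on_subset[OF inj sub])
    show "G x = F x" if "x \<in> ball z r" for x
      using that r(2) by (auto simp: G_def)
  qed
  moreover have "local_degree G w = local_degree F' w"
  proof (rule local_degree_cong[OF _ s(1)])
    have sub: "ball w s \<subseteq> ball c R" using s by blast
    show "continuous_on (ball w s) G" "inj_on G (ball w s)"
      by (rule continuous_on_subset[OF cont sub], rule inj_on_subset[OF inj sub])
    show "G x = F' x" if "x \<in> ball w s" for x
      using that s(2) by (auto simp: G_def)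
  qed
  moreover have "local_degree G z = local_degree G w"
    by (rule local_degree_constant[OF cont inj]) (use z w in auto)
  ultimately show ?thesis by simp
qed

section \<open>The standard triangle\<close>

lemma corner_simps [simp]: "corner 0 = 0" "corner 1 = 1" "corner (Suc 0) = 1" "corner 2 = \<i>" "corner 3 = 0"
  by (simp_all add: corner_def)

lemma standard_triangle_eq:
  "standard_triangle = {z. 0 \<le> Re z \<and> 0 \<le> Im z \<and> Re z + Im z \<le> 1}"
proof -
  have "z \<in> standard_triangle \<longleftrightarrow> 0 \<le> Re z \<and> 0 \<le> Im z \<and> Re z + Im z \<le> 1" for z
  proof
    assume "z \<in> standard_triangle"
    then obtain u v w where "0 \<le> u" "0 \<le> v" "0 \<le> w" "u + v + w = 1" "z = u *\<^sub>R 0 + v *\<^sub>R 1 + w *\<^sub>R \<i>"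
      unfolding standard_triangle_def convex_hull_3 by auto
    then show "0 \<le> Re z \<and> 0 \<le> Im z \<and> Re z + Im z \<le> 1" by auto
  next
    assume z: "0 \<le> Re z \<and> 0 \<le> Im z \<and> Re z + Im z \<le> 1"
    have "z = (1 - Re z - Im z) *\<^sub>R 0 + Re z *\<^sub>R 1 + Im z *\<^sub>R \<i>" by (simp add: complex_eq_iff)
    with z show "z \<in> standard_triangle"
      unfolding standard_triangle_def convex_hull_3 corner_simps mem_Collect_eq
      by (intro exI[of _ "1 - Re z - Im z"] exI[of _ "Re z"] exI[of _ "Im z"]) auto
  qed
  then show ?thesis by auto
qed

lemma interior_standard_triangle_eq:
  "interior standard_triangle = {z. 0 < Re z \<and> 0 < Im z \<and> Re z + Im z < 1}"
proof
  have "open {z. 0 < Re z \<and> 0 < Im z \<and> Re z + Im z < 1}"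
    by (intro open_Collect_conj open_Collect_less continuous_intros)
  then show "{z. 0 < Re z \<and> 0 < Im z \<and> Re z + Im z < 1} \<subseteq> interior standard_triangle"
    by (intro interior_maximal) (auto simp: standard_triangle_eq)
  show "interior standard_triangle \<subseteq> {z. 0 < Re z \<and> 0 < Im z \<and> Re z + Im z < 1}"
  proof
    fix z assume "z \<in> interior standard_triangle"
    then obtain e where e: "e > 0" "ball z e \<subseteq> standard_triangle" by (meson mem_interior)
    have in_t: "z + of_real (e/2) * u \<in> standard_triangle" if "norm u = 1" for u
    proof -
      have "z + of_real (e/2) * u \<in> ball z e" using e that by (simp add: dist_norm norm_mult)
      then show ?thesis using e(2) by blast
    qed
    show "z \<in> {z. 0 < Re z \<and> 0 < Im z \<and> Re z + Im z < 1}"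
      using in_t[of "-1"] in_t[of "-\<i>"] in_t[of 1] e(1) by (auto simp: standard_triangle_eq)
  qed
qed

text \<open>The sides are parametrised counterclockwise. Since \<open>corner\<close> reduces its
  index modulo 3, side 3 is side 0 again.\<close>

definition edge_point :: "nat \<Rightarrow> real \<Rightarrow> complex" where
  "edge_point k = linepath (corner k) (corner (Suc k))"

lemma corner_distinct: "corner k \<noteq> corner (Suc k)"
proof -
  have "k mod 3 < 3" by simp
  then consider "k mod 3 = 0" "Suc k mod 3 = 1" | "k mod 3 = 1" "Suc k mod 3 = 2" | "k mod 3 = 2" "Suc k mod 3 = 0"
    by (simp add: mod_Suc) linarith
  then show ?thesis by cases (simp_all add: corner_def)
qed

lemma side_eq: "side k = edge_point k ` {0<..<1}"
  using corner_distinct[of k] by (auto simp: side_def edge_point_def open_segment_image_interval linepath_def algebra_simps)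

lemma edge_point_inj: "edge_point k s = edge_point k s' \<longleftrightarrow> s = s'"
proof -
  have "edge_point k s - edge_point k s' = (s - s') *\<^sub>R (corner (Suc k) - corner k)"
    by (simp add: edge_point_def linepath_def algebra_simps)
  then show ?thesis using corner_distinct[of k] by (metis eq_iff_diff_eq_0 scaleR_eq_0_iff)
qed

lemma edge_point_simps:
  "edge_point 0 s = of_real s" "edge_point 1 s = Complex (1 - s) s"
  "edge_point (Suc 0) s = Complex (1 - s) s" "edge_point 2 s = Complex 0 (1 - s)"
  by (auto simp: edge_point_def linepath_def complex_eq_iff numeral_2_eq_2[symmetric] numeral_3_eq_3[symmetric])

lemma less_3_cases: "k < 3 \<Longrightarrow> (k::nat) = 0 \<or> k = 1 \<or> k = 2" by auto

lemma side_disjoint_interior: "k < 3 \<Longrightarrow> side k \<inter> interior standard_triangle = {}"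
  using less_3_cases[of k]
  by (auto simp: side_eq edge_point_simps interior_standard_triangle_eq)

lemma side_disjoint:
  assumes "k < 3" "l < 3" "k \<noteq> l" shows "side k \<inter> side l = {}"
  using less_3_cases[OF assms(1)] less_3_cases[OF assms(2)] assms(3)
  by (auto simp: side_eq edge_point_simps complex_eq_iff)

lemma standard_triangle_cases:
  assumes "z \<in> standard_triangle"
  obtains "z \<in> interior standard_triangle" | k where "k < 3" "z = corner k" | k where "k < 3" "z \<in> side k"
proof -
  have z: "0 \<le> Re z" "0 \<le> Im z" "Re z + Im z \<le> 1" using assms by (auto simp: standard_triangle_eq)
  note cases = that
  have on_edge: thesis if k: "k < 3" and u: "0 \<le> u" "u \<le> 1" and z: "z = edge_point k u" for k u
  proof -
    consider "u = 0" | "u = 1" | "u \<in> {0<..<1}" using u by fastforce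
    then show thesis
    proof cases
      case 1 then show ?thesis using cases(2)[of k] k z by (simp add: edge_point_def linepath_def)
    next
      case 2
      have "corner (Suc k mod 3) = corner (Suc k)" by (simp add: corner_def)
      then show ?thesis using 2 cases(2)[of "Suc k mod 3"] z by (simp add: edge_point_def linepath_def)
    next
      case 3 then show ?thesis using cases(3)[of k] k z by (auto simp: side_eq)
    qed
  qed
  consider "z \<in> interior standard_triangle" | "Re z = 0" | "Im z = 0" | "Re z + Im z = 1"
    using z unfolding interior_standard_triangle_eq mem_Collect_eq by linarith
  then show thesis
  proof cases
    case 1 then show ?thesis by (rule cases(1))
  next
    case 2
    then have "z = edge_point 2 (1 - Im z)" by (simp add: edge_point_simps complex_eq_iff)
    then show ?thesis using on_edge[of 2 "1 - Im z"] z 2 by simp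
  next
    case 3
    then have "z = edge_point 0 (Re z)" by (simp add: edge_point_simps complex_eq_iff)
    then show ?thesis using on_edge[of 0 "Re z"] z 3 by simp
  next
    case 4
    then have "z = edge_point 1 (Im z)" unfolding edge_point_simps by (simp add: complex_eq_iff)
    then show ?thesis using on_edge[of 1 "Im z"] z 4 by simp
  qed
qed

section \<open>Disjoint paths between two sides of a triangle\<close>

text \<open>Squaring straightens the corner at the origin, so that both sides adjacent to it come to lie
  on the real axis and the Fashoda theorem applies.\<close>

lemma noncrossing_corner:
  assumes w: "path w" "path_image w \<subseteq> standard_triangle" "path w'" "path_image w' \<subseteq> standard_triangle"
    and disj: "path_image w \<inter> path_image w' = {}"
    and ends: "pathstart w = edge_point 2 s" "pathfinish w = edge_point 3 u"
      "pathstart w' = edge_point 2 s'" "pathfinish w' = edge_point 3 u'"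
    and range: "s' < 1" "0 < u" "s < s'"
  shows "u' < u"
proof (rule ccontr)
  assume "\<not> u' < u"
  have ep3: "edge_point 3 = edge_point 0" by (simp add: edge_point_def corner_def)
  have "u \<noteq> u'"
    using disj ends pathfinish_in_path_image[of w] pathfinish_in_path_image[of w'] by auto
  with \<open>\<not> u' < u\<close> have "u < u'" by simp
  \<comment> \<open>Squaring with values in \<open>real^2\<close>, the type of the Fashoda theorem.
    The triangle lies in the first quadrant, so side 2 goes to the negative and side 0 to the
    positive real axis; the box from (-1, 0) to (1, 2) is a crude bound.\<close>
  define \<Phi> :: "complex \<Rightarrow> real^2" where "\<Phi> z = vector [Re (z^2), Im (z^2)]" for z
  have \<Phi>_nth: "\<Phi> z $ 1 = (Re z)^2 - (Im z)^2" "\<Phi> z $ 2 = 2 * Re z * Im z" for z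
    by (simp_all add: \<Phi>_def power2_eq_square)
  have cont: "continuous_on S \<Phi>" for S
  proof -
    have "\<Phi> = (\<lambda>z. \<chi> i. if i = 1 then Re (z^2) else Im (z^2))"
      by (auto simp: \<Phi>_def vec_eq_iff forall_2)
    moreover have "continuous_on S (\<lambda>z. if i = 1 then Re (z^2) else Im (z^2))" for i :: 2
      by (cases "i = 1") (auto intro!: continuous_intros)
    ultimately show ?thesis by (auto intro!: continuous_on_vec_lambda)
  qed
  have box: "\<Phi> ` standard_triangle \<subseteq> cbox (vector [-1, 0]) (vector [1, 2])"
  proof
    fix y assume "y \<in> \<Phi> ` standard_triangle"
    then obtain z where z: "y = \<Phi> z" "0 \<le> Re z" "0 \<le> Im z" "Re z + Im z \<le> 1"
      by (auto simp: standard_triangle_eq)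
    have "(Re z)^2 \<le> 1" "(Im z)^2 \<le> 1" using z by (auto simp: power_le_one)
    moreover have "Re z * Im z \<le> 1 * 1" using z by (intro mult_mono) auto
    moreover have "0 \<le> (Re z)^2" "0 \<le> (Im z)^2" "0 \<le> Re z * Im z" using z by auto
    ultimately show "y \<in> cbox (vector [-1, 0]) (vector [1, 2])"
      unfolding mem_box_cart forall_2 z(1) \<Phi>_nth vector_2 mult.assoc by linarith
  qed
  obtain x where x: "x \<in> path_image (\<Phi> \<circ> w)" "x \<in> path_image (\<Phi> \<circ> w')"
  proof (rule fashoda_interlace)
    show "path (\<Phi> \<circ> w)" "path (\<Phi> \<circ> w')" using w cont by (auto intro: path_continuous_image)
    show "path_image (\<Phi> \<circ> w) \<subseteq> cbox (vector [-1, 0]) (vector [1, 2])"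
      "path_image (\<Phi> \<circ> w') \<subseteq> cbox (vector [-1, 0]) (vector [1, 2])"
      unfolding path_image_compose by (rule order_trans[OF image_mono box], fact)+
    \<comment> \<open>On the bottom edge of the box the starts have abscissas
      \<open>- (1 - s)^2 < - (1 - s')^2\<close> and the ends \<open>u^2 < u'^2\<close>, so the four
      end points interlace.\<close>
    have sq: "(1 - s')^2 < (1 - s)^2" using range by (intro power_strict_mono) auto
    have squ: "u^2 < u'^2" using range \<open>u < u'\<close> by (intro power_strict_mono) auto
    show "pathstart (\<Phi> \<circ> w) $ 1 < pathstart (\<Phi> \<circ> w') $ 1"
      "pathfinish (\<Phi> \<circ> w) $ 1 < pathfinish (\<Phi> \<circ> w') $ 1"
      using sq squ by (simp_all add: pathstart_compose pathfinish_compose ends \<Phi>_nth edge_point_simps ep3)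
    have "0 \<le> (1 - s')^2" "0 < u^2" using range by auto
    then have "- ((1 - s')^2) < u^2" by linarith
    then show "pathstart (\<Phi> \<circ> w') $ 1 < pathfinish (\<Phi> \<circ> w) $ 1"
      by (simp add: pathstart_compose pathfinish_compose ends \<Phi>_nth edge_point_simps ep3)
  qed (simp_all add: pathstart_compose pathfinish_compose ends \<Phi>_nth edge_point_simps ep3)
  then obtain z z' where z: "z \<in> path_image w" "z' \<in> path_image w'" "\<Phi> z = \<Phi> z'"
    unfolding path_image_compose by (metis imageE)
  have "z^2 = z'^2"
    using arg_cong[OF z(3), of "\<lambda>v::real^2. v $ 1"] arg_cong[OF z(3), of "\<lambda>v::real^2. v $ 2"]
    by (simp add: \<Phi>_def complex_eq_iff)
  \<comment> \<open>Squaring is injective on the triangle: two opposite points of the first quadrant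
    are both the origin.\<close>
  then have "z = z' \<or> z = - z'" by (simp add: power2_eq_iff)
  moreover have "z \<in> standard_triangle" "z' \<in> standard_triangle" using z w by auto
  ultimately have "z = z'" by (auto simp: standard_triangle_eq complex_eq_iff)
  then show False using disj z by auto
qed

text \<open>The affine map that permutes the corners cyclically.\<close>

definition rotate_triangle :: "complex \<Rightarrow> complex" where
  "rotate_triangle z = Complex (1 - Re z - Im z) (Re z)"

lemma rotate_triangle_edge_point: "rotate_triangle (edge_point k s) = edge_point (Suc k) s"
proof -
  have c: "rotate_triangle (corner k) = corner (Suc k)" for k
  proof -
    have "k mod 3 < 3" by simp
    then consider "k mod 3 = 0" "Suc k mod 3 = 1" | "k mod 3 = 1" "Suc k mod 3 = 2" | "k mod 3 = 2" "Suc k mod 3 = 0"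
      by (simp add: mod_Suc) linarith
    then show ?thesis by cases (simp_all add: corner_def rotate_triangle_def complex_eq_iff)
  qed
  have "rotate_triangle ((1 - s) *\<^sub>R x + s *\<^sub>R y) = (1 - s) *\<^sub>R rotate_triangle x + s *\<^sub>R rotate_triangle y" for x y
    by (simp add: rotate_triangle_def complex_eq_iff algebra_simps)
  then show ?thesis by (simp add: edge_point_def linepath_def c)
qed

text \<open>Rotations bring the corner between the two sides to the origin, which is where sides 2
  and 3 meet.\<close>

lemma noncrossing_consecutive:
  assumes "k < 3"
    and "path w" "path_image w \<subseteq> standard_triangle" "path w'" "path_image w' \<subseteq> standard_triangle"
    and "path_image w \<inter> path_image w' = {}"
    and "pathstart w = edge_point k s" "pathfinish w = edge_point (Suc k) u"
      "pathstart w' = edge_point k s'" "pathfinish w' = edge_point (Suc k) u'"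
    and "s' < 1" "0 < u" "s < s'"
  shows "u' < u"
  using assms
proof (induction "2 - k" arbitrary: k w w')
  case 0
  then have "k = 2" by simp
  then show ?case using noncrossing_corner[of w w' s u s' u'] 0 by simp
next
  case (Suc j)
  have cont: "continuous_on S rotate_triangle" for S
    unfolding rotate_triangle_def Complex_eq by (intro continuous_intros)
  have im: "rotate_triangle ` S \<subseteq> standard_triangle" if "S \<subseteq> standard_triangle" for S
    using that by (auto simp: rotate_triangle_def standard_triangle_eq)
  have inj: "inj rotate_triangle"
    by (auto simp: inj_def rotate_triangle_def complex_eq_iff)
  show ?case
  proof (rule Suc.hyps(1))
    show "j = 2 - Suc k" "Suc k < 3" using Suc.hyps(2) by auto
    show "path (rotate_triangle \<circ> w)" "path (rotate_triangle \<circ> w')"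
      using Suc.prems cont by (auto intro: path_continuous_image)
    show "path_image (rotate_triangle \<circ> w) \<subseteq> standard_triangle" "path_image (rotate_triangle \<circ> w') \<subseteq> standard_triangle"
      unfolding path_image_compose by (rule im, fact)+
    show "path_image (rotate_triangle \<circ> w) \<inter> path_image (rotate_triangle \<circ> w') = {}"
      using Suc.prems image_Int[OF inj] by (simp add: path_image_compose flip: image_Int[OF inj])
  qed (use Suc.prems in \<open>auto simp: pathstart_compose pathfinish_compose rotate_triangle_edge_point\<close>)
qed

text \<open>Two distinct sides of a triangle are cyclically consecutive in one of the two orders;
  reversing the paths covers the other. The order of the end points is reversed because both sides
  run counterclockwise.\<close>

lemma noncrossing:
  assumes kl: "k < 3" "l < 3" "k \<noteq> l"
    and w: "path w" "path_image w \<subseteq> standard_triangle" "path w'" "path_image w' \<subseteq> standard_triangle"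
    and disj: "path_image w \<inter> path_image w' = {}"
    and ends: "pathstart w = edge_point k s" "pathfinish w = edge_point l u"
      "pathstart w' = edge_point k s'" "pathfinish w' = edge_point l u'"
    and range: "s \<in> {0<..<1}" "u \<in> {0<..<1}" "s' \<in> {0<..<1}" "u' \<in> {0<..<1}"
  shows "s < s' \<longleftrightarrow> u' < u"
proof -
  have ne: "s \<noteq> s'" "u \<noteq> u'"
    using disj ends pathstart_in_path_image[of w] pathstart_in_path_image[of w']
      pathfinish_in_path_image[of w] pathfinish_in_path_image[of w'] by auto
  have "Suc (Suc 0) = 2" by simp
  then have ep: "edge_point (Suc 2) = edge_point 0" "edge_point (Suc (Suc 0)) = edge_point 2"
    by (auto simp: edge_point_def corner_def)
  consider "edge_point l = edge_point (Suc k)" | "edge_point k = edge_point (Suc l)"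
    using less_3_cases[OF kl(1)] less_3_cases[OF kl(2)] kl(3) ep by auto
  then show ?thesis
  proof cases
    case 1
    have "u' < u" if "s < s'"
      by (rule noncrossing_consecutive[of k w w' s u s' u'])
        (use that kl w disj ends range 1 in simp_all)
    moreover have "u < u'" if "s' < s"
      by (rule noncrossing_consecutive[of k w' w s' u' s u])
        (use that kl w disj ends range 1 in \<open>simp_all add: Int_commute\<close>)
    ultimately show ?thesis using ne by linarith
  next
    case 2
    have "s' < s" if "u < u'"
      by (rule noncrossing_consecutive[of l "reversepath w" "reversepath w'" u s u' s'])
        (use that kl w disj ends range 2 in simp_all)
    moreover have "s < s'" if "u' < u"
      by (rule noncrossing_consecutive[of l "reversepath w'" "reversepath w" u' s' u s])
        (use that kl w disj ends range 2 in \<open>simp_all add: Int_commute\<close>)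
    ultimately show ?thesis using ne by linarith
  qed
qed

section \<open>Orientations of the triangles\<close>

text \<open>A similarity of degree 1 that carries the unit interval to side \<open>k\<close>. As the
  corners run counterclockwise, points above the interval go towards the interior of the
  triangle.\<close>

definition edge_chart :: "nat \<Rightarrow> complex \<Rightarrow> complex" where
  "edge_chart k z = corner k + (corner (Suc k) - corner k) * z"

lemma edge_chart_of_real: "edge_chart k (of_real s) = edge_point k s"
  by (simp add: edge_chart_def edge_point_def linepath_def algebra_simps scaleR_conv_of_real)

lemma edge_chart_inj: "edge_chart k z = edge_chart k w \<longleftrightarrow> z = w"
  using corner_distinct[of k] by (simp add: edge_chart_def)

lemma edge_chart_continuous: "continuous_on S (edge_chart k)"
  unfolding edge_chart_def by (intro continuous_intros)

lemma edge_chart_simps: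
  "edge_chart 0 z = z" "edge_chart (Suc 0) z = Complex (1 - Re z - Im z) (Re z - Im z)"
  "edge_chart 2 z = Complex (Im z) (1 - Re z)"
  by (auto simp: edge_chart_def complex_eq_iff corner_def)

text \<open>In fact a flat triangle over the unit interval. Edge charts preserve angles, and
  \<open>arctan (1/3)\<close> is less than half of 45 degrees, the smallest angle of the standard
  triangle; so the three images lie in the triangle and do not overlap.\<close>

definition half_disc :: "complex set" where
  "half_disc = {z. 0 \<le> Im z \<and> 3 * Im z < Re z \<and> 3 * Im z < 1 - Re z}"

lemma edge_chart_triangle:
  assumes "k < 3" "z \<in> half_disc"
  shows "edge_chart k z \<in> standard_triangle"
    and "0 < Im z \<Longrightarrow> edge_chart k z \<in> interior standard_triangle"
    and "edge_chart k z \<in> interior standard_triangle \<union> side k"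
proof -
  show 1: "edge_chart k z \<in> standard_triangle"
    using less_3_cases[OF assms(1)] assms(2)
    by (auto simp: edge_chart_simps half_disc_def standard_triangle_eq)
  show 2: "edge_chart k z \<in> interior standard_triangle" if "0 < Im z"
    using less_3_cases[OF assms(1)] assms(2) that
    by (auto simp: edge_chart_simps half_disc_def interior_standard_triangle_eq)
  show "edge_chart k z \<in> interior standard_triangle \<union> side k"
  proof (cases "Im z = 0")
    case True
    then have "z = of_real (Re z)" by (simp add: complex_eq_iff)
    then have "edge_chart k z = edge_point k (Re z)" by (metis edge_chart_of_real)
    moreover have "Re z \<in> {0<..<1}" using assms(2) True by (auto simp: half_disc_def)
    ultimately show ?thesis by (auto simp: side_eq)
  next
    case False
    then show ?thesis using 2 assms(2) by (auto simp: half_disc_def)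
  qed
qed

lemma edge_chart_disjoint:
  assumes "k < 3" "l < 3" "k \<noteq> l" "z \<in> half_disc" "w \<in> half_disc" "0 < Im z" "0 < Im w"
  shows "edge_chart k z \<noteq> edge_chart l w"
  using less_3_cases[OF assms(1)] less_3_cases[OF assms(2)] assms(3-)
  by (auto simp: edge_chart_simps half_disc_def complex_eq_iff)

lemma local_degree_of_edge_chart: "local_degree (edge_chart k) z = 1"
  unfolding edge_chart_def by (rule local_degree_affine) (use corner_distinct[of k] in auto)

lemma local_degree_edge_chart:
  assumes "continuous_on S f" "inj_on f S" "open S" "edge_chart k z \<in> S"
  shows "local_degree (f \<circ> edge_chart k) z = local_degree f (edge_chart k z)"
  using local_degree_compose[of UNIV "edge_chart k" z S f] assms
  by (simp add: edge_chart_continuous inj_def edge_chart_inj local_degree_of_edge_chart)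

text \<open>The local form of a gluing: the second triangle is turned below the real axis, and
  \<open>h\<close> changes the parameter along the axis. For increasing \<open>h\<close> this is a
  reflection up to a shear, for decreasing \<open>h\<close> a half-turn up to a shear.\<close>

lemma local_degree_reflected_shear:
  fixes h :: "real \<Rightarrow> real"
  assumes h: "continuous_on (ball (Re z) R) h" and "R > 0"
  shows "strict_mono_on (ball (Re z) R) h \<Longrightarrow> local_degree (\<lambda>w. Complex (h (Re w)) (- Im w)) z = -1"
    and "strict_antimono_on (ball (Re z) R) h \<Longrightarrow> local_degree (\<lambda>w. Complex (h (Re w)) (- Im w)) z = 1"
proof -
  show "local_degree (\<lambda>w. Complex (h (Re w)) (- Im w)) z = -1" if "strict_mono_on (ball (Re z) R) h"
  proof -
    have "local_degree (cnj \<circ> (\<lambda>w. Complex (h (Re w)) (Im w))) z = -1 * 1"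
      using local_degree_compose[of "ball z R" "\<lambda>w. Complex (h (Re w)) (Im w)" z UNIV cnj]
        shear_continuous[OF h] shear_inj[OF that] local_degree_cnj local_degree_shear[OF h that assms(2)] assms(2)
      by (auto simp: inj_def intro!: continuous_intros)
    moreover have "cnj \<circ> (\<lambda>w. Complex (h (Re w)) (Im w)) = (\<lambda>w. Complex (h (Re w)) (- Im w))"
      by (auto simp: complex_eq_iff)
    ultimately show ?thesis by simp
  qed
  show "local_degree (\<lambda>w. Complex (h (Re w)) (- Im w)) z = 1" if "strict_antimono_on (ball (Re z) R) h"
  proof -
    have mono: "strict_mono_on (ball (Re z) R) (\<lambda>x. - h x)"
      using that by (auto simp: monotone_on_def)
    have h': "continuous_on (ball (Re z) R) (\<lambda>x. - h x)" using h by (intro continuous_intros)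
    have neg: "local_degree (\<lambda>w. 0 + (-1) * w) u = 1" for u by (rule local_degree_affine) simp
    have neg': "continuous_on UNIV (\<lambda>w::complex. 0 + (-1) * w)" "inj (\<lambda>w::complex. 0 + (-1) * w)"
      by (intro continuous_intros, simp add: inj_def)
    have "local_degree ((\<lambda>w. 0 + (-1) * w) \<circ> (\<lambda>w. Complex (- h (Re w)) (Im w))) z = 1"
    proof -
      have "z \<in> ball z R" using assms(2) by simp
      from local_degree_compose[OF shear_continuous[OF h'] shear_inj[OF mono] open_ball this neg' open_UNIV UNIV_I]
      show ?thesis unfolding neg local_degree_shear[OF h' mono assms(2)] mult_1_left .
    qed
    moreover have "(\<lambda>w. 0 + (-1) * w) \<circ> (\<lambda>w. Complex (- h (Re w)) (Im w)) = (\<lambda>w. Complex (h (Re w)) (- Im w))"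
      by (auto simp: complex_eq_iff)
    ultimately show ?thesis by simp
  qed
qed

lemma orientation_preserving_local_degree:
  assumes "orientation_preserving_at f z"
  shows "local_degree f z = 1"
  unfolding local_degree_def
proof (rule the_equality)
  show ev: "\<forall>\<^sub>F r in at_right 0. winding_number (f \<circ> circlepath z r) (f z) = 1"
    using assms by (simp add: orientation_preserving_at_def)
  fix d assume "\<forall>\<^sub>F r in at_right 0. winding_number (f \<circ> circlepath z r) (f z) = d"
  with ev have "\<forall>\<^sub>F r::real in at_right 0. d = 1" by eventually_elim auto
  then show "d = 1" using eventually_const_iff trivial_limit_at_right_real by metis
qed

section \<open>Orientation of a triangle relative to the atlas\<close>

locale triangulated_surface =
  fixes M P :: "'a::t2_space set"
    and \<A> :: "('a set \<times> ('a \<Rightarrow> complex)) set"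
    and T :: "(real \<Rightarrow> 'a) set set"
    and rep :: "(real \<Rightarrow> 'a) set \<Rightarrow> real \<Rightarrow> 'a"
    and \<tau> :: "'a set \<Rightarrow> complex \<Rightarrow> 'a"
  assumes atlas: "oriented_atlas M \<A>"
    and rep_subset: "e \<in> T \<Longrightarrow> arc_interior (rep e) \<subseteq> M - P"
    and rep_disjoint: "e \<in> T \<Longrightarrow> e' \<in> T \<Longrightarrow> e \<noteq> e' \<Longrightarrow> arc_interior (rep e) \<inter> arc_interior (rep e') = {}"
    and maps: "characteristic_maps M P T rep \<tau>"
begin

abbreviation triangles where "triangles \<equiv> ideal_triangles M P T rep"

lemma triangle_subset: "t \<in> triangles \<Longrightarrow> t \<subseteq> M - P - arcs_union T rep"
  unfolding ideal_triangles_def by (rule in_components_subset)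

lemma triangle_disjoint: "t \<in> triangles \<Longrightarrow> t' \<in> triangles \<Longrightarrow> t \<noteq> t' \<Longrightarrow> t \<inter> t' = {}"
  unfolding ideal_triangles_def using components_nonoverlap by blast

lemma
  assumes t: "t \<in> triangles"
  shows map_continuous: "continuous_on standard_triangle (\<tau> t)"
    and map_range: "\<tau> t ` standard_triangle \<subseteq> M"
    and map_interior: "\<exists>g. homeomorphism (interior standard_triangle) t (\<tau> t) g"
    and map_corner: "k < 3 \<Longrightarrow> \<tau> t (corner k) \<in> P"
    and map_side: "k < 3 \<Longrightarrow> \<exists>e\<in>T. \<exists>g. homeomorphism (side k) (arc_interior (rep e)) (\<tau> t) g"
  using maps t unfolding characteristic_maps_def characteristic_map_def by auto

lemma homeomorphism_inj_on: "homeomorphism S S' f f' \<Longrightarrow> inj_on f S"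
  by (rule inj_on_inverseI) (rule homeomorphism_apply1)

lemma map_inj_interior: "t \<in> triangles \<Longrightarrow> inj_on (\<tau> t) (interior standard_triangle)"
  using map_interior[of t] homeomorphism_inj_on by blast

lemma map_inj_side: "t \<in> triangles \<Longrightarrow> k < 3 \<Longrightarrow> inj_on (\<tau> t) (side k)"
  using map_side[of t k] homeomorphism_inj_on by blast

lemma map_interior_in: "t \<in> triangles \<Longrightarrow> z \<in> interior standard_triangle \<Longrightarrow> \<tau> t z \<in> t"
  using map_interior[of t] homeomorphism_image1 by (metis imageI)

lemma map_side_in: "t \<in> triangles \<Longrightarrow> k < 3 \<Longrightarrow> z \<in> side k \<Longrightarrow> \<tau> t z \<in> arcs_union T rep"
  using map_side[of t k] homeomorphism_image1 unfolding arcs_union_def by (metis UN_I imageI)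

text \<open>A characteristic map may identify corners and, in a self-folded triangle, two sides. On
  the interior together with a single side it is injective, which suffices near an arc.\<close>

lemma map_inj_near_side:
  assumes "t \<in> triangles" "k < 3"
  shows "inj_on (\<tau> t) (interior standard_triangle \<union> side k)"
proof -
  have "\<tau> t x \<noteq> \<tau> t y" if "x \<in> interior standard_triangle" "y \<in> side k" for x y
    using map_interior_in[OF assms(1) that(1)] map_side_in[OF assms that(2)] triangle_subset[OF assms(1)] by auto
  then show ?thesis
    using map_inj_interior[OF assms(1)] map_inj_side[OF assms] unfolding inj_on_def by (metis UnE)
qed

lemma
  assumes "(U, \<phi>) \<in> \<A>"
  shows chart_open: "openin (top_of_set M) U"
    and chart_homeo: "\<exists>\<psi>. homeomorphism U (\<phi> ` U) \<phi> \<psi>"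
    and chart_continuous: "continuous_on U \<phi>"
    and chart_inj: "inj_on \<phi> U"
proof -
  show "openin (top_of_set M) U" and 1: "\<exists>\<psi>. homeomorphism U (\<phi> ` U) \<phi> \<psi>"
    using atlas assms unfolding oriented_atlas_def by auto
  then show "continuous_on U \<phi>" "inj_on \<phi> U"
    by (auto dest: homeomorphism_cont1 intro: inj_on_inverseI homeomorphism_apply1)
qed

lemma chart_exists: "x \<in> M \<Longrightarrow> \<exists>U \<phi>. (U, \<phi>) \<in> \<A> \<and> x \<in> U"
  using atlas unfolding oriented_atlas_def by blast

lemma chart_orientation:
  "(U, \<phi>) \<in> \<A> \<Longrightarrow> (V, \<psi>) \<in> \<A> \<Longrightarrow> x \<in> U \<Longrightarrow> x \<in> V \<Longrightarrow>
    orientation_preserving_at (\<psi> \<circ> inv_into U \<phi>) (\<phi> x)"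
  using atlas unfolding oriented_atlas_def by blast

definition chart_domain :: "'a set \<Rightarrow> 'a set \<Rightarrow> complex set" where
  "chart_domain t U = interior standard_triangle \<inter> \<tau> t -` U"

lemma chart_domain:
  assumes t: "t \<in> triangles" and U: "(U, \<phi>) \<in> \<A>"
  shows "open (chart_domain t U)" "continuous_on (chart_domain t U) (\<phi> \<circ> \<tau> t)"
    "inj_on (\<phi> \<circ> \<tau> t) (chart_domain t U)"
proof -
  have cont: "continuous_on (interior standard_triangle) (\<tau> t)"
    using map_continuous[OF t] continuous_on_subset interior_subset by blast
  obtain O' where O': "open O'" "U = M \<inter> O'" using chart_open[OF U] by (metis openin_open)
  have "\<tau> t ` interior standard_triangle \<subseteq> M"
    using map_range[OF t] interior_subset by (metis image_mono order_trans)
  then have "chart_domain t U = interior standard_triangle \<inter> \<tau> t -` O'"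
    unfolding chart_domain_def O'(2) by blast
  then show "open (chart_domain t U)" using continuous_open_preimage[OF cont _ O'(1)] by simp
  have sub: "chart_domain t U \<subseteq> interior standard_triangle" "\<tau> t ` chart_domain t U \<subseteq> U"
    by (auto simp: chart_domain_def)
  show "continuous_on (chart_domain t U) (\<phi> \<circ> \<tau> t)"
    by (rule continuous_on_compose[OF continuous_on_subset[OF cont sub(1)] continuous_on_subset[OF chart_continuous[OF U] sub(2)]])
  show "inj_on (\<phi> \<circ> \<tau> t) (chart_domain t U)"
    by (rule comp_inj_on[OF inj_on_subset[OF map_inj_interior[OF t] sub(1)] inj_on_subset[OF chart_inj[OF U] sub(2)]])
qed

text \<open>The two readings of the characteristic map differ by a transition map of the atlas,
  which has degree 1, and degrees multiply.\<close>

lemma chart_degree_unique: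
  assumes t: "t \<in> triangles" and U: "(U, \<phi>) \<in> \<A>" and V: "(V, \<psi>) \<in> \<A>"
    and w: "w \<in> chart_domain t U" "w \<in> chart_domain t V"
  shows "local_degree (\<psi> \<circ> \<tau> t) w = local_degree (\<phi> \<circ> \<tau> t) w"
proof -
  define W where "W = chart_domain t U \<inter> chart_domain t V"
  note dU = chart_domain[OF t U] and dV = chart_domain[OF t V]
  have W: "open W" "w \<in> W" using dU dV w by (auto simp: W_def)
  have contU: "continuous_on W (\<phi> \<circ> \<tau> t)" and injU: "inj_on (\<phi> \<circ> \<tau> t) W"
    using dU W_def continuous_on_subset inj_on_subset by (metis Int_lower1)+
  have contV: "continuous_on W (\<psi> \<circ> \<tau> t)" and injV: "inj_on (\<psi> \<circ> \<tau> t) W"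
    using dV W_def continuous_on_subset inj_on_subset by (metis Int_lower2)+
  define g where "g = \<psi> \<circ> inv_into U \<phi>"
  have inv: "inv_into U \<phi> (\<phi> x) = x" if "x \<in> U" for x
    using chart_inj[OF U] that by simp
  have g: "g ((\<phi> \<circ> \<tau> t) x) = (\<psi> \<circ> \<tau> t) x" if "x \<in> W" for x
    using that inv by (auto simp: g_def W_def chart_domain_def)
  obtain \<phi>' where \<phi>': "homeomorphism U (\<phi> ` U) \<phi> \<phi>'" using chart_homeo[OF U] by blast
  have WU: "\<tau> t ` W \<subseteq> U" "\<tau> t ` W \<subseteq> V" by (auto simp: W_def chart_domain_def)
  define S where "S = (\<phi> \<circ> \<tau> t) ` W"
  have S: "open S" unfolding S_def by (rule invariance_of_domain[OF contU W(1) injU])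
  have S_sub: "S \<subseteq> \<phi> ` U" using WU by (auto simp: S_def)
  have inv': "\<phi>' y = inv_into U \<phi> y" if "y \<in> S" for y
    using that S_sub homeomorphism_apply1[OF \<phi>'] inv by force
  have contg: "continuous_on S g"
    unfolding g_def
  proof (rule continuous_on_compose)
    show "continuous_on S (inv_into U \<phi>)"
      using continuous_on_subset[OF homeomorphism_cont2[OF \<phi>'] S_sub] inv' by (rule continuous_on_eq)
    show "continuous_on (inv_into U \<phi> ` S) \<psi>"
    proof (rule continuous_on_subset[OF chart_continuous[OF V]])
      show "inv_into U \<phi> ` S \<subseteq> V" using WU inv by (auto simp: S_def)
    qed
  qed
  have injg: "inj_on g S"
  proof (rule inj_onI)
    fix x y assume "x \<in> S" "y \<in> S" "g x = g y"
    then obtain u v where "u \<in> W" "v \<in> W" "x = (\<phi> \<circ> \<tau> t) u" "y = (\<phi> \<circ> \<tau> t) v" by (auto simp: S_def)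
    with \<open>g x = g y\<close> g injV show "x = y" by (metis inj_onD)
  qed
  obtain R where R: "R > 0" "ball w R \<subseteq> W" using W openE by blast
  have "local_degree (\<psi> \<circ> \<tau> t) w = local_degree (g \<circ> (\<phi> \<circ> \<tau> t)) w"
  proof (rule local_degree_cong[OF _ R(1)])
    show "(\<psi> \<circ> \<tau> t) x = (g \<circ> (\<phi> \<circ> \<tau> t)) x" if "x \<in> ball w R" for x
      using g[of x] that R by auto
    show "continuous_on (ball w R) (\<psi> \<circ> \<tau> t)" "inj_on (\<psi> \<circ> \<tau> t) (ball w R)"
      by (rule continuous_on_subset[OF contV R(2)], rule inj_on_subset[OF injV R(2)])
  qed
  also have "\<dots> = local_degree g ((\<phi> \<circ> \<tau> t) w) * local_degree (\<phi> \<circ> \<tau> t) w"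
    by (rule local_degree_compose[OF contU injU W contg injg S]) (use W in \<open>auto simp: S_def\<close>)
  also have "local_degree g ((\<phi> \<circ> \<tau> t) w) = 1"
    unfolding g_def comp_apply[of \<phi>]
    by (rule orientation_preserving_local_degree[OF chart_orientation[OF U V]])
      (use w in \<open>auto simp: chart_domain_def\<close>)
  finally show ?thesis by (simp only: mult_1_left)
qed

text \<open>Near each point a single chart computes the degree, which is constant there; the
  interior of the triangle is connected.\<close>

lemma orientation_exists:
  assumes t: "t \<in> triangles"
  shows "\<exists>d. (d = 1 \<or> d = -1) \<and>
    (\<forall>(U, \<phi>)\<in>\<A>. \<forall>w\<in>chart_domain t U. local_degree (\<phi> \<circ> \<tau> t) w = d)"
proof -
  define K where "K = interior standard_triangle"
  have "\<exists>c. \<forall>w\<in>K. c w \<in> \<A> \<and> w \<in> chart_domain t (fst (c w))"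
  proof (rule bchoice, rule ballI)
    fix w assume "w \<in> K"
    moreover from this have "\<tau> t w \<in> M" using map_range[OF t] interior_subset unfolding K_def by blast
    ultimately obtain U \<phi> where "(U, \<phi>) \<in> \<A>" "w \<in> chart_domain t U"
      using chart_exists[of "\<tau> t w"] by (auto simp: chart_domain_def K_def)
    then show "\<exists>c. c \<in> \<A> \<and> w \<in> chart_domain t (fst c)" by force
  qed
  then obtain c where c: "\<And>w. w \<in> K \<Longrightarrow> c w \<in> \<A>" "\<And>w. w \<in> K \<Longrightarrow> w \<in> chart_domain t (fst (c w))" by blast
  define D where "D w = local_degree (snd (c w) \<circ> \<tau> t) w" for w
  have D: "local_degree (\<phi> \<circ> \<tau> t) w = D w" if "(U, \<phi>) \<in> \<A>" "w \<in> chart_domain t U" for U \<phi> w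
  proof -
    have "w \<in> K" using that(2) by (simp add: chart_domain_def K_def)
    then show ?thesis
      unfolding D_def using chart_degree_unique[OF t _ that(1) _ that(2), of "fst (c w)" "snd (c w)"] c by simp
  qed
  have "D constant_on K"
  proof (rule locally_constant_imp_constant)
    show "connected K" unfolding K_def standard_triangle_def
      by (intro convex_connected convex_interior convex_convex_hull)
    fix w assume w: "w \<in> K"
    note d = chart_domain[OF t, of "fst (c w)" "snd (c w)"]
    have cw: "(fst (c w), snd (c w)) \<in> \<A>" using c(1)[OF w] by simp
    obtain R where R: "R > 0" "ball w R \<subseteq> chart_domain t (fst (c w))"
      using d(1)[OF cw] c(2)[OF w] openE by blast
    have "D u = D w" if u: "u \<in> ball w R" for u
    proof -
      have "local_degree (snd (c w) \<circ> \<tau> t) u = local_degree (snd (c w) \<circ> \<tau> t) w"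
        by (rule local_degree_constant[OF continuous_on_subset[OF d(2)[OF cw] R(2)] inj_on_subset[OF d(3)[OF cw] R(2)]])
          (use u R(1) in auto)
      moreover have "u \<in> chart_domain t (fst (c w))" using u R(2) by blast
      ultimately show ?thesis using D[OF cw] c(2)[OF w] by metis
    qed
    moreover have "ball w R \<subseteq> K" using R(2) by (auto simp: chart_domain_def K_def)
    ultimately show "\<exists>S. openin (top_of_set K) S \<and> w \<in> S \<and> (\<forall>x\<in>S. D x = D w)"
      using R(1) open_ball open_subset centre_in_ball by meson
  qed
  then obtain d where d: "\<And>w. w \<in> K \<Longrightarrow> D w = d" by (auto simp: constant_on_def)
  have "Complex (1/4) (1/4) \<in> K" by (simp add: K_def interior_standard_triangle_eq)
  then obtain w where w: "w \<in> K" by blast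
  have cw: "(fst (c w), snd (c w)) \<in> \<A>" using c(1)[OF w] by simp
  obtain R where R: "R > 0" "ball w R \<subseteq> chart_domain t (fst (c w))"
    using chart_domain(1)[OF t cw] c(2)[OF w] openE by blast
  have "D w = 1 \<or> D w = -1"
    unfolding D_def
    by (rule local_degree_cases[OF continuous_on_subset[OF chart_domain(2)[OF t cw] R(2)]
          inj_on_subset[OF chart_domain(3)[OF t cw] R(2)] R(1)])
  moreover have "\<forall>(U, \<phi>)\<in>\<A>. \<forall>w\<in>chart_domain t U. local_degree (\<phi> \<circ> \<tau> t) w = d"
    using D d by (auto simp: chart_domain_def K_def)
  ultimately show ?thesis unfolding d[OF w] by (intro exI[of _ d] conjI)
qed

definition orientation :: "'a set \<Rightarrow> complex" where
  "orientation t = (SOME d. (d = 1 \<or> d = -1) \<and>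
     (\<forall>(U, \<phi>)\<in>\<A>. \<forall>w\<in>chart_domain t U. local_degree (\<phi> \<circ> \<tau> t) w = d))"

lemma
  assumes t: "t \<in> triangles"
  shows orientation_cases: "orientation t = 1 \<or> orientation t = -1"
    and orientation_eq: "(U, \<phi>) \<in> \<A> \<Longrightarrow> w \<in> chart_domain t U \<Longrightarrow> local_degree (\<phi> \<circ> \<tau> t) w = orientation t"
proof -
  have "(orientation t = 1 \<or> orientation t = -1) \<and>
    (\<forall>(U, \<phi>)\<in>\<A>. \<forall>w\<in>chart_domain t U. local_degree (\<phi> \<circ> \<tau> t) w = orientation t)"
    unfolding orientation_def using orientation_exists[OF t] by (rule someI_ex)
  then show "orientation t = 1 \<or> orientation t = -1"
    "(U, \<phi>) \<in> \<A> \<Longrightarrow> w \<in> chart_domain t U \<Longrightarrow> local_degree (\<phi> \<circ> \<tau> t) w = orientation t" by auto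
qed

section \<open>Gluing of triangles along an arc\<close>

abbreviation sides where "sides \<equiv> local_sides M P T rep \<tau>"

lemma sidesD:
  assumes "(t, k) \<in> sides e"
  shows "t \<in> triangles" "k < 3" "\<tau> t ` side k = arc_interior (rep e)"
  using assms by (auto simp: local_sides_def)

lemma side_homeomorphism:
  assumes "e \<in> T" "(t, k) \<in> sides e"
  shows "\<exists>g. homeomorphism (side k) (arc_interior (rep e)) (\<tau> t) g"
proof -
  obtain e' g where "e' \<in> T" "homeomorphism (side k) (arc_interior (rep e')) (\<tau> t) g"
    using map_side sidesD[OF assms(2)] by blast
  then show ?thesis using sidesD(3)[OF assms(2)] homeomorphism_image1 by metis
qed

text \<open>\<open>h\<close> is the change of parameter from one local side to the other; being
  continuous and injective on an interval, it is monotone.\<close>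

lemma gluing_map:
  assumes e: "e \<in> T" and side: "(t, k) \<in> sides e" "(t', k') \<in> sides e"
  obtains h where "continuous_on {0<..<1} h" "strict_mono_on {0<..<1} h \<or> strict_antimono_on {0<..<1} h"
    "\<And>x. x \<in> {0<..<1} \<Longrightarrow> h x \<in> {0<..<1}"
    "\<And>x. x \<in> {0<..<1} \<Longrightarrow> \<tau> t (edge_point k x) = \<tau> t' (edge_point k' (h x))"
proof -
  obtain g where g: "homeomorphism (side k) (arc_interior (rep e)) (\<tau> t) g"
    using side_homeomorphism[OF e side(1)] by blast
  obtain g' where g': "homeomorphism (side k') (arc_interior (rep e)) (\<tau> t') g'"
    using side_homeomorphism[OF e side(2)] by blast
  define p where "p z = Re ((z - corner k') / (corner (Suc k') - corner k'))" for z
  have p: "p (edge_point k' x) = x" for x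
  proof -
    have "edge_point k' x - corner k' = of_real x * (corner (Suc k') - corner k')"
      by (simp add: edge_point_def linepath_def scaleR_conv_of_real algebra_simps)
    then show ?thesis using corner_distinct[of k'] by (simp add: p_def)
  qed
  have p_cont: "continuous_on S p" for S
    unfolding p_def using corner_distinct[of k'] by (intro continuous_intros) auto
  define h where "h = p \<circ> (g' \<circ> (\<tau> t \<circ> edge_point k))"
  have in_side: "edge_point k x \<in> side k" if "x \<in> {0<..<1}" for x
    using that by (auto simp: side_eq)
  have in_arc: "\<tau> t (edge_point k x) \<in> arc_interior (rep e)" if "x \<in> {0<..<1}" for x
    using homeomorphism_image1[OF g] in_side[OF that] by blast
  have h: "h x \<in> {0<..<1} \<and> edge_point k' (h x) = g' (\<tau> t (edge_point k x))" if "x \<in> {0<..<1}" for x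
  proof -
    have "g' (\<tau> t (edge_point k x)) \<in> side k'"
      using homeomorphism_image2[OF g'] in_arc[OF that] by blast
    then obtain y where "y \<in> {0<..<1}" "g' (\<tau> t (edge_point k x)) = edge_point k' y"
      by (auto simp: side_eq)
    then show ?thesis by (simp add: h_def p)
  qed
  have glue: "\<tau> t (edge_point k x) = \<tau> t' (edge_point k' (h x))" if "x \<in> {0<..<1}" for x
    using h[OF that] homeomorphism_apply2[OF g' in_arc[OF that]] by simp
  have cont: "continuous_on {0<..<1} h"
    unfolding h_def
  proof (intro continuous_on_compose)
    show "continuous_on {0<..<1} (edge_point k)"
      unfolding edge_point_def by (intro continuous_on_linepath)
    show "continuous_on (edge_point k ` {0<..<1}) (\<tau> t)"
      using homeomorphism_cont1[OF g] by (simp add: side_eq)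
    show "continuous_on ((\<tau> t \<circ> edge_point k) ` {0<..<1}) g'"
      by (rule continuous_on_subset[OF homeomorphism_cont2[OF g']]) (use in_arc in auto)
    show "continuous_on ((g' \<circ> (\<tau> t \<circ> edge_point k)) ` {0<..<1}) p" by (rule p_cont)
  qed
  have "inj_on h {0<..<1}"
  proof (rule inj_onI)
    fix x y :: real assume xy: "x \<in> {0<..<1}" "y \<in> {0<..<1}" "h x = h y"
    then have "\<tau> t (edge_point k x) = \<tau> t (edge_point k y)" using glue by metis
    then have "edge_point k x = edge_point k y"
      using homeomorphism_apply1[OF g] in_side xy by metis
    then show "x = y" by (simp add: edge_point_inj)
  qed
  then have "strict_mono_on {0<..<1} h \<or> strict_antimono_on {0<..<1} h"
    using injective_eq_monotone_map[OF _ cont] by (simp add: is_interval_oo)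
  with cont h glue show thesis using that by blast
qed

text \<open>In a chart about a point of the arc, \<open>t\<close> is placed above and
  \<open>t'\<close> below the real axis. The glued map has the same degree on both halves, and the
  degree of the flip \<open>A\<close> is -1 or 1 according to the monotonicity of
  \<open>h\<close>.\<close>

lemma gluing_orientation:
  assumes e: "e \<in> T" and side: "(t, k) \<in> sides e" "(t', k') \<in> sides e" "(t, k) \<noteq> (t', k')"
    and h: "continuous_on {0<..<1} h"
      "\<And>x. x \<in> {0<..<1} \<Longrightarrow> h x \<in> {0<..<1}"
      "\<And>x. x \<in> {0<..<1} \<Longrightarrow> \<tau> t (edge_point k x) = \<tau> t' (edge_point k' (h x))"
  shows "strict_mono_on {0<..<1} h \<Longrightarrow> orientation t = - orientation t'"
    and "strict_antimono_on {0<..<1} h \<Longrightarrow> orientation t = orientation t'"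
proof -
  note tk = sidesD[OF side(1)] and tk' = sidesD[OF side(2)]
  define A where "A z = Complex (h (Re z)) (- Im z)" for z
  define c :: complex where "c = of_real (1/2)"
  define f1 where "f1 = \<tau> t \<circ> edge_chart k"
  define f2 where "f2 = \<tau> t' \<circ> (edge_chart k' \<circ> A)"
  define H where "H = {z. Re z \<in> {0<..<1} \<and> Im z \<le> 0 \<and> A z \<in> half_disc}"
  have A_cont: "continuous_on S A" if "S \<subseteq> {z. Re z \<in> {0<..<1}}" for S
    unfolding A_def Complex_eq
    by (intro continuous_intros continuous_on_compose2[OF h(1)]) (use that in auto)
  have cont1: "continuous_on half_disc f1"
    unfolding f1_def
    by (intro continuous_on_compose edge_chart_continuous continuous_on_subset[OF map_continuous[OF tk(1)]])
      (use edge_chart_triangle(1)[OF tk(2)] in blast)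
  have cont2: "continuous_on H f2"
    unfolding f2_def
  proof (intro continuous_on_compose edge_chart_continuous)
    show "continuous_on H A" by (rule A_cont) (auto simp: H_def)
    show "continuous_on ((edge_chart k' \<circ> A) ` H) (\<tau> t')"
      by (rule continuous_on_subset[OF map_continuous[OF tk'(1)]])
        (use edge_chart_triangle(1)[OF tk'(2)] in \<open>auto simp: H_def\<close>)
  qed
  have range1: "f1 ` half_disc \<subseteq> M" using map_range[OF tk(1)] edge_chart_triangle(1)[OF tk(2)] unfolding f1_def by fastforce
  have range2: "f2 ` H \<subseteq> M" using map_range[OF tk'(1)] edge_chart_triangle(1)[OF tk'(2)] unfolding f2_def H_def by fastforce
  have agree: "f1 z = f2 z" if "Im z = 0" "Re z \<in> {0<..<1}" for z
  proof -
    have "z = of_real (Re z)" using that by (simp add: complex_eq_iff)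
    then have "edge_chart k z = edge_point k (Re z)" by (metis edge_chart_of_real)
    moreover have "A z = of_real (h (Re z))" using that by (simp add: A_def complex_eq_iff)
    ultimately show ?thesis using h(3)[OF that(2)] by (simp add: f1_def f2_def edge_chart_of_real)
  qed
  have c: "c \<in> half_disc" "c \<in> H" "Re c = 1/2" "Im c = 0"
    using h(2)[of "1/2"] by (auto simp: c_def half_disc_def H_def A_def)
  obtain U \<phi> where U: "(U, \<phi>) \<in> \<A>" "f1 c \<in> U" using chart_exists range1 c(1) by blast
  have "f2 c \<in> U" using agree[of c] U(2) c by simp
  obtain O' where O': "open O'" "U = M \<inter> O'" using chart_open[OF U(1)] by (metis openin_open)
  obtain O1 where O1: "open O1" "O1 \<inter> half_disc = f1 -` O' \<inter> half_disc"
    using cont1 O'(1) unfolding continuous_on_open_invariant by metis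
  obtain O2 where O2: "open O2" "O2 \<inter> H = f2 -` O' \<inter> H"
    using cont2 O'(1) unfolding continuous_on_open_invariant by metis
  \<comment> \<open>\<open>half_disc\<close> contains part of the axis and is not open.
    \<open>N\<close> and \<open>N'\<close> are open, and on the upper and the lower half they force
    \<open>z\<close> and \<open>A z\<close>, respectively, into \<open>half_disc\<close>.\<close>
  define N where "N = {z. Re z \<in> {0<..<1} \<and> \<bar>3 * Im z\<bar> < Re z \<and> \<bar>3 * Im z\<bar> < 1 - Re z}"
  have N: "open N"
    unfolding N_def greaterThanLessThan_iff
    by (intro open_Collect_conj open_Collect_less continuous_intros)
  define N' where "N' = {z. Re z \<in> {0<..<1}} \<inter> A -` {z. - 3 * Im z < Re z \<and> - 3 * Im z < 1 - Re z \<and> 3 * Im z < Re z \<and> 3 * Im z < 1 - Re z}"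
  have N': "open N'"
    unfolding N'_def
  proof (rule continuous_open_preimage[OF A_cont])
    show "open {z. Re z \<in> {0<..<1}}"
      unfolding greaterThanLessThan_iff by (intro open_Collect_conj open_Collect_less continuous_intros)
    show "open {z. - 3 * Im z < Re z \<and> - 3 * Im z < 1 - Re z \<and> 3 * Im z < Re z \<and> 3 * Im z < 1 - Re z}"
      by (intro open_Collect_conj open_Collect_less continuous_intros)
  qed simp
  have "c \<in> O1 \<inter> O2 \<inter> N \<inter> N'"
    using O1(2) O2(2) c U(2) \<open>f2 c \<in> U\<close> O'(2) h(2)[of "Re c"] by (auto simp: N_def N'_def A_def)
  then obtain R where R: "R > 0" "ball c R \<subseteq> O1 \<inter> O2 \<inter> N \<inter> N'"
    using O1(1) O2(1) N N' open_contains_ball[of "O1 \<inter> O2 \<inter> N \<inter> N'"] by (metis open_Int)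
  have B: "z \<in> O1" "z \<in> O2" "z \<in> N" "z \<in> N'" if "z \<in> ball c R" for z using R(2) that by auto
  define D1 where "D1 = ball c R \<inter> {z. Im z \<ge> 0}"
  define D2 where "D2 = ball c R \<inter> {z. Im z \<le> 0}"
  have Re_ball: "Re z \<in> {0<..<1}" if "z \<in> ball c R" for z using B(3)[OF that] by (simp add: N_def)
  have D1: "z \<in> half_disc" "f1 z \<in> U" if "z \<in> D1" for z
  proof -
    show *: "z \<in> half_disc" using B(3)[of z] that by (auto simp: D1_def N_def half_disc_def)
    then show "f1 z \<in> U" using O1(2) B(1)[of z] that O'(2) range1 by (auto simp: D1_def)
  qed
  have D2: "A z \<in> half_disc" "z \<in> H" "f2 z \<in> U" if "z \<in> D2" for z
  proof -
    show *: "A z \<in> half_disc" using B(4)[of z] that by (auto simp: D2_def N'_def half_disc_def A_def)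
    then show **: "z \<in> H" using Re_ball[of z] that by (auto simp: D2_def H_def)
    then show "f2 z \<in> U" using O2(2) B(2)[of z] that O'(2) range2 by (auto simp: D2_def)
  qed
  have f1_inj: "inj_on f1 D1"
  proof -
    have "inj_on (edge_chart k) D1" by (simp add: inj_on_def edge_chart_inj)
    moreover have "inj_on (\<tau> t) (edge_chart k ` D1)"
      by (rule inj_on_subset[OF map_inj_near_side[OF tk(1,2)]])
        (use edge_chart_triangle(3)[OF tk(2)] D1(1) in blast)
    ultimately show ?thesis unfolding f1_def by (rule comp_inj_on)
  qed
  have f2_inj: "inj_on f2 D2" if mono: "inj_on h {0<..<1}"
  proof -
    have "inj_on A D2"
    proof (rule inj_onI)
      fix x y assume "x \<in> D2" "y \<in> D2" "A x = A y"
      then show "x = y" using inj_onD[OF mono, of "Re x" "Re y"] Re_ball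
        by (auto simp: A_def D2_def complex_eq_iff)
    qed
    moreover have "inj_on (edge_chart k') (A ` D2)" by (simp add: inj_on_def edge_chart_inj)
    ultimately have "inj_on (edge_chart k' \<circ> A) D2" by (rule comp_inj_on)
    moreover have "inj_on (\<tau> t') ((edge_chart k' \<circ> A) ` D2)"
    proof (rule inj_on_subset[OF map_inj_near_side[OF tk'(1,2)]])
      show "(edge_chart k' \<circ> A) ` D2 \<subseteq> interior standard_triangle \<union> side k'"
        using edge_chart_triangle(3)[OF tk'(2)] D2(1) by fastforce
    qed
    ultimately show ?thesis unfolding f2_def by (rule comp_inj_on)
  qed
  have f_ne: "f1 z \<noteq> f2 w" if "z \<in> D1" "0 < Im z" "w \<in> D2" "Im w < 0" for z w
  proof -
    have z: "edge_chart k z \<in> interior standard_triangle"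
      using edge_chart_triangle(2)[OF tk(2) D1(1)[OF that(1)] that(2)] .
    have Aw: "0 < Im (A w)" using that by (simp add: A_def)
    have w: "edge_chart k' (A w) \<in> interior standard_triangle"
      using edge_chart_triangle(2)[OF tk'(2) D2(1)[OF that(3)] Aw] .
    show ?thesis
    \<comment> \<open>At a self-folded arc the same triangle lies on both local sides; the points
      are then told apart by the disjoint regions over two different sides of it.\<close>
    proof (cases "t = t'")
      case True
      then have "edge_chart k z \<noteq> edge_chart k' (A w)"
        using edge_chart_disjoint[OF tk(2) tk'(2) _ D1(1)[OF that(1)] D2(1)[OF that(3)] that(2) Aw] side(3) by auto
      then show ?thesis using inj_onD[OF map_inj_interior[OF tk(1)]] z w True by (auto simp: f1_def f2_def)
    next
      case False
      then show ?thesis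
        using map_interior_in[OF tk(1) z] map_interior_in[OF tk'(1) w] triangle_disjoint[OF tk(1) tk'(1)]
        by (auto simp: f1_def f2_def)
    qed
  qed
  define z1 where "z1 = Complex (1/2) (R/2)"
  define z2 where "z2 = Complex (1/2) (- R/2)"
  have "dist c z1 = R/2" "dist c z2 = R/2" using R(1) by (auto simp: c_def z1_def z2_def dist_norm complex_norm cmod_def)
  then have z12: "z1 \<in> ball c R" "z2 \<in> ball c R" "Im z1 > 0" "Im z2 < 0" using R(1) by (auto simp: z1_def z2_def)
  have U1: "edge_chart k z1 \<in> chart_domain t U"
    using edge_chart_triangle(2)[OF tk(2) D1(1)] D1(2)[of z1] z12 by (auto simp: D1_def chart_domain_def f1_def)
  have U2: "edge_chart k' (A z2) \<in> chart_domain t' U"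
    using edge_chart_triangle(2)[OF tk'(2) D2(1)] D2(3)[of z2] z12 by (auto simp: D2_def chart_domain_def f2_def A_def)
  have deg1: "local_degree (\<phi> \<circ> f1) z1 = orientation t"
    unfolding f1_def comp_assoc[symmetric]
    using local_degree_edge_chart[OF chart_domain(2,3,1)[OF tk(1) U(1)] U1] orientation_eq[OF tk(1) U(1) U1] by simp
  have glue: "orientation t = local_degree (\<phi> \<circ> f2) z2" if mono: "inj_on h {0<..<1}"
    unfolding deg1[symmetric]
  proof (rule local_degree_glue)
    show "continuous_on (ball c R \<inter> {z. 0 \<le> Im z}) (\<phi> \<circ> f1)"
      by (rule continuous_on_compose[OF continuous_on_subset[OF cont1] continuous_on_subset[OF chart_continuous[OF U(1)]]])
        (use D1 in \<open>auto simp: D1_def\<close>)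
    show "continuous_on (ball c R \<inter> {z. Im z \<le> 0}) (\<phi> \<circ> f2)"
      by (rule continuous_on_compose[OF continuous_on_subset[OF cont2] continuous_on_subset[OF chart_continuous[OF U(1)]]])
        (use D2 in \<open>auto simp: D2_def\<close>)
    show "inj_on (\<phi> \<circ> f1) (ball c R \<inter> {z. 0 \<le> Im z})"
      using comp_inj_on[OF f1_inj inj_on_subset[OF chart_inj[OF U(1)] image_subsetI]] D1(2) unfolding D1_def by metis
    show "inj_on (\<phi> \<circ> f2) (ball c R \<inter> {z. Im z \<le> 0})"
      using comp_inj_on[OF f2_inj[OF mono] inj_on_subset[OF chart_inj[OF U(1)] image_subsetI]] D2(3) unfolding D2_def by metis
    show "(\<phi> \<circ> f1) z = (\<phi> \<circ> f2) z" if "z \<in> ball c R" "Im z = 0" for z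
      using agree[OF that(2) Re_ball[OF that(1)]] by simp
    show "(\<phi> \<circ> f1) ` (ball c R \<inter> {z. 0 < Im z}) \<inter> (\<phi> \<circ> f2) ` (ball c R \<inter> {z. Im z < 0}) = {}"
    proof -
      have "\<phi> (f1 z) \<noteq> \<phi> (f2 w)" if "z \<in> ball c R" "0 < Im z" "w \<in> ball c R" "Im w < 0" for z w
      proof -
        have "z \<in> D1" "w \<in> D2" using that by (auto simp: D1_def D2_def)
        then show ?thesis using f_ne[of z w] that D1(2) D2(3) inj_onD[OF chart_inj[OF U(1)], of "f1 z" "f2 w"] by blast
      qed
      then show ?thesis by fastforce
    qed
  qed (use z12 in auto)
  obtain r where r: "r > 0" "ball z2 r \<subseteq> ball c R \<inter> {z. Im z < 0}"
    using open_contains_ball[of "ball c R \<inter> {z. Im z < 0}"] z12 open_halfspace_Im_lt by (metis IntI mem_Collect_eq open_Int open_ball)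
  have deg2: "local_degree (\<phi> \<circ> f2) z2 = orientation t' * local_degree A z2" if mono: "inj_on h {0<..<1}"
  proof -
    have contA: "continuous_on (ball z2 r) A" by (rule A_cont) (use r(2) Re_ball in auto)
    have injA: "inj_on A (ball z2 r)"
    proof (rule inj_onI)
      fix x y assume "x \<in> ball z2 r" "y \<in> ball z2 r" "A x = A y"
      moreover from this have "Re x \<in> {0<..<1}" "Re y \<in> {0<..<1}" using r(2) Re_ball by auto
      ultimately show "x = y" using inj_onD[OF mono, of "Re x" "Re y"] by (auto simp: A_def complex_eq_iff)
    qed
    define S where "S = edge_chart k' -` chart_domain t' U"
    have S: "open S" unfolding S_def
      using chart_domain(1)[OF tk'(1) U(1)] edge_chart_continuous open_vimage by blast
    have "continuous_on S (\<phi> \<circ> \<tau> t' \<circ> edge_chart k')"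
      by (rule continuous_on_compose[OF edge_chart_continuous continuous_on_subset[OF chart_domain(2)[OF tk'(1) U(1)]]])
        (auto simp: S_def)
    moreover have "inj_on (\<phi> \<circ> \<tau> t' \<circ> edge_chart k') S"
      by (rule comp_inj_on[OF _ inj_on_subset[OF chart_domain(3)[OF tk'(1) U(1)]]])
        (auto simp: S_def inj_on_def edge_chart_inj)
    ultimately have "local_degree ((\<phi> \<circ> \<tau> t' \<circ> edge_chart k') \<circ> A) z2
        = local_degree (\<phi> \<circ> \<tau> t' \<circ> edge_chart k') (A z2) * local_degree A z2"
      using local_degree_compose[OF contA injA _ _ _ _ S] U2 r(1) by (simp add: S_def)
    moreover have "local_degree (\<phi> \<circ> \<tau> t' \<circ> edge_chart k') (A z2) = orientation t'"
      using local_degree_edge_chart[OF chart_domain(2,3,1)[OF tk'(1) U(1)] U2] orientation_eq[OF tk'(1) U(1) U2] by simp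
    ultimately show ?thesis by (simp add: f2_def comp_assoc)
  qed
  have ball: "ball (Re z2) (1/4) \<subseteq> {0<..<1}" by (auto simp: z2_def dist_real_def abs_if split: if_splits)
  note cont_h = continuous_on_subset[OF h(1) ball]
  show "orientation t = - orientation t'" if mono: "strict_mono_on {0<..<1} h"
    using glue deg2 strict_mono_on_imp_inj_on[OF mono]
      local_degree_reflected_shear(1)[OF cont_h _ monotone_on_subset[OF mono ball]]
    by (simp add: A_def[abs_def])
  show "orientation t = orientation t'" if mono: "strict_antimono_on {0<..<1} h"
  proof -
    have "inj_on h {0<..<1}"
    proof (rule inj_onI)
      fix x y :: real assume "x \<in> {0<..<1}" "y \<in> {0<..<1}" "h x = h y"
      then show "x = y" using monotone_onD[OF mono, of x y] monotone_onD[OF mono, of y x] by (cases x y rule: linorder_cases) auto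
    qed
    then show ?thesis
      using glue deg2 local_degree_reflected_shear(2)[OF cont_h _ monotone_on_subset[OF mono ball]]
      by (simp add: A_def[abs_def])
  qed
qed

text \<open>Each side runs counterclockwise in its own standard triangle, so equally oriented
  triangles are glued by reversing the parameter.\<close>

lemma gluing_order:
  assumes e: "e \<in> T" and side: "(t, k) \<in> sides e" "(t', k') \<in> sides e" "(t, k) \<noteq> (t', k')"
    and xy: "x \<in> {0<..<1}" "y \<in> {0<..<1}" "x' \<in> {0<..<1}" "y' \<in> {0<..<1}"
    and eq: "\<tau> t (edge_point k x) = \<tau> t' (edge_point k' x')" "\<tau> t (edge_point k y) = \<tau> t' (edge_point k' y')"
  shows "x < y \<longleftrightarrow> (if orientation t = orientation t' then y' < x' else x' < y')"
proof -
  note tk' = sidesD[OF side(2)]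
  obtain h where h: "continuous_on {0<..<1} h" "strict_mono_on {0<..<1} h \<or> strict_antimono_on {0<..<1} h"
    "\<And>x. x \<in> {0<..<1} \<Longrightarrow> h x \<in> {0<..<1}"
    "\<And>x. x \<in> {0<..<1} \<Longrightarrow> \<tau> t (edge_point k x) = \<tau> t' (edge_point k' (h x))"
    using gluing_map[OF e side(1,2)] by blast
  have hx: "h x = x'" if "x \<in> {0<..<1}" "x' \<in> {0<..<1}" "\<tau> t (edge_point k x) = \<tau> t' (edge_point k' x')" for x x'
  proof -
    have "\<tau> t' (edge_point k' (h x)) = \<tau> t' (edge_point k' x')" using h(4)[OF that(1)] that(3) by simp
    moreover have "edge_point k' (h x) \<in> side k'" "edge_point k' x' \<in> side k'"
      using h(3)[OF that(1)] that(2) by (auto simp: side_eq)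
    ultimately show ?thesis using inj_onD[OF map_inj_side[OF tk'(1,2)]] edge_point_inj by metis
  qed
  have x': "h x = x'" "h y = y'" using hx xy eq by auto
  have o: "orientation t' \<noteq> 0" using orientation_cases[OF tk'(1)] by auto
  from h(2) show ?thesis
  proof
    assume mono: "strict_mono_on {0<..<1} h"
    then have "orientation t \<noteq> orientation t'" using gluing_orientation(1)[OF e side h(1,3,4)] o by auto
    then show ?thesis using strict_mono_on_less[OF mono xy(1,2)] x' by simp
  next
    assume mono: "strict_antimono_on {0<..<1} h"
    then have "orientation t = orientation t'" using gluing_orientation(2)[OF e side h(1,3,4)] by auto
    moreover have "x < y \<longleftrightarrow> h y < h x"
      using monotone_onD[OF mono, of x y] monotone_onD[OF mono, of y x] xy by (cases x y rule: linorder_cases) auto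
    ultimately show ?thesis using x' by simp
  qed
qed

end

section \<open>Lifting paths through maps with finite fibres\<close>

text \<open>Compactness yields a cluster point \<open>z\<close> of the lift. The fibre of
  \<open>y\<close> is finite, so some small sphere about \<open>z\<close> misses it; close to
  \<open>a\<close> the lift cannot cross this sphere and, being connected, is trapped
  inside.\<close>

lemma lift_limit_at_right:
  fixes f :: "'b::euclidean_space \<Rightarrow> 'a::t2_space" and w :: "real \<Rightarrow> 'b"
  assumes "a < b" and w: "continuous_on {a<..<b} w" "w ` {a<..<b} \<subseteq> K"
    and K: "compact K" "continuous_on K f"
    and lim: "((\<lambda>x. f (w x)) \<longlongrightarrow> y) (at_right a)"
    and fin: "finite {z \<in> K. f z = y}"
  obtains z where "z \<in> K" "f z = y" "(w \<longlongrightarrow> z) (at_right a)"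
proof -
  \<comment> \<open>The summand 2 keeps all points strictly below \<open>b\<close>, also for
    \<open>m = 0\<close>.\<close>
  define x where "x m = a + (b - a) / (real m + 2)" for m
  have x_in: "x m \<in> {a<..<b}" for m
  proof -
    have "(b - a) / (real m + 2) < (b - a) / 1" using \<open>a < b\<close> by (intro divide_strict_left_mono) auto
    then show ?thesis using \<open>a < b\<close> by (simp add: x_def)
  qed
  have "(\<lambda>m. (b - a) / (real m + 2)) \<longlonglongrightarrow> 0"
    by (intro tendsto_divide_0[OF tendsto_const] filterlim_at_top_imp_at_infinity
        filterlim_tendsto_add_at_top[OF tendsto_const, of _ _ 2, unfolded add.commute[of 2]]
        filterlim_real_sequentially)
  then have "x \<longlonglongrightarrow> a + 0" unfolding x_def by (intro tendsto_intros)
  then have "x \<longlonglongrightarrow> a" by simp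
  then have x_lim: "filterlim x (at_right a) sequentially"
    unfolding filterlim_at
  proof (intro conjI always_eventually allI)
    fix m
    show "x m \<in> {a<..}" "x m \<noteq> a" using x_in[of m] by auto
  qed
  have "\<forall>m. w (x m) \<in> K"
  proof
    fix m show "w (x m) \<in> K" using imageI[OF x_in[of m], of w] w(2) by (rule rev_subsetD)
  qed
  then obtain z r where z: "z \<in> K" "strict_mono (r :: nat \<Rightarrow> nat)" "((\<lambda>m. w (x m)) \<circ> r) \<longlonglongrightarrow> z"
    using K(1)[unfolded compact_def, rule_format, of "\<lambda>m. w (x m)"] by blast
  have xr: "filterlim (\<lambda>m. x (r m)) (at_right a) sequentially"
    using filterlim_compose[OF x_lim filterlim_subseq[OF z(2)]] .
  have "(\<lambda>m. f (w (x (r m)))) \<longlonglongrightarrow> f z"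
  proof (rule continuous_on_tendsto_compose[OF K(2) _ z(1)])
    show "(\<lambda>m. w (x (r m))) \<longlonglongrightarrow> z" using z(3) by (simp add: o_def)
    show "\<forall>\<^sub>F m in sequentially. w (x (r m)) \<in> K" using x_in w(2) by (auto intro!: always_eventually)
  qed
  moreover have "(\<lambda>m. f (w (x (r m)))) \<longlonglongrightarrow> y" using filterlim_compose[OF lim xr] .
  ultimately have fz: "f z = y" using LIMSEQ_unique by blast
  have "(w \<longlongrightarrow> z) (at_right a)"
  proof (rule tendstoI)
    fix e :: real assume "e > 0"
    have "\<exists>d>0. \<forall>u\<in>{u \<in> K. f u = y}. u \<noteq> z \<longrightarrow> d \<le> dist z u" using finite_set_avoid[OF fin] .
    then obtain d where d: "d > 0" "\<And>u. u \<in> K \<Longrightarrow> f u = y \<Longrightarrow> u \<noteq> z \<Longrightarrow> d \<le> dist z u" by blast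
    \<comment> \<open>The radius is below the distance to the other points of the fibre, so the part
      of the sphere in \<open>K\<close> has a compact image not containing \<open>y\<close>.\<close>
    define \<delta> where "\<delta> = min e (d / 2)"
    have \<delta>: "0 < \<delta>" "\<delta> \<le> e" "\<delta> < d" using \<open>e > 0\<close> d(1) by (auto simp: \<delta>_def min_def)
    define C where "C = f ` (K \<inter> sphere z \<delta>)"
    have "compact C" unfolding C_def
      by (intro compact_continuous_image continuous_on_subset[OF K(2)] compact_Int_closed K) auto
    then have "open (- C)" by (simp add: compact_imp_closed open_Compl)
    moreover have "y \<in> - C" using d(2) \<delta> by (force simp: C_def)
    ultimately have "\<forall>\<^sub>F u in at_right a. f (w u) \<in> - C" using lim topological_tendstoD by blast
    then obtain b' where b': "b' > a" "\<And>u. a < u \<Longrightarrow> u < b' \<Longrightarrow> f (w u) \<in> - C"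
      unfolding eventually_at_right_field by blast
    define c where "c = min b b'"
    have c: "a < c" "c \<le> b" "c \<le> b'" using b'(1) \<open>a < b\<close> by (auto simp: c_def)
    have conn: "connected (w ` {a<..<c})"
      by (intro connected_continuous_image continuous_on_subset[OF w(1)]) (use c in auto)
    have avoid: "w ` {a<..<c} \<inter> sphere z \<delta> = {}"
    proof -
      have "w u \<notin> sphere z \<delta>" if "u \<in> {a<..<c}" for u
      proof
        assume "w u \<in> sphere z \<delta>"
        moreover have "w u \<in> K" using w(2) that c by auto
        ultimately have "f (w u) \<in> C" by (auto simp: C_def)
        then show False using b'(2)[of u] that c by auto
      qed
      then show ?thesis by blast
    qed
    have "\<forall>\<^sub>F m in sequentially. x (r m) \<in> {a<..<c}"
    proof -
      have "\<forall>\<^sub>F u in at_right a. u \<in> {a<..<c}"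
        unfolding eventually_at_right_field using c(1) by (intro exI[of _ c]) auto
      then show ?thesis using xr unfolding filterlim_iff by blast
    qed
    moreover have "\<forall>\<^sub>F m in sequentially. dist (w (x (r m))) z < \<delta>"
      using tendstoD[OF z(3) \<delta>(1)] by (simp add: o_def)
    ultimately have "\<forall>\<^sub>F m in sequentially. x (r m) \<in> {a<..<c} \<and> dist (w (x (r m))) z < \<delta>"
      by (rule eventually_conj)
    from eventually_happens'[OF sequentially_bot this]
    obtain m where m: "x (r m) \<in> {a<..<c}" "dist (w (x (r m))) z < \<delta>" by blast
    have "w ` {a<..<c} \<subseteq> ball z \<delta>"
    proof (rule ccontr)
      assume "\<not> w ` {a<..<c} \<subseteq> ball z \<delta>"
      then have "w ` {a<..<c} - ball z \<delta> \<noteq> {}" by (metis Diff_eq_empty_iff)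
      moreover have "w (x (r m)) \<in> ball z \<delta>" using m(2) by (simp add: dist_commute)
      with imageI[OF m(1), of w] have "w ` {a<..<c} \<inter> ball z \<delta> \<noteq> {}" by (metis IntI emptyE)
      ultimately have "w ` {a<..<c} \<inter> frontier (ball z \<delta>) \<noteq> {}"
        by (intro connected_Int_frontier[OF conn])
      then show False using avoid \<delta>(1) by simp
    qed
    then have "dist (w u) z < e" if "u \<in> {a<..<c}" for u
    proof -
      have "w u \<in> ball z \<delta>" using imageI[OF that, of w] \<open>w ` {a<..<c} \<subseteq> ball z \<delta>\<close> by (rule rev_subsetD)
      then show ?thesis using \<delta>(2) by (simp add: dist_commute)
    qed
    then show "\<forall>\<^sub>F u in at_right a. dist (w u) z < e"
      unfolding eventually_at_right_field using c(1) by (intro exI[of _ c]) auto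
  qed
  then show thesis using that z(1) fz by blast
qed

lemma lift_extension:
  fixes f :: "'b::euclidean_space \<Rightarrow> 'a::t2_space" and w :: "real \<Rightarrow> 'b"
  assumes "a < b" and w: "continuous_on {a<..<b} w" "w ` {a<..<b} \<subseteq> K"
    and K: "compact K" "continuous_on K f"
    and c: "continuous_on {a..b} c" "\<And>x. x \<in> {a<..<b} \<Longrightarrow> f (w x) = c x"
    and fin: "finite {z \<in> K. f z = c a}" "finite {z \<in> K. f z = c b}"
  obtains W where "continuous_on {a..b} W" "W ` {a..b} \<subseteq> K" "\<And>x. x \<in> {a<..<b} \<Longrightarrow> W x = w x"
    "\<And>x. x \<in> {a..b} \<Longrightarrow> f (W x) = c x"
proof -
  have ev_a: "\<forall>\<^sub>F x in at_right a. c x = f (w x)"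
    unfolding eventually_at_right_field using \<open>a < b\<close> c(2) by (intro exI[of _ b]) auto
  have ev_b: "\<forall>\<^sub>F x in at_left b. c x = f (w x)"
    unfolding eventually_at_left_field using \<open>a < b\<close> c(2) by (intro exI[of _ a]) auto
  have "(c \<longlongrightarrow> c a) (at_right a)"
    using c(1) \<open>a < b\<close> by (auto simp: continuous_on_Icc_at_rightD)
  then have "((\<lambda>x. f (w x)) \<longlongrightarrow> c a) (at_right a)" using ev_a by (rule Lim_transform_eventually)
  then obtain za where za: "za \<in> K" "f za = c a" "(w \<longlongrightarrow> za) (at_right a)"
    using lift_limit_at_right[OF \<open>a < b\<close> w K _ fin(1)] by blast
  have "(c \<longlongrightarrow> c b) (at_left b)"
    using c(1) \<open>a < b\<close> by (auto simp: continuous_on_Icc_at_leftD)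
  then have "((\<lambda>x. f (w x)) \<longlongrightarrow> c b) (at_left b)" using ev_b by (rule Lim_transform_eventually)
  \<comment> \<open>The left-hand limit at \<open>b\<close> becomes a right-hand limit at
    \<open>- b\<close> after reversing time.\<close>
  then have lim: "((\<lambda>x. f ((\<lambda>x. w (- x)) x)) \<longlongrightarrow> c b) (at_right (- b))"
    by (simp add: filterlim_at_left_to_right)
  have "continuous_on {- b<..<- a} (\<lambda>x. w (- x))"
    by (intro continuous_on_compose2[OF w(1)] continuous_intros) auto
  moreover have "(\<lambda>x. w (- x)) ` {- b<..<- a} \<subseteq> K" using w(2) by auto
  ultimately obtain zb where zb: "zb \<in> K" "f zb = c b" "((\<lambda>x. w (- x)) \<longlongrightarrow> zb) (at_right (- b))"
    using lift_limit_at_right[of "- b" "- a", OF _ _ _ K lim fin(2)] \<open>a < b\<close> by auto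
  then have zb': "(w \<longlongrightarrow> zb) (at_left b)" by (simp add: filterlim_at_left_to_right)
  define W where "W x = (if x = a then za else if x = b then zb else w x)" for x
  have W: "W x = w x" if "x \<in> {a<..<b}" for x using that by (auto simp: W_def)
  have Wa: "W a = za" and Wb: "W b = zb" using \<open>a < b\<close> by (auto simp: W_def)
  have ev_Wa: "\<forall>\<^sub>F x in at_right a. w x = W x"
    unfolding eventually_at_right_field using \<open>a < b\<close> W by (intro exI[of _ b]) auto
  have ev_Wb: "\<forall>\<^sub>F x in at_left b. w x = W x"
    unfolding eventually_at_left_field using \<open>a < b\<close> W by (intro exI[of _ a]) auto
  have cont_W: "continuous_on {a..b} W"
    unfolding continuous_on_def
  proof
    fix x assume "x \<in> {a..b}"
    then consider "x = a" | "x = b" | "x \<in> {a<..<b}" by fastforce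
    then show "(W \<longlongrightarrow> W x) (at x within {a..b})"
    proof cases
      case 1
      then show ?thesis using Lim_transform_eventually[OF za(3) ev_Wa] \<open>a < b\<close> Wa
        by (simp add: at_within_Icc_at_right)
    next
      case 2
      then show ?thesis using Lim_transform_eventually[OF zb' ev_Wb] \<open>a < b\<close> Wb
        by (simp add: at_within_Icc_at_left)
    next
      case 3
      have "continuous_on {a<..<b} W" using w(1) by (rule continuous_on_eq) (simp add: W)
      then have "(W \<longlongrightarrow> W x) (at x)" using 3 by (simp add: continuous_on_eq_continuous_at isCont_def)
      then show ?thesis by (rule tendsto_within_subset) simp
    qed
  qed
  show thesis
  proof (rule that)
    show "continuous_on {a..b} W" by (rule cont_W)
    have ab: "x = a \<or> x = b \<or> x \<in> {a<..<b}" if "x \<in> {a..b}" for x using that by auto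
    show "W ` {a..b} \<subseteq> K" using ab W Wa Wb za zb w(2) by blast
    show "f (W x) = c x" if "x \<in> {a..b}" for x using ab[OF that] W Wa Wb za zb c(2) by auto
  qed (rule W)
qed

section \<open>The closed walk of a divided curve\<close>

locale divided_curve = triangulated_surface +
  fixes \<gamma> :: "real \<Rightarrow> 'a"
  assumes loop: "simple_loop (M - P) \<gamma>"
    and divided: "divided_into_segments M P T rep \<tau> \<gamma>"
    and distinct_ends: "\<sigma> \<in> loop_segments T rep \<gamma> \<Longrightarrow> connects_distinct_arcs T rep \<sigma>"
begin

text \<open>The periodic extension of the curve to the real line, so that crossings and segments can
  be numbered by all integers in the order of travel.\<close>

definition \<Gamma> :: "real \<Rightarrow> 'a" where "\<Gamma> x = \<gamma> (frac x)"

lemma \<Gamma>_add_int: "\<Gamma> (x + of_int m) = \<Gamma> x"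
  by (simp add: \<Gamma>_def)

lemma \<gamma>_ends: "\<gamma> 1 = \<gamma> 0"
  using loop by (simp add: simple_loop_def pathfinish_def pathstart_def)

lemma \<Gamma>_eq: "\<Gamma> x = \<Gamma> y \<longleftrightarrow> (\<exists>m. y = x + of_int m)"
proof
  assume "\<Gamma> x = \<Gamma> y"
  moreover have "0 \<le> frac x" "frac x < 1" "0 \<le> frac y" "frac y < 1" by (auto simp: frac_lt_1)
  ultimately have "frac x = frac y"
    using loop unfolding simple_loop_def simple_path_def loop_free_def \<Gamma>_def
    by (metis atLeastAtMost_iff less_eq_real_def less_irrefl)
  then have "y = x + of_int (\<lfloor>y\<rfloor> - \<lfloor>x\<rfloor>)" by (simp add: frac_def)
  then show "\<exists>m. y = x + of_int m" by blast
qed (auto simp: \<Gamma>_add_int)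

lemma \<Gamma>_path_image: "range \<Gamma> = path_image \<gamma>"
proof
  show "range \<Gamma> \<subseteq> path_image \<gamma>"
  proof
    fix y assume "y \<in> range \<Gamma>"
    then obtain x where "y = \<gamma> (frac x)" by (auto simp: \<Gamma>_def)
    moreover have "frac x \<in> {0..1}" using less_imp_le[OF frac_lt_1] by simp
    ultimately show "y \<in> path_image \<gamma>" by (auto simp: path_image_def)
  qed
  show "path_image \<gamma> \<subseteq> range \<Gamma>"
  proof
    fix y assume "y \<in> path_image \<gamma>"
    then obtain x where x: "x \<in> {0..1}" "y = \<gamma> x" by (auto simp: path_image_def)
    show "y \<in> range \<Gamma>"
    proof (cases "x = 1")
      case True then have "y = \<Gamma> 0" using x \<gamma>_ends by (simp add: \<Gamma>_def)
      then show ?thesis by blast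
    next
      case False then have "frac x = x" using x by (simp add: frac_eq)
      then have "y = \<Gamma> x" using x by (simp add: \<Gamma>_def)
      then show ?thesis by blast
    qed
  qed
qed

lemma \<Gamma>_continuous: "continuous_on S \<Gamma>"
proof -
  have \<gamma>: "continuous_on {0..1} \<gamma>"
    using loop by (simp add: simple_loop_def simple_path_def path_def)
  have unit: "continuous_on {of_int m..of_int m + 1} \<Gamma>" for m :: int
  proof (rule continuous_on_eq)
    show "continuous_on {of_int m..of_int m + 1} (\<lambda>x. \<gamma> (x - of_int m))"
      by (intro continuous_on_compose2[OF \<gamma>] continuous_intros) auto
    fix x :: real assume x: "x \<in> {of_int m..of_int m + 1}"
    show "\<gamma> (x - of_int m) = \<Gamma> x"
    proof (cases "x = of_int m + 1")
      case True
      then have "x = of_int (m + 1)" by simp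
      then have "frac x = 0" by (metis frac_of_int)
      with True show ?thesis using \<gamma>_ends by (simp add: \<Gamma>_def)
    next
      case False
      then have "\<lfloor>x\<rfloor> = m" using x by (intro floor_unique) auto
      then show ?thesis by (simp add: \<Gamma>_def frac_def)
    qed
  qed
  have "isCont \<Gamma> x" for x
  proof -
    define m where "m = \<lfloor>x\<rfloor>"
    have "{of_int (m - 1)..of_int m + 1} = {of_int (m - 1)..of_int (m - 1) + 1} \<union> {of_int m..of_int m + 1 :: real}"
      by auto
    then have "continuous_on {of_int (m - 1)..of_int m + 1} \<Gamma>"
      using continuous_on_closed_Un[OF _ _ unit[of "m - 1"] unit[of m]] by simp
    moreover have "x \<in> interior {of_int (m - 1)..of_int m + 1}"
      unfolding interior_atLeastAtMost_real by (auto simp: m_def) linarith+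
    ultimately show ?thesis by (rule continuous_on_interior)
  qed
  then show ?thesis by (simp add: continuous_at_imp_continuous_on)
qed

lemma \<Gamma>_surface: "\<Gamma> x \<in> M - P"
  using loop \<Gamma>_path_image unfolding simple_loop_def by blast

definition crossing_times :: "real set" where
  "crossing_times = {x \<in> {0..<1}. \<Gamma> x \<in> arcs_union T rep}"

lemma finite_crossing_times: "finite crossing_times"
proof (rule finite_imageD)
  have "\<Gamma> ` crossing_times \<subseteq> path_image \<gamma> \<inter> arcs_union T rep"
    unfolding \<Gamma>_path_image[symmetric] by (auto simp: crossing_times_def)
  then show "finite (\<Gamma> ` crossing_times)"
    by (rule finite_subset) (use divided in \<open>simp add: divided_into_segments_def\<close>)
  show "inj_on \<Gamma> crossing_times"
  proof (rule inj_onI)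
    fix x y assume "x \<in> crossing_times" "y \<in> crossing_times" "\<Gamma> x = \<Gamma> y"
    then obtain m where "y = x + of_int m" "x \<in> {0..<1}" "y \<in> {0..<1}"
      using \<Gamma>_eq by (auto simp: crossing_times_def)
    moreover from this have "m = 0" by auto
    ultimately show "x = y" by simp
  qed
qed

text \<open>A curve that misses all arcs would be a single loop segment. Being compact, it would
  have no end points, although every segment connects two arcs.\<close>

lemma crossing_times_nonempty: "crossing_times \<noteq> {}"
proof
  assume empty: "crossing_times = {}"
  have "\<Gamma> x \<notin> arcs_union T rep" for x
  proof
    assume *: "\<Gamma> x \<in> arcs_union T rep"
    have "\<Gamma> (frac x) = \<Gamma> x" by (simp add: \<Gamma>_def)
    then have "frac x \<in> crossing_times" using * by (simp add: crossing_times_def frac_lt_1)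
    then show False using empty by simp
  qed
  then have "path_image \<gamma> - arcs_union T rep = path_image \<gamma>" unfolding \<Gamma>_path_image[symmetric] by blast
  moreover have "path \<gamma>" using loop by (simp add: simple_loop_def simple_path_def)
  ultimately have "path_image \<gamma> \<in> loop_segments T rep \<gamma>"
    unfolding loop_segments_def by (intro clopen_connected_component) (auto simp: connected_path_image)
  then have "closure (path_image \<gamma>) - path_image \<gamma> \<noteq> {}"
    using distinct_ends unfolding connects_distinct_arcs_def by blast
  then show False
    using compact_path_image[OF \<open>path \<gamma>\<close>] by (simp add: compact_imp_closed)
qed

definition n :: int where "n = int (card crossing_times)"

text \<open>All crossing times of the periodic extension in increasing order: \<open>i mod n\<close>
  selects the crossing within a round, and \<open>i div n\<close> is the number of the
  round.\<close>

definition p :: "int \<Rightarrow> real" where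
  "p i = sorted_list_of_set crossing_times ! nat (i mod n) + of_int (i div n)"

lemma n_pos: "n > 0"
  using finite_crossing_times crossing_times_nonempty by (simp add: n_def card_gt_0_iff)

lemma p_index:
  assumes "0 \<le> r" "r < n"
  shows "sorted_list_of_set crossing_times ! nat r \<in> crossing_times"
proof -
  have "nat r < length (sorted_list_of_set crossing_times)" using assms by (simp add: n_def)
  then show ?thesis using nth_mem set_sorted_list_of_set[OF finite_crossing_times] by metis
qed

lemma p_add: "p (i + m * n) = p i + of_int m"
  using n_pos by (simp add: p_def)

lemma p_Suc: "p i < p (i + 1)"
proof -
  define r where "r = i mod n"
  have r: "0 \<le> r" "r < n" "i = r + (i div n) * n" using n_pos by (auto simp: r_def)
  define l where "l = sorted_list_of_set crossing_times"
  have pr: "p s = l ! nat s" if "0 \<le> s" "s < n" for s using that by (simp add: p_def l_def)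
  have "p r < p (r + 1)"
  proof (cases "r + 1 < n")
    case True
    have "l ! nat r < l ! nat (r + 1)"
      using strict_sorted_list_of_set[of crossing_times] r True
      unfolding l_def by (intro sorted_wrt_nth_less[of "(<)"]) (auto simp: n_def)
    then show ?thesis using pr[of r] pr[of "r + 1"] r True by simp
  next
    case False
    then have "r + 1 = 0 + 1 * n" using r by simp
    then have "p (r + 1) = p 0 + 1" using p_add[of 0 1] by simp
    moreover have "p 0 \<in> crossing_times" "p r \<in> crossing_times"
      using p_index[of 0] p_index[of r] pr[of 0] pr[of r] n_pos r by (auto simp: l_def)
    ultimately show ?thesis by (auto simp: crossing_times_def)
  qed
  then show ?thesis
    using p_add[of r "i div n"] p_add[of "r + 1" "i div n"] r(3) by (simp add: algebra_simps)
qed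

lemma p_mono: "p i < p k \<longleftrightarrow> i < k"
proof -
  have less: "p i < p k" if "i < k" for i k
    using that
  proof (induction k rule: int_gr_induct)
    case base show ?case by (rule p_Suc)
  next
    case (step k) then show ?case using p_Suc[of k] by simp
  qed
  show ?thesis using less[of i k] less[of k i] by (cases i k rule: linorder_cases) auto
qed

lemma \<Gamma>_p: "\<Gamma> (p i) \<in> arcs_union T rep"
proof -
  have "sorted_list_of_set crossing_times ! nat (i mod n) \<in> crossing_times"
    by (rule p_index) (use n_pos in auto)
  then show ?thesis by (simp add: p_def \<Gamma>_add_int crossing_times_def)
qed

lemma crossing_p:
  assumes "\<Gamma> x \<in> arcs_union T rep"
  obtains i where "x = p i"
proof -
  have "\<Gamma> (frac x) = \<Gamma> x" by (simp add: \<Gamma>_def)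
  then have "frac x \<in> crossing_times" using assms by (simp add: crossing_times_def frac_lt_1)
  then obtain r where r: "r < card crossing_times" "sorted_list_of_set crossing_times ! r = frac x"
    using set_sorted_list_of_set[OF finite_crossing_times]
    by (metis in_set_conv_nth length_sorted_list_of_set)
  have "x = p (int r + \<lfloor>x\<rfloor> * n)" using r by (simp add: p_add) (simp add: p_def n_def frac_def)
  then show thesis by (rule that)
qed

lemma p_cover:
  obtains i where "p i \<le> x" "x < p (i + 1)"
proof -
  have p0: "0 \<le> p 0" "p 0 < 1"
    using p_index[of 0] n_pos by (auto simp: p_def crossing_times_def)
  define lo where "lo = 0 + (\<lfloor>x\<rfloor> - 1) * n"
  define hi where "hi = 0 + (\<lfloor>x\<rfloor> + 1) * n"
  have "p lo \<le> x" unfolding lo_def p_add using p0 by linarith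
  have "x < p hi" unfolding hi_def p_add using p0 by linarith
  define I where "I = {i \<in> {lo..hi}. p i \<le> x}"
  have "finite I" by (rule finite_subset[of _ "{lo..hi}"]) (auto simp: I_def)
  moreover have "lo \<in> I" using \<open>p lo \<le> x\<close> \<open>x < p hi\<close> p_mono[of lo hi] by (auto simp: I_def)
  ultimately have I: "finite I" "lo \<in> I" .
  have m: "Max I \<in> I" using I by (intro Max_in) auto
  have "x < p (Max I + 1)"
  proof (rule ccontr)
    assume *: "\<not> x < p (Max I + 1)"
    then have "p (Max I + 1) < p hi" using \<open>x < p hi\<close> by linarith
    then have "Max I + 1 \<in> I" using m * by (auto simp: I_def p_mono)
    then show False using Max_ge[OF I(1), of "Max I + 1"] by simp
  qed
  then show thesis using m that by (auto simp: I_def)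
qed

definition \<sigma> :: "int \<Rightarrow> 'a set" where "\<sigma> i = \<Gamma> ` {p i<..<p (i + 1)}"

lemma \<sigma>_subset: "\<sigma> i \<subseteq> path_image \<gamma> - arcs_union T rep"
proof
  fix y assume "y \<in> \<sigma> i"
  then obtain x where x: "p i < x" "x < p (i + 1)" "y = \<Gamma> x" by (auto simp: \<sigma>_def)
  have "\<Gamma> x \<notin> arcs_union T rep"
  proof
    assume "\<Gamma> x \<in> arcs_union T rep"
    then obtain k where "x = p k" by (rule crossing_p)
    then show False using x by (simp add: p_mono)
  qed
  then show "y \<in> path_image \<gamma> - arcs_union T rep" using x \<Gamma>_path_image by auto
qed

lemma \<sigma>_connected: "connected (\<sigma> i)"
  unfolding \<sigma>_def by (intro connected_continuous_image \<Gamma>_continuous) simp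

lemma \<sigma>_nonempty: "\<sigma> i \<noteq> {}"
  using p_Suc[of i] by (auto simp: \<sigma>_def)

lemma \<sigma>_cover: "path_image \<gamma> - arcs_union T rep \<subseteq> (\<Union>i. \<sigma> i)"
proof
  fix y assume y: "y \<in> path_image \<gamma> - arcs_union T rep"
  then obtain x where x: "y = \<Gamma> x" using \<Gamma>_path_image by blast
  obtain i where i: "p i \<le> x" "x < p (i + 1)" by (rule p_cover)
  have "x \<noteq> p i" using y x \<Gamma>_p by auto
  then have "y \<in> \<sigma> i" unfolding x \<sigma>_def using i by (intro imageI) auto
  then show "y \<in> (\<Union>i. \<sigma> i)" by blast
qed

lemma p_shift: "p i + of_int m = p (i + m * n)"
  by (simp add: p_add)

lemma \<Gamma>_p_eq: "\<Gamma> (p i) = \<Gamma> (p k) \<longleftrightarrow> i mod n = k mod n"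
proof
  assume "\<Gamma> (p i) = \<Gamma> (p k)"
  then obtain m where "p k = p i + of_int m" using \<Gamma>_eq by blast
  then have "p k = p (i + m * n)" by (simp add: p_shift)
  then have "k = i + m * n" using p_mono by (metis linorder_neqE less_irrefl)
  then show "i mod n = k mod n" by simp
next
  assume "i mod n = k mod n"
  then obtain m where "k = i + m * n" by (metis mod_eqE mult.commute)
  then show "\<Gamma> (p i) = \<Gamma> (p k)" by (simp add: p_add \<Gamma>_add_int)
qed

lemma \<sigma>_periodic: "\<sigma> (i + m * n) = \<sigma> i"
proof -
  have "{p (i + m * n)<..<p (i + m * n + 1)} = (\<lambda>x. x + of_int m) ` {p i<..<p (i + 1)}"
  proof
    show "{p (i + m * n)<..<p (i + m * n + 1)} \<subseteq> (\<lambda>x. x + of_int m) ` {p i<..<p (i + 1)}"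
    proof
      fix x assume "x \<in> {p (i + m * n)<..<p (i + m * n + 1)}"
      then show "x \<in> (\<lambda>x. x + of_int m) ` {p i<..<p (i + 1)}"
        using p_add[of "i + 1" m] p_add[of i m]
        by (intro image_eqI[of _ _ "x - of_int m"]) (auto simp: algebra_simps)
    qed
  qed (use p_add[of "i + 1" m] p_add[of i m] in \<open>auto simp: algebra_simps\<close>)
  then show ?thesis by (simp add: \<sigma>_def image_image \<Gamma>_add_int)
qed

lemma \<sigma>_disjoint: "\<sigma> i \<inter> \<sigma> k \<noteq> {} \<Longrightarrow> i mod n = k mod n"
proof -
  assume "\<sigma> i \<inter> \<sigma> k \<noteq> {}"
  then obtain x y where xy: "x \<in> {p i<..<p (i + 1)}" "y \<in> {p k<..<p (k + 1)}" "\<Gamma> x = \<Gamma> y"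
    unfolding \<sigma>_def by blast
  then obtain m where "y = x + of_int m" using \<Gamma>_eq by blast
  then have y: "p (i + m * n) < y" "y < p (i + m * n + 1)"
    using xy(1) p_add[of "i + 1" m] by (auto simp: p_add algebra_simps)
  have "p (i + m * n) < p (k + 1)" "p k < p (i + m * n + 1)" using y xy(2) by auto
  then have "k = i + m * n" unfolding p_mono by linarith
  then show ?thesis by simp
qed

lemma \<sigma>_eq: "\<sigma> i = \<sigma> k \<longleftrightarrow> i mod n = k mod n"
proof
  show "i mod n = k mod n" if "\<sigma> i = \<sigma> k" using \<sigma>_disjoint[of i k] \<sigma>_nonempty that by auto
  assume "i mod n = k mod n"
  then obtain m where "k = i + m * n" by (metis mod_eqE mult.commute)
  then show "\<sigma> i = \<sigma> k" by (simp add: \<sigma>_periodic)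
qed

lemma closed_\<Gamma>: "closed (\<Gamma> ` {x..y})"
  by (intro compact_imp_closed compact_continuous_image \<Gamma>_continuous) simp

text \<open>The segment is relatively closed since the image of \<open>{p i..p (i + 1)}\<close> adds
  only points on arcs, and relatively open since the rest of the curve off the arcs lies in the
  compact image of \<open>{p (i + 1)..p i + 1}\<close>.\<close>

lemma \<sigma>_component: "\<sigma> i \<in> loop_segments T rep \<gamma>"
  unfolding loop_segments_def
proof (rule clopen_connected_component[OF _ _ \<sigma>_connected \<sigma>_nonempty])
  let ?X = "path_image \<gamma> - arcs_union T rep"
  have split: "y \<in> \<sigma> i \<or> (\<exists>x\<in>{p (i + 1)..p i + 1}. y = \<Gamma> x)" if y: "y \<in> range \<Gamma>" "y \<notin> arcs_union T rep" for y
  proof -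
    obtain x where x: "y = \<Gamma> x" using y(1) by (rule rangeE)
    define x' where "x' = x + of_int (- \<lfloor>x - p i\<rfloor>)"
    have "\<Gamma> x' = y" unfolding x'_def \<Gamma>_add_int by (simp add: x)
    have x': "p i \<le> x'" "x' < p i + 1" unfolding x'_def by linarith+
    have "x' \<noteq> p i" using y(2) \<Gamma>_p \<open>\<Gamma> x' = y\<close> by auto
    then show ?thesis
      using x' \<open>\<Gamma> x' = y\<close> by (cases "x' < p (i + 1)") (auto simp: \<sigma>_def intro!: image_eqI[of _ _ x'] bexI[of _ x'])
  qed
  have disj: "\<Gamma> x \<notin> \<sigma> i" if "x \<in> {p (i + 1)..p i + 1}" for x
  proof
    assume "\<Gamma> x \<in> \<sigma> i"
    then obtain y where y: "p i < y" "y < p (i + 1)" "\<Gamma> x = \<Gamma> y" by (auto simp: \<sigma>_def)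
    then obtain m where "y = x + of_int m" using \<Gamma>_eq by blast
    then have "real_of_int m < real_of_int 0" "real_of_int (-1) < real_of_int m" using y that by auto
    then show False unfolding of_int_less_iff by linarith
  qed
  have "\<sigma> i = ?X \<inter> - (\<Gamma> ` {p (i + 1)..p i + 1})"
    using split \<sigma>_subset[of i] disj \<Gamma>_path_image by blast
  then show "openin (top_of_set ?X) (\<sigma> i)"
    using closed_\<Gamma> openin_open_Int open_Compl by metis
  have "\<Gamma> ` {p i..p (i + 1)} \<inter> ?X = \<sigma> i"
  proof -
    have "{p i..p (i + 1)} = {p i<..<p (i + 1)} \<union> {p i, p (i + 1)}" using p_Suc[of i] by auto
    then show ?thesis using \<sigma>_subset[of i] \<Gamma>_p unfolding \<sigma>_def by auto
  qed
  then show "closedin (top_of_set ?X) (\<sigma> i)"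
    using closed_\<Gamma> closedin_closed_Int Int_commute by metis
qed

lemma loop_segments_eq: "loop_segments T rep \<gamma> = range \<sigma>"
proof
  show "range \<sigma> \<subseteq> loop_segments T rep \<gamma>" using \<sigma>_component by blast
  show "loop_segments T rep \<gamma> \<subseteq> range \<sigma>"
  proof
    fix C assume C: "C \<in> loop_segments T rep \<gamma>"
    then obtain y where y: "y \<in> C" unfolding loop_segments_def using in_components_nonempty by blast
    then have "y \<in> path_image \<gamma> - arcs_union T rep"
      using C in_components_subset unfolding loop_segments_def by blast
    then obtain i where "y \<in> \<sigma> i" using \<sigma>_cover by blast
    then have "C = \<sigma> i"
      using y C \<sigma>_component[of i] components_nonoverlap unfolding loop_segments_def by blast
    then show "C \<in> range \<sigma>" by blast
  qed
qed

section \<open>Arcs and triangles visited by the curve\<close>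

lemma arc_at_exists: "\<exists>e\<in>T. \<Gamma> (p i) \<in> arc_interior (rep e)"
  using \<Gamma>_p[of i] by (auto simp: arcs_union_def)

definition arc_at :: "int \<Rightarrow> (real \<Rightarrow> 'a) set" where
  "arc_at i = (SOME e. e \<in> T \<and> \<Gamma> (p i) \<in> arc_interior (rep e))"

lemma arc_at: "arc_at i \<in> T" "\<Gamma> (p i) \<in> arc_interior (rep (arc_at i))"
  using someI_ex[of "\<lambda>e. e \<in> T \<and> \<Gamma> (p i) \<in> arc_interior (rep e)"] arc_at_exists[of i]
  unfolding arc_at_def by blast+

lemma arc_at_eq: "e \<in> T \<Longrightarrow> \<Gamma> (p i) \<in> arc_interior (rep e) \<Longrightarrow> e = arc_at i"
  using rep_disjoint[of e "arc_at i"] arc_at[of i] by blast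

text \<open>The only possible end points of the segment are the junctures \<open>i\<close> and
  \<open>i + 1\<close>, and it connects two distinct arcs. This is what makes the walk
  reduced.\<close>

lemma arc_at_distinct: "arc_at i \<noteq> arc_at (i + 1)"
proof -
  have "closure (\<sigma> i) \<subseteq> \<Gamma> ` {p i..p (i + 1)}"
    by (rule closure_minimal[OF _ closed_\<Gamma>]) (auto simp: \<sigma>_def)
  moreover have "{p i..p (i + 1)} \<subseteq> {p i<..<p (i + 1)} \<union> {p i, p (i + 1)}" by auto
  ultimately have sub: "closure (\<sigma> i) - \<sigma> i \<subseteq> {\<Gamma> (p i), \<Gamma> (p (i + 1))}"
    unfolding \<sigma>_def by blast
  obtain e e' j j' where e: "e \<in> T" "e' \<in> T" "e \<noteq> e'" "j \<in> arc_interior (rep e)" "j' \<in> arc_interior (rep e')"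
    "closure (\<sigma> i) - \<sigma> i = {j, j'}"
    using distinct_ends[OF \<sigma>_component[of i]] unfolding connects_distinct_arcs_def by blast
  have "j \<noteq> j'" using e rep_disjoint[of e e'] by blast
  then have "j = \<Gamma> (p i) \<and> j' = \<Gamma> (p (i + 1)) \<or> j' = \<Gamma> (p i) \<and> j = \<Gamma> (p (i + 1))"
    using sub e(6) by blast
  then show ?thesis using arc_at_eq e by metis
qed

lemma triangle_at_exists: "\<exists>t\<in>triangles. \<sigma> i \<subseteq> t"
proof -
  have "\<sigma> i \<subseteq> M - P - arcs_union T rep"
    using \<sigma>_subset[of i] loop unfolding simple_loop_def by blast
  moreover from this have "M - P - arcs_union T rep \<noteq> {}" using \<sigma>_nonempty[of i] by (metis subset_empty)
  ultimately have "\<exists>C. C \<in> components (M - P - arcs_union T rep) \<and> \<sigma> i \<subseteq> C"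
    by (rule exists_component_superset[OF _ _ \<sigma>_connected])
  then show ?thesis unfolding ideal_triangles_def Bex_def .
qed

definition triangle_at :: "int \<Rightarrow> 'a set" where
  "triangle_at i = (SOME t. t \<in> triangles \<and> \<sigma> i \<subseteq> t)"

lemma triangle_at: "triangle_at i \<in> triangles" "\<sigma> i \<subseteq> triangle_at i"
  using someI_ex[of "\<lambda>t. t \<in> triangles \<and> \<sigma> i \<subseteq> t"] triangle_at_exists[of i]
  unfolding triangle_at_def by blast+

lemma triangle_at_eq: "t \<in> triangles \<Longrightarrow> \<sigma> i \<subseteq> t \<Longrightarrow> t = triangle_at i"
  using triangle_disjoint[of t "triangle_at i"] triangle_at[of i] \<sigma>_nonempty[of i] by blast

lemma arc_at_periodic: "i mod n = k mod n \<Longrightarrow> arc_at i = arc_at k"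
  using arc_at[of i] \<Gamma>_p_eq[of i k] arc_at_eq[of "arc_at i" k] by simp

lemma triangle_at_periodic: "i mod n = k mod n \<Longrightarrow> triangle_at i = triangle_at k"
  using triangle_at[of i] \<sigma>_eq[of i k] triangle_at_eq[of "triangle_at i" k] by simp

text \<open>Over a point of an arc there are neither interior points, which map into a triangle, nor
  corners, which map to punctures; each of the three sides contributes at most one point.\<close>

lemma fiber_finite:
  assumes t: "t \<in> triangles" and y: "y \<in> arcs_union T rep"
  shows "finite {z \<in> standard_triangle. \<tau> t z = y}"
    and "z \<in> standard_triangle \<Longrightarrow> \<tau> t z = y \<Longrightarrow> \<exists>k<3. z \<in> side k"
proof -
  have sides: "\<exists>k<3. z \<in> side k" if "z \<in> standard_triangle" "\<tau> t z = y" for z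
    using that(1)
  proof (cases rule: standard_triangle_cases)
    case 1
    then show ?thesis using map_interior_in[OF t 1] triangle_subset[OF t] that y by blast
  next
    case (2 k)
    then have "y \<in> P" using map_corner[OF t] that by auto
    then show ?thesis using y rep_subset unfolding arcs_union_def by blast
  qed blast
  then show "z \<in> standard_triangle \<Longrightarrow> \<tau> t z = y \<Longrightarrow> \<exists>k<3. z \<in> side k" .
  have "finite {z \<in> side k. \<tau> t z = y}" if "k < 3" for k
  proof -
    have "inj_on (\<tau> t) {z \<in> side k. \<tau> t z = y}" using map_inj_side[OF t that] by (rule inj_on_subset) auto
    moreover have "\<tau> t ` {z \<in> side k. \<tau> t z = y} \<subseteq> {y}" by auto
    ultimately show ?thesis by (meson finite.emptyI finite.insertI inj_on_finite)
  qed
  then have "finite (\<Union>k<3. {z \<in> side k. \<tau> t z = y})" by auto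
  moreover have "{z \<in> standard_triangle. \<tau> t z = y} \<subseteq> (\<Union>k<3. {z \<in> side k. \<tau> t z = y})"
    using sides by auto
  ultimately show "finite {z \<in> standard_triangle. \<tau> t z = y}" by (rule rev_finite_subset)
qed

text \<open>Inside the triangle the inverse homeomorphism lifts the segment. It need not extend
  continuously to the arcs, since a point of a self-folded arc has two preimages, but finite fibres
  determine the limits along the segment.\<close>

lemma lifted_segment_exists:
  "\<exists>W. continuous_on {p i..p (i + 1)} W \<and> W ` {p i..p (i + 1)} \<subseteq> standard_triangle \<and>
     (\<forall>x\<in>{p i<..<p (i + 1)}. W x \<in> interior standard_triangle) \<and>
     (\<forall>x\<in>{p i..p (i + 1)}. \<tau> (triangle_at i) (W x) = \<Gamma> x)"
proof -
  note t = triangle_at[of i]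
  obtain g where g: "homeomorphism (interior standard_triangle) (triangle_at i) (\<tau> (triangle_at i)) g"
    using map_interior[OF t(1)] by blast
  have \<Gamma>_t: "\<Gamma> x \<in> triangle_at i" if "x \<in> {p i<..<p (i + 1)}" for x
    using t(2) that by (auto simp: \<sigma>_def)
  have g_in: "g (\<Gamma> x) \<in> interior standard_triangle" if "x \<in> {p i<..<p (i + 1)}" for x
    using homeomorphism_image2[OF g] \<Gamma>_t[OF that] by blast
  obtain W where W: "continuous_on {p i..p (i + 1)} W" "W ` {p i..p (i + 1)} \<subseteq> standard_triangle"
    "\<And>x. x \<in> {p i<..<p (i + 1)} \<Longrightarrow> W x = g (\<Gamma> x)"
    "\<And>x. x \<in> {p i..p (i + 1)} \<Longrightarrow> \<tau> (triangle_at i) (W x) = \<Gamma> x"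
  proof (rule lift_extension[of "p i" "p (i + 1)" "\<lambda>x. g (\<Gamma> x)" standard_triangle "\<tau> (triangle_at i)" \<Gamma>])
    fix W
    assume "continuous_on {p i..p (i + 1)} W" "W ` {p i..p (i + 1)} \<subseteq> standard_triangle"
      "\<And>x. x \<in> {p i<..<p (i + 1)} \<Longrightarrow> W x = g (\<Gamma> x)"
      "\<And>x. x \<in> {p i..p (i + 1)} \<Longrightarrow> \<tau> (triangle_at i) (W x) = \<Gamma> x"
    then show thesis by (rule that)
  next
    show "p i < p (i + 1)" by (rule p_Suc)
    show "continuous_on {p i<..<p (i + 1)} (\<lambda>x. g (\<Gamma> x))"
      by (intro continuous_on_compose2[OF homeomorphism_cont2[OF g] \<Gamma>_continuous]) (use \<Gamma>_t in auto)
    show "(\<lambda>x. g (\<Gamma> x)) ` {p i<..<p (i + 1)} \<subseteq> standard_triangle"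
      using g_in interior_subset by blast
    show "compact standard_triangle" unfolding standard_triangle_def
      by (intro compact_convex_hull) simp
    show "continuous_on standard_triangle (\<tau> (triangle_at i))" by (rule map_continuous[OF t(1)])
    show "continuous_on {p i..p (i + 1)} \<Gamma>" by (rule \<Gamma>_continuous)
    show "\<tau> (triangle_at i) (g (\<Gamma> x)) = \<Gamma> x" if "x \<in> {p i<..<p (i + 1)}" for x
      by (rule homeomorphism_apply2[OF g \<Gamma>_t[OF that]])
    show "finite {z \<in> standard_triangle. \<tau> (triangle_at i) z = \<Gamma> (p i)}"
      "finite {z \<in> standard_triangle. \<tau> (triangle_at i) z = \<Gamma> (p (i + 1))}"
      by (rule fiber_finite(1)[OF t(1) \<Gamma>_p])+
  qed
  then show ?thesis using g_in by (intro exI[of _ W]) auto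
qed


definition lift :: "int \<Rightarrow> real \<Rightarrow> complex" where
  "lift i = (SOME W. continuous_on {p i..p (i + 1)} W \<and> W ` {p i..p (i + 1)} \<subseteq> standard_triangle \<and>
     (\<forall>x\<in>{p i<..<p (i + 1)}. W x \<in> interior standard_triangle) \<and>
     (\<forall>x\<in>{p i..p (i + 1)}. \<tau> (triangle_at i) (W x) = \<Gamma> x))"

lemma
  shows lift_continuous: "continuous_on {p i..p (i + 1)} (lift i)"
    and lift_range: "lift i ` {p i..p (i + 1)} \<subseteq> standard_triangle"
    and lift_interior: "x \<in> {p i<..<p (i + 1)} \<Longrightarrow> lift i x \<in> interior standard_triangle"
    and lift_map: "x \<in> {p i..p (i + 1)} \<Longrightarrow> \<tau> (triangle_at i) (lift i x) = \<Gamma> x"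
  using someI_ex[OF lifted_segment_exists[of i]] unfolding lift_def[symmetric] by blast+

lemma p_ends: "p i \<in> {p i..p (i + 1)}" "p (i + 1) \<in> {p i..p (i + 1)}"
  using p_Suc[of i] by auto

definition edge_coordinates :: "complex \<Rightarrow> nat \<times> real" where
  "edge_coordinates z = (SOME ku. fst ku < 3 \<and> snd ku \<in> {0<..<1} \<and> z = edge_point (fst ku) (snd ku))"

definition entry :: "int \<Rightarrow> nat \<times> real" where
  "entry i = edge_coordinates (lift i (p i))"

definition departure :: "int \<Rightarrow> nat \<times> real" where
  "departure i = edge_coordinates (lift i (p (i + 1)))"

lemma edge_coordinates:
  assumes "x \<in> {p i..p (i + 1)}" "\<Gamma> x \<in> arcs_union T rep" "ku = edge_coordinates (lift i x)"
  shows "fst ku < 3" "snd ku \<in> {0<..<1}" "lift i x = edge_point (fst ku) (snd ku)"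
proof -
  have "lift i x \<in> standard_triangle" using imageI[OF assms(1), of "lift i"] lift_range by blast
  then obtain k where "k < 3" "lift i x \<in> side k"
    using fiber_finite(2)[OF triangle_at(1)[of i] assms(2) _ lift_map[OF assms(1)]] by blast
  then have "\<exists>ku. fst ku < 3 \<and> snd ku \<in> {0<..<1} \<and> lift i x = edge_point (fst ku) (snd ku)"
    unfolding side_eq by force
  from someI_ex[OF this]
  show "fst ku < 3" "snd ku \<in> {0<..<1}" "lift i x = edge_point (fst ku) (snd ku)"
    unfolding assms(3) edge_coordinates_def by blast+
qed

lemmas entry = edge_coordinates[OF p_ends(1) \<Gamma>_p entry_def]
  and departure = edge_coordinates[OF p_ends(2) \<Gamma>_p departure_def]

lemma entry_side: "lift i (p i) \<in> side (fst (entry i))"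
  unfolding entry(3) side_eq using entry(2) by blast

lemma departure_side: "lift i (p (i + 1)) \<in> side (fst (departure i))"
  unfolding departure(3) side_eq using departure(2) by blast

text \<open>The walk on the dual graph: the crossing \<open>i\<close> ends on the local side
  \<open>b i\<close>, seen from the triangle entered, and begins on \<open>a i\<close>, seen from
  the triangle left. The vertex of a local side is its triangle, the first component.\<close>

definition b :: "int \<Rightarrow> 'a set \<times> nat" where "b i = (triangle_at i, fst (entry i))"

definition a :: "int \<Rightarrow> 'a set \<times> nat" where "a i = (triangle_at (i - 1), fst (departure (i - 1)))"

lemma side_at:
  assumes "k < 3" "z \<in> side k" "\<tau> (triangle_at i) z = \<Gamma> (p l)"
  shows "(triangle_at i, k) \<in> sides (arc_at l)"
proof -
  obtain e g where e: "e \<in> T" "homeomorphism (side k) (arc_interior (rep e)) (\<tau> (triangle_at i)) g"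
    using map_side[OF triangle_at(1) assms(1)] by blast
  have im: "\<tau> (triangle_at i) ` side k = arc_interior (rep e)" using homeomorphism_image1[OF e(2)] .
  then have "\<Gamma> (p l) \<in> arc_interior (rep e)" using assms(2,3) by (metis imageI)
  then have "e = arc_at l" by (rule arc_at_eq[OF e(1)])
  then show ?thesis using im assms(1) triangle_at(1) by (simp add: local_sides_def)
qed

lemma b_side: "b i \<in> sides (arc_at i)"
  unfolding b_def by (rule side_at[OF entry(1) entry_side lift_map[OF p_ends(1)]])

lemma a_side: "a i \<in> sides (arc_at i)"
proof -
  have "(triangle_at (i - 1), fst (departure (i - 1))) \<in> sides (arc_at (i - 1 + 1))"
    by (rule side_at[OF departure(1) departure_side lift_map[OF p_ends(2)]])
  then show ?thesis by (simp add: a_def)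
qed

lemma sides_arc_unique:
  assumes "e \<in> T" "e' \<in> T" "s \<in> sides e" "s \<in> sides e'"
  shows "e = e'"
proof (rule ccontr)
  assume "e \<noteq> e'"
  then have "arc_interior (rep e) \<inter> arc_interior (rep e') = {}" using rep_disjoint assms by blast
  moreover have "arc_interior (rep e) = arc_interior (rep e')"
    using assms by (cases s) (auto simp: local_sides_def)
  moreover have "arc_interior (rep e) \<noteq> {}" by (auto simp: arc_interior_def)
  ultimately show False by simp
qed

lemma lift_preimage:
  "{w \<in> interior standard_triangle. \<tau> (triangle_at i) w \<in> \<sigma> i} = lift i ` {p i<..<p (i + 1)}" (is "?L = ?R")
proof
  show "?R \<subseteq> ?L"
  proof
    fix w assume "w \<in> ?R"
    then obtain x where x: "x \<in> {p i<..<p (i + 1)}" "w = lift i x" by blast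
    then have "\<tau> (triangle_at i) w = \<Gamma> x" using lift_map[of x i] by simp
    then show "w \<in> ?L" using lift_interior[OF x(1)] x by (auto simp: \<sigma>_def)
  qed
  show "?L \<subseteq> ?R"
  proof
    fix w assume w: "w \<in> ?L"
    then obtain x where x: "x \<in> {p i<..<p (i + 1)}" "\<tau> (triangle_at i) w = \<Gamma> x" by (auto simp: \<sigma>_def)
    then have "\<tau> (triangle_at i) w = \<tau> (triangle_at i) (lift i x)" using lift_map[of x i] by simp
    then have "w = lift i x"
      using inj_onD[OF map_inj_interior[OF triangle_at(1)]] w lift_interior[OF x(1)] by blast
    then show "w \<in> ?R" using x(1) by blast
  qed
qed

text \<open>Taking the closure of the lifted open segment adds at most its two ends, and these lie
  on the entry side and on the departure side.\<close>

lemma attached_iff: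
  assumes "t \<in> triangles" "k < 3"
  shows "attached T rep \<tau> \<gamma> (t, k) j (\<sigma> i) \<longleftrightarrow>
    ((t, k) = b i \<and> j = \<Gamma> (p i)) \<or> ((t, k) = a (i + 1) \<and> j = \<Gamma> (p (i + 1)))"
proof
  assume "attached T rep \<tau> \<gamma> (t, k) j (\<sigma> i)"
  then obtain z where seg: "\<sigma> i \<subseteq> t" and z: "z \<in> side k" "\<tau> t z = j"
    "z \<in> closure {w \<in> interior standard_triangle. \<tau> t w \<in> \<sigma> i}"
    unfolding attached_def segments_in_def prod.case by blast
  have t: "t = triangle_at i" by (rule triangle_at_eq[OF assms(1) seg])
  have "closure (lift i ` {p i<..<p (i + 1)}) \<subseteq> lift i ` {p i..p (i + 1)}"
  proof (rule closure_minimal)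
    show "closed (lift i ` {p i..p (i + 1)})"
      by (intro compact_imp_closed compact_continuous_image lift_continuous) simp
  qed auto
  then have "z \<in> lift i ` {p i..p (i + 1)}" using z(3) unfolding t lift_preimage by blast
  then obtain x where x: "x \<in> {p i..p (i + 1)}" "z = lift i x" by blast
  have "x \<notin> {p i<..<p (i + 1)}"
    using lift_interior[of x i] side_disjoint_interior[OF assms(2)] z(1) x(2) by blast
  then consider "x = p i" | "x = p (i + 1)" using x(1) by fastforce
  then show "((t, k) = b i \<and> j = \<Gamma> (p i)) \<or> ((t, k) = a (i + 1) \<and> j = \<Gamma> (p (i + 1)))"
  proof cases
    case 1
    then have "k = fst (entry i)"
      using side_disjoint[OF assms(2) entry(1), of i] entry_side[of i] z(1) x(2) by blast
    moreover have "j = \<Gamma> (p i)" using z(2) x(2) t 1 lift_map[OF p_ends(1)] by simp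
    ultimately show ?thesis by (simp add: b_def t)
  next
    case 2
    then have "k = fst (departure i)"
      using side_disjoint[OF assms(2) departure(1), of i] departure_side[of i] z(1) x(2) by blast
    moreover have "j = \<Gamma> (p (i + 1))" using z(2) x(2) t 2 lift_map[OF p_ends(2)] by simp
    ultimately show ?thesis by (simp add: a_def t)
  qed
next
  have seg: "\<sigma> i \<in> segments_in T rep \<gamma> (triangle_at i)"
    using \<sigma>_component triangle_at(2) by (simp add: segments_in_def)
  have cl: "lift i x \<in> closure (lift i ` {p i<..<p (i + 1)})" if "x \<in> {p i..p (i + 1)}" for x
  proof -
    have c: "closure {p i<..<p (i + 1)} = {p i..p (i + 1)}" using p_Suc[of i] by simp
    have "lift i ` closure {p i<..<p (i + 1)} \<subseteq> closure (lift i ` {p i<..<p (i + 1)})"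
      by (rule image_closure_subset[OF _ closed_closure closure_subset]) (simp add: c lift_continuous)
    then show ?thesis using that unfolding c by blast
  qed
  assume "((t, k) = b i \<and> j = \<Gamma> (p i)) \<or> ((t, k) = a (i + 1) \<and> j = \<Gamma> (p (i + 1)))"
  then show "attached T rep \<tau> \<gamma> (t, k) j (\<sigma> i)"
  proof
    assume *: "(t, k) = b i \<and> j = \<Gamma> (p i)"
    then have t: "t = triangle_at i" "k = fst (entry i)" by (auto simp: b_def)
    show ?thesis unfolding attached_def t lift_preimage prod.case
      using seg entry_side[of i] cl[OF p_ends(1)] lift_map[OF p_ends(1), of i] * by blast
  next
    assume *: "(t, k) = a (i + 1) \<and> j = \<Gamma> (p (i + 1))"
    then have t: "t = triangle_at i" "k = fst (departure i)" by (auto simp: a_def)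
    show ?thesis unfolding attached_def t lift_preimage prod.case
      using seg departure_side[of i] cl[OF p_ends(2)] lift_map[OF p_ends(2), of i] * by blast
  qed
qed

lemma attached_b: "attached T rep \<tau> \<gamma> (b i) (\<Gamma> (p i)) (\<sigma> i)"
  using attached_iff[of "triangle_at i" "fst (entry i)" "\<Gamma> (p i)" i] triangle_at(1) entry(1)
  by (simp add: b_def)

lemma attached_a: "attached T rep \<tau> \<gamma> (a i) (\<Gamma> (p i)) (\<sigma> (i - 1))"
  using attached_iff[of "triangle_at (i - 1)" "fst (departure (i - 1))" "\<Gamma> (p i)" "i - 1"] triangle_at(1) departure(1)
  by (simp add: a_def)

lemma juncture_at: "\<Gamma> (p i) \<in> junctures rep \<gamma> (arc_at i)"
  using arc_at(2)[of i] \<Gamma>_path_image unfolding junctures_def by blast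

lemma attached_unique:
  assumes "s \<in> sides (arc_at i)" "attached T rep \<tau> \<gamma> s (\<Gamma> (p i)) \<rho>" "attached T rep \<tau> \<gamma> s (\<Gamma> (p i)) \<rho>'"
  shows "\<rho> = \<rho>'"
proof -
  have "\<exists>!\<rho>. attached T rep \<tau> \<gamma> s (\<Gamma> (p i)) \<rho>"
    using divided arc_at(1) juncture_at assms(1) unfolding divided_into_segments_def by blast
  then show ?thesis using assms by blast
qed

lemma arc_at_index: "\<Gamma> (p k) = \<Gamma> (p i) \<Longrightarrow> arc_at k = arc_at i"
  using \<Gamma>_p_eq arc_at_periodic by metis

lemma p_consecutive: "\<Gamma> (p i) \<noteq> \<Gamma> (p (i + 1))"
  using arc_at_index[of i "i + 1"] arc_at_distinct by metis

text \<open>\<open>lift\<close> is chosen separately for each index, so periodicity of its ends is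
  recovered from attachment and from the injectivity of the characteristic map on a side.\<close>

lemma entry_periodic:
  assumes "i mod n = k mod n"
  shows "b i = b k" "snd (entry i) = snd (entry k)"
proof -
  have eq: "\<Gamma> (p i) = \<Gamma> (p k)" "\<sigma> i = \<sigma> k" "triangle_at i = triangle_at k"
    by (rule iffD2[OF \<Gamma>_p_eq assms], rule iffD2[OF \<sigma>_eq assms], rule triangle_at_periodic[OF assms])
  have "attached T rep \<tau> \<gamma> (triangle_at i, fst (entry i)) (\<Gamma> (p k)) (\<sigma> k)"
    using attached_b[of i] eq by (simp add: b_def)
  then show "b i = b k"
    using attached_iff[OF triangle_at(1)[of i] entry(1)[of i], of "\<Gamma> (p k)" k] p_consecutive[of k]
    unfolding b_def[of i] by blast
  then have k: "fst (entry i) = fst (entry k)" by (simp add: b_def)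
  have "\<tau> (triangle_at k) (lift i (p i)) = \<tau> (triangle_at k) (lift k (p k))"
    using lift_map[OF p_ends(1), of i] lift_map[OF p_ends(1), of k] eq by simp
  then have "lift i (p i) = lift k (p k)"
    using inj_onD[OF map_inj_side[OF triangle_at(1) entry(1)]] entry_side[of i] entry_side[of k] k by metis
  then show "snd (entry i) = snd (entry k)" unfolding entry(3) k edge_point_inj .
qed

lemma departure_periodic:
  assumes "i mod n = k mod n"
  shows "a (i + 1) = a (k + 1)"
proof -
  have "(i + 1) mod n = (k + 1) mod n" using assms by (metis mod_add_left_eq)
  then have eq: "\<Gamma> (p (i + 1)) = \<Gamma> (p (k + 1))" "\<sigma> i = \<sigma> k"
    using assms by (simp_all only: \<Gamma>_p_eq \<sigma>_eq)
  have "attached T rep \<tau> \<gamma> (triangle_at i, fst (departure i)) (\<Gamma> (p (k + 1))) (\<sigma> k)"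
    using attached_a[of "i + 1"] eq by (simp add: a_def)
  then have "(triangle_at i, fst (departure i)) = a (k + 1)"
    using attached_iff[OF triangle_at(1)[of i] departure(1)[of i], of "\<Gamma> (p (k + 1))" k] p_consecutive[of k] by metis
  then show ?thesis by (simp add: a_def)
qed

text \<open>The curve crosses the arc: from each local side exactly one segment is attached to a
  juncture. Turning back would identify two consecutive segments, hence make \<open>n\<close> divide
  1 and two consecutive arcs equal.\<close>

lemma sides_distinct: "a i \<noteq> b i"
proof
  assume "a i = b i"
  then have "\<sigma> i = \<sigma> (i - 1)"
    using attached_unique[OF b_side attached_b] attached_a[of i] by metis
  then have "i mod n = (i - 1) mod n" by (simp add: \<sigma>_eq)
  then have "arc_at (i - 1) = arc_at (i - 1 + 1)" using arc_at_periodic[of i "i - 1"] by simp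
  then show False using arc_at_distinct by blast
qed

text \<open>From every local side of the arc some segment is attached to the juncture, and only the
  segments just before and just after the juncture end there. So a crossed arc has exactly two local
  sides.\<close>

lemma sides_arc_at: "sides (arc_at i) = {a i, b i}"
proof
  show "{a i, b i} \<subseteq> sides (arc_at i)" using a_side b_side by blast
  show "sides (arc_at i) \<subseteq> {a i, b i}"
  proof
    fix s assume s: "s \<in> sides (arc_at i)"
    then obtain \<rho> where \<rho>: "attached T rep \<tau> \<gamma> s (\<Gamma> (p i)) \<rho>"
      using divided arc_at(1) juncture_at unfolding divided_into_segments_def by blast
    obtain t k where tk: "s = (t, k)" by (cases s)
    have "\<rho> \<in> loop_segments T rep \<gamma>" using \<rho> unfolding attached_def tk segments_in_def by auto
    then obtain l where l: "\<rho> = \<sigma> l" unfolding loop_segments_eq by blast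
    have "t \<in> triangles" "k < 3" using sidesD s tk by blast+
    from attached_iff[OF this] \<rho>
    have "(s = b l \<and> \<Gamma> (p i) = \<Gamma> (p l)) \<or> (s = a (l + 1) \<and> \<Gamma> (p i) = \<Gamma> (p (l + 1)))"
      unfolding tk l by blast
    then show "s \<in> {a i, b i}"
    proof
      assume "s = b l \<and> \<Gamma> (p i) = \<Gamma> (p l)"
      then show ?thesis using entry_periodic(1)[of i l] \<Gamma>_p_eq by auto
    next
      assume *: "s = a (l + 1) \<and> \<Gamma> (p i) = \<Gamma> (p (l + 1))"
      then have "i mod n = (l + 1) mod n" using \<Gamma>_p_eq by simp
      then have "(i - 1) mod n = l mod n" by (metis add_diff_cancel_right' mod_diff_left_eq)
      then show ?thesis using departure_periodic[of "i - 1" l] * by simp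
    qed
  qed
qed

lemma same_arc: "s \<in> {a i, b i} \<Longrightarrow> s \<in> {a k, b k} \<Longrightarrow> {a i, b i} = {a k, b k}"
  using sides_arc_unique[of "arc_at i" "arc_at k" s] arc_at(1) sides_arc_at by metis

lemma same_arc_at: "s \<in> {a i, b i} \<Longrightarrow> s \<in> {a k, b k} \<Longrightarrow> arc_at i = arc_at k"
  using sides_arc_unique[of "arc_at i" "arc_at k" s] arc_at(1) sides_arc_at by metis

lemma b_eq_iff: "b i = b k \<longleftrightarrow> a i = a k"
proof
  assume "b i = b k"
  then show "a i = a k" using same_arc[of "b i" i k] sides_distinct by (auto simp: doubleton_eq_iff)
next
  assume "a i = a k"
  then show "b i = b k" using same_arc[of "a i" i k] sides_distinct[of k] by (auto simp: doubleton_eq_iff)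
qed

lemma b_eq_a: "b i = a k \<Longrightarrow> a i = b k"
  using same_arc[of "b i" i k] sides_distinct by (auto simp: doubleton_eq_iff)

lemma b_neq_a: "b i \<noteq> a (i + 1)"
proof
  assume "b i = a (i + 1)"
  then have "arc_at i = arc_at (i + 1)" using same_arc_at[of "b i" i "i + 1"] by simp
  then show False using arc_at_distinct by blast
qed

lemma entry_neq_departure: "fst (entry i) \<noteq> fst (departure i)"
  using b_neq_a[of i] by (simp add: a_def b_def)

section \<open>The walk is not a proper power\<close>

lemma parallel_noncrossing:
  assumes ik: "i mod n \<noteq> k mod n" and b: "b i = b k" and a: "a (i + 1) = a (k + 1)"
  shows "snd (entry i) < snd (entry k) \<longleftrightarrow> snd (departure k) < snd (departure i)"
proof -
  have t: "triangle_at k = triangle_at i" "fst (entry k) = fst (entry i)" "fst (departure k) = fst (departure i)"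
    using a b by (auto simp: a_def b_def)
  \<comment> \<open>Common interior points would give overlapping segments, common end points equal
    junctures; an entry cannot meet a departure because they lie on different sides.\<close>
  have disj: "lift i x \<noteq> lift k y" if x: "x \<in> {p i..p (i + 1)}" and y: "y \<in> {p k..p (k + 1)}" for x y
  proof
    assume eq: "lift i x = lift k y"
    then have \<Gamma>: "\<Gamma> x = \<Gamma> y" using lift_map[OF x] lift_map[OF y] t by simp
    have int: "lift l z \<in> interior standard_triangle \<longleftrightarrow> z \<in> {p l<..<p (l + 1)}" if "z \<in> {p l..p (l + 1)}" for l z
    proof (cases "z \<in> {p l<..<p (l + 1)}")
      case True then show ?thesis using lift_interior by blast
    next
      case False
      then have "z = p l \<or> z = p (l + 1)" using that by auto
      then show ?thesis
        using side_disjoint_interior[OF entry(1)[of l]] side_disjoint_interior[OF departure(1)[of l]]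
          entry_side[of l] departure_side[of l] False by blast
    qed
    show False
    proof (cases "x \<in> {p i<..<p (i + 1)}")
      case True
      then have "y \<in> {p k<..<p (k + 1)}" using int[OF x] int[OF y] eq by simp
      then have "\<Gamma> x \<in> \<sigma> k" unfolding \<Gamma> \<sigma>_def by (rule imageI)
      moreover have "\<Gamma> x \<in> \<sigma> i" unfolding \<sigma>_def using True by (rule imageI)
      ultimately show False using \<sigma>_disjoint ik by blast
    next
      case False
      then have xe: "x = p i \<or> x = p (i + 1)" using x by auto
      have "y \<notin> {p k<..<p (k + 1)}" using False int[OF x] int[OF y] eq by simp
      then have ye: "y = p k \<or> y = p (k + 1)" using y by auto
      have ik': "(i + 1) mod n \<noteq> (k + 1) mod n"
        using ik by (metis add_diff_cancel_right' mod_diff_left_eq)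
      have "side (fst (entry i)) \<inter> side (fst (departure i)) = {}"
        by (rule side_disjoint[OF entry(1) departure(1) entry_neq_departure])
      then show False
        using xe ye \<Gamma> \<Gamma>_p_eq ik ik' eq entry_side[of i] departure_side[of i] entry_side[of k] departure_side[of k] t
        by (metis disjoint_iff)
    qed
  qed
  define w where "w l = lift l \<circ> linepath (p l) (p (l + 1))" for l
  have im: "path_image (linepath (p l) (p (l + 1))) = {p l..p (l + 1)}" for l
    using p_Suc[of l] by (simp add: closed_segment_eq_real_ivl)
  have w: "path (w l)" "path_image (w l) = lift l ` {p l..p (l + 1)}" "path_image (w l) \<subseteq> standard_triangle"
    "pathstart (w l) = edge_point (fst (entry l)) (snd (entry l))"
    "pathfinish (w l) = edge_point (fst (departure l)) (snd (departure l))" for l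
  proof -
    show "path (w l)" unfolding w_def by (rule path_continuous_image) (simp_all add: im lift_continuous del: path_image_linepath)
    show 1: "path_image (w l) = lift l ` {p l..p (l + 1)}" unfolding w_def path_image_compose im ..
    show "path_image (w l) \<subseteq> standard_triangle" unfolding 1 by (rule lift_range)
    show "pathstart (w l) = edge_point (fst (entry l)) (snd (entry l))"
      "pathfinish (w l) = edge_point (fst (departure l)) (snd (departure l))"
      by (simp_all add: w_def pathstart_compose pathfinish_compose entry(3) departure(3))
  qed
  show ?thesis
  proof (rule noncrossing[OF entry(1)[of i] departure(1)[of i] entry_neq_departure w(1,3)[of i] w(1,3)[of k]])
    show "path_image (w i) \<inter> path_image (w k) = {}" unfolding w(2) using disj by blast
  qed (use w(4,5)[of i] w(4,5)[of k] t entry(2) departure(2) in auto)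
qed

text \<open>If the curve ran around a shorter combinatorial cycle several times, then comparing the
  positions of consecutive rounds along the arcs would give a quantity that is constant along the
  curve, because the surface is oriented; the positions of the rounds would then be strictly
  monotone although the curve closes up.\<close>

lemma walk_aperiodic:
  assumes m: "0 < m" "m < n"
  shows "\<exists>i. b (i + m) \<noteq> b i"
proof (rule ccontr)
  assume "\<not> ?thesis"
  then have b: "b (i + m) = b i" for i by blast
  then have a: "a (i + m) = a i" for i using b_eq_iff by blast
  have nm: "(i + m) mod n \<noteq> i mod n" for i
  proof
    assume "(i + m) mod n = i mod n"
    then have "n dvd m" by (metis add_diff_cancel_left' mod_eq_dvd_iff)
    then show False using m zdvd_not_zless by blast
  qed
  define s where "s i = snd (entry i)" for i
  define u where "u i = snd (departure i)" for i
  have tri: "triangle_at (i + m) = triangle_at i" for i using b[of i] by (simp add: b_def)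
  have ent: "fst (entry (i + m)) = fst (entry i)" for i using b[of i] by (simp add: b_def)
  have ext: "fst (departure (i + m)) = fst (departure i)" for i using a[of "i + 1"] by (simp add: a_def algebra_simps)
  have map_in: "\<tau> (triangle_at i) (edge_point (fst (entry i)) (s i)) = \<Gamma> (p i)" for i
    using lift_map[OF p_ends(1), of i] entry(3)[of i] by (simp add: s_def)
  have map_out: "\<tau> (triangle_at i) (edge_point (fst (departure i)) (u i)) = \<Gamma> (p (i + 1))" for i
    using lift_map[OF p_ends(2), of i] departure(3)[of i] by (simp add: u_def)
  have s_ne: "s i \<noteq> s (i + m)" for i
    using map_in[of i] map_in[of "i + m"] nm[of i] \<Gamma>_p_eq[of "i + m" i] tri ent by metis
  have u_ne: "u i \<noteq> u (i + m)" for i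
    using map_out[of i] map_out[of "i + m"] nm[of "i + 1"] \<Gamma>_p_eq[of "i + m + 1" "i + 1"] tri ext
    by (metis add.assoc add.commute)
  \<comment> \<open>\<open>X i\<close> says on which side of the current round the next round
    passes, measured by the orientation of the surface instead of the parameter of the side.\<close>
  define X where "X i \<longleftrightarrow> (s i < s (i + m) \<longleftrightarrow> orientation (triangle_at i) = 1)" for i
  have X: "X i \<longleftrightarrow> X (i + 1)" for i
  proof -
    \<comment> \<open>The order is reversed in passing through a triangle, and reversed once more in
      crossing an arc exactly if the two orientations agree; the sign in \<open>X\<close> absorbs
      the difference.\<close>
    have 1: "s i < s (i + m) \<longleftrightarrow> u (i + m) < u i"
      unfolding s_def u_def
      by (rule parallel_noncrossing) (use nm[of i] b[of i] a[of "i + 1"] in \<open>auto simp: algebra_simps\<close>)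
    have 2: "u i < u (i + m) \<longleftrightarrow> (if orientation (triangle_at i) = orientation (triangle_at (i + 1))
        then s (i + 1 + m) < s (i + 1) else s (i + 1) < s (i + 1 + m))"
    proof (rule gluing_order[OF arc_at(1)[of "i + 1"]])
      show "(triangle_at i, fst (departure i)) \<in> sides (arc_at (i + 1))" using a_side[of "i + 1"] by (simp add: a_def)
      show "(triangle_at (i + 1), fst (entry (i + 1))) \<in> sides (arc_at (i + 1))" using b_side[of "i + 1"] by (simp add: b_def)
      show "(triangle_at i, fst (departure i)) \<noteq> (triangle_at (i + 1), fst (entry (i + 1)))"
        using sides_distinct[of "i + 1"] by (simp add: a_def b_def)
      show "u i \<in> {0<..<1}" "u (i + m) \<in> {0<..<1}" "s (i + 1) \<in> {0<..<1}" "s (i + 1 + m) \<in> {0<..<1}"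
        using entry(2) departure(2) by (auto simp: s_def u_def)
      show "\<tau> (triangle_at i) (edge_point (fst (departure i)) (u i)) =
          \<tau> (triangle_at (i + 1)) (edge_point (fst (entry (i + 1))) (s (i + 1)))"
        using map_out[of i] map_in[of "i + 1"] by simp
      show "\<tau> (triangle_at i) (edge_point (fst (departure i)) (u (i + m))) =
          \<tau> (triangle_at (i + 1)) (edge_point (fst (entry (i + 1))) (s (i + 1 + m)))"
        using map_out[of "i + m"] map_in[of "i + 1 + m"] tri[of i] tri[of "i + 1"] ext[of i] ent[of "i + 1"]
        by (simp add: algebra_simps)
    qed
    show ?thesis
      using 1 2 u_ne[of i] s_ne[of "i + 1"]
        orientation_cases[OF triangle_at(1)[of i]] orientation_cases[OF triangle_at(1)[of "i + 1"]]
      unfolding X_def by (auto simp: not_less le_less split: if_splits)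
  qed
  have X_const: "X i = X 0" for i
  proof (induction i rule: int_induct[where k = 0])
    case (step1 i) then show ?case using X[of i] by simp
  next
    case (step2 i) then show ?case using X[of "i - 1"] by simp
  qed simp
  have tri0: "triangle_at (int j * m) = triangle_at 0" for j
  proof (induction j)
    case (Suc j) then show ?case using tri[of "int j * m"] by (simp add: algebra_simps)
  qed simp
  have step: "s (int j * m) < s (int (Suc j) * m) \<longleftrightarrow> s 0 < s m" for j
    using X_const[of "int j * m"] tri0[of j] unfolding X_def by (auto simp: algebra_simps)
  \<comment> \<open>After \<open>n\<close> rounds of length \<open>m\<close> the index has advanced
    by \<open>m\<close> full periods, so the position is the initial one, contradicting strict
    monotonicity.\<close>
  have periodic: "s (int (nat n) * m) = s 0"
    unfolding s_def by (rule entry_periodic(2)) (use m in auto)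
  have pos: "nat n > 0" using m by simp
  show False
  proof (cases "s 0 < s m")
    case True
    have "s 0 < s (int (Suc j) * m)" for j
    proof (induction j)
      case (Suc j) then show ?case using step[of "Suc j"] True by simp
    qed (simp add: True)
    from this[of "nat n - 1"] show False using periodic pos by simp
  next
    case False
    have dec: "s (int (Suc j) * m) < s (int j * m)" for j
      using step[of j] False s_ne[of "int j * m"] by (simp add: algebra_simps)
    have "s (int (Suc j) * m) < s 0" for j
    proof (induction j)
      case 0 then show ?case using dec[of 0] by simp
    next
      case (Suc j) then show ?case using dec[of "Suc j"] by simp
    qed
    from this[of "nat n - 1"] show False using periodic pos by simp
  qed
qed

sublocale walk: closed_walk n a b fst
proof
  fix i k m :: int
  show "n > 0" by (rule n_pos)
  show "b (i + n) = b i" by (rule entry_periodic(1)) simp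
  have "a (i - 1 + n + 1) = a (i - 1 + 1)" by (rule departure_periodic) simp
  then show "a (i + n) = a i" by (simp add: algebra_simps)
  show "fst (a (i + 1)) = fst (b i)" by (simp add: a_def b_def)
qed (use sides_distinct b_eq_iff b_eq_a b_neq_a walk_aperiodic in auto)

text \<open>A segment gets the height of the passage with its index. The stacking separates passages
  through the same triangle, which makes the orderings antisymmetric, and coherence along the edges
  is compatibility at the arcs.\<close>

theorem compatible_orderings_exist:
  "\<exists>R. (\<forall>t\<in>triangles. linear_order_on (segments_in T rep \<gamma> t) (R t)) \<and>
       (\<forall>e\<in>T. compatible_at M P T rep \<tau> \<gamma> R e)"
proof -
  obtain L where L: "walk.coherent L" and inj: "\<And>i k. fst (b i) = fst (b k) \<Longrightarrow> L i = L k \<Longrightarrow> i mod n = k mod n"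
    using walk.stacking by blast
  have L_per: "L i = L k" if "i mod n = k mod n" for i k
    by (rule periodic_cong[of L n]) (use walk.coherentD(1)[OF L] that in simp_all)
  have L_\<sigma>: "L i = L k" if "\<sigma> i = \<sigma> k" for i k using that \<sigma>_eq L_per by blast
  have le_b: "L i \<le> L k \<longleftrightarrow> L (i - 1) \<le> L (k - 1)" if "b i = b k" for i k
    using walk.coherentD(2)[OF L that] walk.coherent_eq(1)[OF L that] by linarith
  have le_a: "L i \<le> L (k - 1) \<longleftrightarrow> L (i - 1) \<le> L k" if "b i = a k" for i k
    using walk.coherentD(3)[OF L that] walk.coherent_eq(2)[OF L that] by linarith
  define R where "R t = {(\<sigma> i, \<sigma> k) | i k. triangle_at i = t \<and> triangle_at k = t \<and> L i \<le> L k}" for t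
  \<comment> \<open>\<open>L\<close> is periodic, so the relation does not depend on the indices
    chosen to represent the segments.\<close>
  have R_iff: "(\<sigma> i, \<sigma> k) \<in> R t \<longleftrightarrow> triangle_at i = t \<and> triangle_at k = t \<and> L i \<le> L k" for i k t
  proof
    assume "(\<sigma> i, \<sigma> k) \<in> R t"
    then obtain i' k' where "\<sigma> i = \<sigma> i'" "\<sigma> k = \<sigma> k'" "triangle_at i' = t" "triangle_at k' = t" "L i' \<le> L k'"
      unfolding R_def by blast
    then show "triangle_at i = t \<and> triangle_at k = t \<and> L i \<le> L k"
      using L_\<sigma> \<sigma>_eq triangle_at_periodic by metis
  qed (auto simp: R_def)
  have linear: "linear_order_on (segments_in T rep \<gamma> t) (R t)" if t: "t \<in> triangles" for t
  proof -
    have seg: "segments_in T rep \<gamma> t = {\<sigma> i | i. triangle_at i = t}"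
      unfolding segments_in_def loop_segments_eq using triangle_at triangle_at_eq[OF t] by blast
    have R_sub: "R t \<subseteq> segments_in T rep \<gamma> t \<times> segments_in T rep \<gamma> t"
      unfolding seg R_def by blast
    have "refl_on (segments_in T rep \<gamma> t) (R t)"
      unfolding refl_on_def seg using R_iff by blast
    moreover have "trans (R t)"
    proof (rule transI)
      fix x y z assume "(x, y) \<in> R t" "(y, z) \<in> R t"
      moreover from this obtain i k l where "x = \<sigma> i" "y = \<sigma> k" "z = \<sigma> l" unfolding R_def by blast
      ultimately show "(x, z) \<in> R t" using R_iff[of i k] R_iff[of k l] R_iff[of i l] by auto
    qed
    moreover have "antisym (R t)"
    proof (rule antisymI)
      fix x y assume xy: "(x, y) \<in> R t" "(y, x) \<in> R t"
      then obtain i k where ik: "x = \<sigma> i" "y = \<sigma> k" unfolding R_def by blast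
      then have "L i = L k" "triangle_at i = triangle_at k" using xy R_iff[of i k t] R_iff[of k i t] by auto
      then have "i mod n = k mod n" by (intro inj) (simp_all add: b_def)
      then show "x = y" using ik \<sigma>_eq by simp
    qed
    moreover have "total_on (segments_in T rep \<gamma> t) (R t)"
    proof (rule total_onI)
      fix x y assume "x \<in> segments_in T rep \<gamma> t" "y \<in> segments_in T rep \<gamma> t"
      then obtain i k where "x = \<sigma> i" "y = \<sigma> k" "triangle_at i = t" "triangle_at k = t" unfolding seg by blast
      then show "(x, y) \<in> R t \<or> (y, x) \<in> R t" using R_iff[of i k t] R_iff[of k i t] by auto
    qed
    ultimately show ?thesis
      using R_sub by (simp add: linear_order_on_def partial_order_on_def preorder_on_def)
  qed
  \<comment> \<open>One inclusion is enough, as the two local sides can be exchanged.\<close>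
  have sub: "induced_ordering T rep \<tau> \<gamma> R e s \<subseteq> induced_ordering T rep \<tau> \<gamma> R e s'"
    if e: "e \<in> T" and s: "s \<in> sides e" "s' \<in> sides e" for e s s'
  proof
    fix jj assume "jj \<in> induced_ordering T rep \<tau> \<gamma> R e s"
    then obtain j j' \<rho> \<rho>' where jj: "jj = (j, j')" "j \<in> junctures rep \<gamma> e" "j' \<in> junctures rep \<gamma> e"
      "attached T rep \<tau> \<gamma> s j \<rho>" "attached T rep \<tau> \<gamma> s j' \<rho>'" "(\<rho>, \<rho>') \<in> R (fst s)"
      unfolding induced_ordering_def by blast
    have junc: "\<exists>i. j = \<Gamma> (p i) \<and> arc_at i = e" if "j \<in> junctures rep \<gamma> e" for j
    proof -
      have "j \<in> arc_interior (rep e)" "j \<in> range \<Gamma>" using that \<Gamma>_path_image by (auto simp: junctures_def)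
      then obtain x where "j = \<Gamma> x" by blast
      moreover from this have "\<Gamma> x \<in> arcs_union T rep" using e \<open>j \<in> arc_interior (rep e)\<close> by (auto simp: arcs_union_def)
      ultimately obtain i where "j = \<Gamma> (p i)" using crossing_p by metis
      then show ?thesis using arc_at_eq[OF e] \<open>j \<in> arc_interior (rep e)\<close> by metis
    qed
    obtain i where i: "j = \<Gamma> (p i)" "arc_at i = e" using junc[OF jj(2)] by blast
    obtain k where k: "j' = \<Gamma> (p k)" "arc_at k = e" using junc[OF jj(3)] by blast
    \<comment> \<open>The index of the segment attached to juncture \<open>i\<close> from side
      \<open>s\<close>: the following one on the side \<open>b i\<close>, the preceding one on the
      side \<open>a i\<close>.\<close>
    define seg where "seg s i = (if s = b i then i else i - 1)" for s i
    have att: "attached T rep \<tau> \<gamma> s (\<Gamma> (p i)) (\<sigma> (seg s i))" "triangle_at (seg s i) = fst s"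
      if "s \<in> sides e" "arc_at i = e" for s i
    proof -
      have "s = a i \<or> s = b i" using that sides_arc_at[of i] by blast
      then show "attached T rep \<tau> \<gamma> s (\<Gamma> (p i)) (\<sigma> (seg s i))" "triangle_at (seg s i) = fst s"
        using attached_a[of i] attached_b[of i] sides_distinct[of i] by (auto simp: seg_def a_def b_def)
    qed
    have s_at: "s \<in> sides (arc_at i)" "s \<in> sides (arc_at k)" using s(1) i(2) k(2) by simp_all
    have "\<rho> = \<sigma> (seg s i)"
      by (rule attached_unique[OF s_at(1) jj(4)[unfolded i(1)] att(1)[OF s(1) i(2)]])
    moreover have "\<rho>' = \<sigma> (seg s k)"
      by (rule attached_unique[OF s_at(2) jj(5)[unfolded k(1)] att(1)[OF s(1) k(2)]])
    ultimately have le: "L (seg s i) \<le> L (seg s k)" using jj(6) R_iff by blast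
    have mem: "s \<in> {a i, b i}" "s' \<in> {a i, b i}" and same: "{a k, b k} = {a i, b i}"
      using s sides_arc_at[of i] sides_arc_at[of k] i k by auto
    \<comment> \<open>Both junctures lie on the same arc, crossed either in the same or in opposite
      directions; these cases correspond to the two order conditions of
      \<open>coherent\<close>.\<close>
    consider "b i = b k" "a i = a k" | "b i = a k" "a i = b k"
      using same sides_distinct[of i] sides_distinct[of k] by (auto simp: doubleton_eq_iff)
    then have "L (seg s' i) \<le> L (seg s' k)"
    proof cases
      case 1
      then show ?thesis
        using le le_b[OF 1(1)] sides_distinct[of i] mem by (auto simp: seg_def)
    next
      case 2
      then show ?thesis
        using le le_a[OF 2(1)] sides_distinct[of i] mem by (auto simp: seg_def)
    qed
    then have "(\<sigma> (seg s' i), \<sigma> (seg s' k)) \<in> R (fst s')" using att(2)[OF s(2)] i k R_iff by simp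
    then show "jj \<in> induced_ordering T rep \<tau> \<gamma> R e s'"
      unfolding induced_ordering_def using jj i k att(1)[OF s(2)] by blast
  qed
  have "compatible_at M P T rep \<tau> \<gamma> R e" if "e \<in> T" for e
    unfolding compatible_at_def using sub[OF that] by blast
  with linear show ?thesis by blast
qed

end

theorem theorem1p2:
  fixes M P :: "'a::t2_space set"
    and \<A> :: "('a set \<times> ('a \<Rightarrow> complex)) set"
    and g s :: nat
    and T :: "(real \<Rightarrow> 'a) set set"
    and rep :: "(real \<Rightarrow> 'a) set \<Rightarrow> real \<Rightarrow> 'a"
    and \<tau> :: "'a set \<Rightarrow> complex \<Rightarrow> 'a"
    and \<gamma> \<gamma>' :: "real \<Rightarrow> 'a"
  assumes "oriented_punctured_surface M \<A> P g s"
    and "ideal_triangulation M P T rep"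
    and "characteristic_maps M P T rep \<tau>"
    and "simple_loop (M - P) \<gamma>"
    and "\<not> retractible M P \<gamma>"
    and "deforms_to (M - P) \<gamma> \<gamma>'"
    and "divided_into_segments M P T rep \<tau> \<gamma>'"
    and "\<forall>\<sigma>\<in>loop_segments T rep \<gamma>'. connects_distinct_arcs T rep \<sigma>"
  shows "\<exists>R. (\<forall>t\<in>ideal_triangles M P T rep. linear_order_on (segments_in T rep \<gamma>' t) (R t)) \<and>
             (\<forall>e\<in>T. compatible_at M P T rep \<tau> \<gamma>' R e)"
proof -
  have arcs: "simple_ideal_path M P (rep e)" if "e \<in> T" for e
  proof -
    have "rep e \<in> e" "e \<in> ideal_arcs M P"
      using assms(2) that by (auto simp: ideal_triangulation_def disjoint_representatives_def)
    then show ?thesis by (auto simp: ideal_arcs_def arc_class_def)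
  qed
  interpret divided_curve M P \<A> T rep \<tau> \<gamma>'
  proof
    show "oriented_atlas M \<A>"
      using assms(1) by (simp add: oriented_punctured_surface_def closed_oriented_surface_def)
    show "arc_interior (rep e) \<subseteq> M - P" if "e \<in> T" for e
      using arcs[OF that] by (simp add: simple_ideal_path_def ideal_path_def)
    show "arc_interior (rep e) \<inter> arc_interior (rep e') = {}" if "e \<in> T" "e' \<in> T" "e \<noteq> e'" for e e'
      using assms(2) that by (simp add: ideal_triangulation_def disjoint_representatives_def)
    \<comment> \<open>Every stage of the deformation is a simple loop, in particular its
      end.\<close>
    show "simple_loop (M - P) \<gamma>'"
      using assms(6) homotopic_with_imp_property unfolding deforms_to_def by blast
  qed (use assms in auto)
  show ?thesis by (rule compatible_orderings_exist)
qed

end
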